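(* Let $k$ be any field, let $A$ be a finite-dimensional $k$-algebra and let $Q$ be its Gabriel quiver, with vertex set $Q_0$. Then $A$ admits a non-trivial directed stratification if and only if there exist disjoint non-empty subsets $Q_0'$ and $Q_0''$ of $Q_0$ such that: (1) $Q_0=Q_0'\cup Q_0''$; (2) for any $i\in Q_0'$ and $j\in Q_0''$ there is no path from $i$ to $j$ in $Q$.
   Context: A finite-dimensional $k$-algebra $A$ has a directed stratification of length $n$, given by $e_1,\dots,e_n$, if $e_1,\dots,e_n\in A$ are pairwise orthogonal non-zero idempotents (not necessarily primitive) with $\sum_{i=1}^n e_i=1_A$ and $e_iAe_j=0$ for all $i<j$. It is non-trivial if its length is $n\ge 2$. The Gabriel quiver (Ext-quiver) $Q$ of $A$ has as vertices the isomorphism classes of simple $A$-modules, and there is an arrow from $i$ to $j$ if and only if $\operatorname{Ext}^1_A(S_i,S_j)\neq 0$ (only the existence of arrows matters here). *)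

theory Defs
  imports "HOL-Algebra.QuotRing" "HOL-Algebra.Module"
begin

section \<open>Finite-dimensional algebras and directed stratifications\<close>

text \<open>
  The locale \<open>algebra\<close> of HOL-Algebra is restricted to commutative algebras. Here the product
  of \<open>A\<close> need not be commutative. The zero algebra is allowed.
\<close>

locale fin_dim_algebra = K?: field K + A?: ring A + module K A
  for K :: "('k, 'p) ring_scheme" (structure) and A :: "('k, 'a, 'q) module_scheme" (structure) +
  assumes smult_mult_left:
      "\<lbrakk>c \<in> carrier K; x \<in> carrier A; y \<in> carrier A\<rbrakk>
        \<Longrightarrow> (c \<odot>\<^bsub>A\<^esub> x) \<otimes>\<^bsub>A\<^esub> y = c \<odot>\<^bsub>A\<^esub> (x \<otimes>\<^bsub>A\<^esub> y)"
    and smult_mult_right: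
      "\<lbrakk>c \<in> carrier K; x \<in> carrier A; y \<in> carrier A\<rbrakk>
        \<Longrightarrow> x \<otimes>\<^bsub>A\<^esub> (c \<odot>\<^bsub>A\<^esub> y) = c \<odot>\<^bsub>A\<^esub> (x \<otimes>\<^bsub>A\<^esub> y)"
    and finite_spanning_set:
      "\<exists>B. finite B \<and> B \<subseteq> carrier A \<and>
        (\<forall>x \<in> carrier A. \<exists>c \<in> B \<rightarrow> carrier K. x = (\<Oplus>\<^bsub>A\<^esub>b\<in>B. c b \<odot>\<^bsub>A\<^esub> b))"

definition directed_stratification ::
    "('a, 'q) ring_scheme \<Rightarrow> nat \<Rightarrow> (nat \<Rightarrow> 'a) \<Rightarrow> bool" where
  "directed_stratification A n e \<longleftrightarrow>
     (\<forall>i \<in> {1..n}. e i \<in> carrier A \<and> e i \<noteq> \<zero>\<^bsub>A\<^esub> \<and> e i \<otimes>\<^bsub>A\<^esub> e i = e i) \<and>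
     (\<forall>i \<in> {1..n}. \<forall>j \<in> {1..n}. i \<noteq> j \<longrightarrow> e i \<otimes>\<^bsub>A\<^esub> e j = \<zero>\<^bsub>A\<^esub>) \<and>
     (\<Oplus>\<^bsub>A\<^esub>i\<in>{1..n}. e i) = \<one>\<^bsub>A\<^esub> \<and>
     (\<forall>i \<in> {1..n}. \<forall>j \<in> {1..n}. i < j \<longrightarrow>
        (\<forall>a \<in> carrier A. e i \<otimes>\<^bsub>A\<^esub> a \<otimes>\<^bsub>A\<^esub> e j = \<zero>\<^bsub>A\<^esub>))"

definition has_nontrivial_directed_stratification :: "('a, 'q) ring_scheme \<Rightarrow> bool" where
  "has_nontrivial_directed_stratification A \<longleftrightarrow>
     (\<exists>n e. n \<ge> 2 \<and> directed_stratification A n e)"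


section \<open>Modules over a not necessarily commutative ring\<close>

text \<open>
  The axioms are those of the locale \<open>module\<close>, without commutativity of \<open>R\<close>. The fields
  \<open>mult\<close> and \<open>one\<close> of the record \<open>M\<close> play no role. A module over an
  algebra is a module over the underlying ring; its vector space structure is induced.
\<close>

locale left_module = R?: ring R + M?: abelian_group M
  for R :: "('a, 'q) ring_scheme" (structure) and M :: "('a, 'm, 'r) module_scheme" (structure) +
  assumes smult_closed [simp, intro]:
      "\<lbrakk>a \<in> carrier R; x \<in> carrier M\<rbrakk> \<Longrightarrow> a \<odot>\<^bsub>M\<^esub> x \<in> carrier M"
    and smult_l_distr:
      "\<lbrakk>a \<in> carrier R; b \<in> carrier R; x \<in> carrier M\<rbrakk>
        \<Longrightarrow> (a \<oplus>\<^bsub>R\<^esub> b) \<odot>\<^bsub>M\<^esub> x = a \<odot>\<^bsub>M\<^esub> x \<oplus>\<^bsub>M\<^esub> b \<odot>\<^bsub>M\<^esub> x"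
    and smult_r_distr:
      "\<lbrakk>a \<in> carrier R; x \<in> carrier M; y \<in> carrier M\<rbrakk>
        \<Longrightarrow> a \<odot>\<^bsub>M\<^esub> (x \<oplus>\<^bsub>M\<^esub> y) = a \<odot>\<^bsub>M\<^esub> x \<oplus>\<^bsub>M\<^esub> a \<odot>\<^bsub>M\<^esub> y"
    and smult_assoc1:
      "\<lbrakk>a \<in> carrier R; b \<in> carrier R; x \<in> carrier M\<rbrakk>
        \<Longrightarrow> (a \<otimes>\<^bsub>R\<^esub> b) \<odot>\<^bsub>M\<^esub> x = a \<odot>\<^bsub>M\<^esub> (b \<odot>\<^bsub>M\<^esub> x)"
    and smult_one [simp]:
      "x \<in> carrier M \<Longrightarrow> \<one>\<^bsub>R\<^esub> \<odot>\<^bsub>M\<^esub> x = x"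

definition simple_module :: "('a, 'q) ring_scheme \<Rightarrow> ('a, 'm, 'r) module_scheme \<Rightarrow> bool" where
  "simple_module R M \<longleftrightarrow> left_module R M \<and> carrier M \<noteq> {\<zero>\<^bsub>M\<^esub>} \<and>
     (\<forall>H. submodule H R M \<longrightarrow> H = {\<zero>\<^bsub>M\<^esub>} \<or> H = carrier M)"

text \<open>Homomorphisms are extensional, so that they are determined by their values on the carrier.\<close>

definition mod_hom :: "('a, 'q) ring_scheme \<Rightarrow> ('a, 'm, 'r) module_scheme \<Rightarrow>
    ('a, 'n, 's) module_scheme \<Rightarrow> ('m \<Rightarrow> 'n) set" where
  "mod_hom R M N = {f \<in> carrier M \<rightarrow>\<^sub>E carrier N.
     (\<forall>x \<in> carrier M. \<forall>y \<in> carrier M. f (x \<oplus>\<^bsub>M\<^esub> y) = f x \<oplus>\<^bsub>N\<^esub> f y) \<and>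
     (\<forall>a \<in> carrier R. \<forall>x \<in> carrier M. f (a \<odot>\<^bsub>M\<^esub> x) = a \<odot>\<^bsub>N\<^esub> f x)}"

definition mod_iso :: "('a, 'q) ring_scheme \<Rightarrow> ('a, 'm, 'r) module_scheme \<Rightarrow>
    ('a, 'n, 's) module_scheme \<Rightarrow> bool" where
  "mod_iso R M N \<longleftrightarrow> (\<exists>f \<in> mod_hom R M N. bij_betw f (carrier M) (carrier N))"

definition hom_group :: "('a, 'q) ring_scheme \<Rightarrow> ('a, 'm, 'r) module_scheme \<Rightarrow>
    ('a, 'n, 's) module_scheme \<Rightarrow> ('m \<Rightarrow> 'n) monoid" where
  "hom_group R M N =
     \<lparr>carrier = mod_hom R M N,
      mult = (\<lambda>f g. \<lambda>x \<in> carrier M. f x \<oplus>\<^bsub>N\<^esub> g x),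
      one = (\<lambda>x \<in> carrier M. \<zero>\<^bsub>N\<^esub>)\<rparr>"


section \<open>Ext as a derived functor\<close>

text \<open>The free left module on a set \<open>X\<close>: finitely supported functions from \<open>X\<close> to \<open>R\<close>.\<close>

definition free_module :: "('a, 'q) ring_scheme \<Rightarrow> 'x set \<Rightarrow> ('a, 'x \<Rightarrow> 'a) module" where
  "free_module R X =
     \<lparr>carrier = {u. (\<forall>x. u x \<in> carrier R) \<and> finite {x. u x \<noteq> \<zero>\<^bsub>R\<^esub>} \<and> {x. u x \<noteq> \<zero>\<^bsub>R\<^esub>} \<subseteq> X},
      mult = undefined, one = undefined,
      zero = (\<lambda>x. \<zero>\<^bsub>R\<^esub>),
      add = (\<lambda>u v x. u x \<oplus>\<^bsub>R\<^esub> v x),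
      smult = (\<lambda>a u x. a \<otimes>\<^bsub>R\<^esub> u x)\<rparr>"

text \<open>
  For \<open>X \<subseteq> carrier M\<close>, the linear map from the free module on \<open>X\<close> to \<open>M\<close> sending the basis element
  of \<open>x\<close> to \<open>x\<close>. Its image is the submodule generated by \<open>X\<close>.
\<close>

definition free_eval :: "('a, 'q) ring_scheme \<Rightarrow> ('a, 'm, 'r) module_scheme \<Rightarrow> ('m \<Rightarrow> 'a) \<Rightarrow> 'm" where
  "free_eval R M u = (\<Oplus>\<^bsub>M\<^esub>x\<in>{x. u x \<noteq> \<zero>\<^bsub>R\<^esub>}. u x \<odot>\<^bsub>M\<^esub> x)"

text \<open>
  The beginning \<open>P2 \<rightarrow> P1 \<rightarrow> P0 \<rightarrow> M \<rightarrow> 0\<close> of the standard free resolution of \<open>M\<close>: \<open>P0\<close> is free on the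
  elements of \<open>M\<close>, and each further term is free on the elements of the kernel of the preceding
  map. All maps are instances of \<open>free_eval\<close>.
\<close>

definition res0 :: "('a, 'q) ring_scheme \<Rightarrow> ('a, 'm, 'r) module_scheme \<Rightarrow> ('a, 'm \<Rightarrow> 'a) module" where
  "res0 R M = free_module R (carrier M)"

definition res1 :: "('a, 'q) ring_scheme \<Rightarrow> ('a, 'm, 'r) module_scheme \<Rightarrow>
    ('a, ('m \<Rightarrow> 'a) \<Rightarrow> 'a) module" where
  "res1 R M = free_module R {u \<in> carrier (res0 R M). free_eval R M u = \<zero>\<^bsub>M\<^esub>}"

definition res2 :: "('a, 'q) ring_scheme \<Rightarrow> ('a, 'm, 'r) module_scheme \<Rightarrow>
    ('a, (('m \<Rightarrow> 'a) \<Rightarrow> 'a) \<Rightarrow> 'a) module" where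
  "res2 R M = free_module R {u \<in> carrier (res1 R M). free_eval R (res0 R M) u = \<zero>\<^bsub>res0 R M\<^esub>}"

definition ext1_cocycles :: "('a, 'q) ring_scheme \<Rightarrow> ('a, 'm, 'r) module_scheme \<Rightarrow>
    ('a, 'n, 's) module_scheme \<Rightarrow> ((('m \<Rightarrow> 'a) \<Rightarrow> 'a) \<Rightarrow> 'n) set" where
  "ext1_cocycles R M N = {f \<in> mod_hom R (res1 R M) N.
     \<forall>w \<in> carrier (res2 R M). f (free_eval R (res1 R M) w) = \<zero>\<^bsub>N\<^esub>}"

definition ext1_coboundaries :: "('a, 'q) ring_scheme \<Rightarrow> ('a, 'm, 'r) module_scheme \<Rightarrow>
    ('a, 'n, 's) module_scheme \<Rightarrow> ((('m \<Rightarrow> 'a) \<Rightarrow> 'a) \<Rightarrow> 'n) set" where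
  "ext1_coboundaries R M N =
     (\<lambda>g. \<lambda>v \<in> carrier (res1 R M). g (free_eval R (res0 R M) v)) ` mod_hom R (res0 R M) N"

text \<open>The first cohomology group of the complex obtained by applying \<open>Hom(-, N)\<close>.\<close>

definition Ext1 :: "('a, 'q) ring_scheme \<Rightarrow> ('a, 'm, 'r) module_scheme \<Rightarrow>
    ('a, 'n, 's) module_scheme \<Rightarrow> ((('m \<Rightarrow> 'a) \<Rightarrow> 'a) \<Rightarrow> 'n) set monoid" where
  "Ext1 R M N = (hom_group R (res1 R M) N)\<lparr>carrier := ext1_cocycles R M N\<rparr> Mod ext1_coboundaries R M N"


section \<open>The Gabriel quiver\<close>

text \<open>
  Isomorphism classes are formed among the simple modules whose elements are sets of elements
  of \<open>A\<close>. This covers all simple modules up to isomorphism, since each is a quotient of \<open>A\<close>; see the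
  lemma \<open>simple_module_representative\<close> below.
\<close>

definition gabriel_vertices :: "('a, 'q) ring_scheme \<Rightarrow> ('a, 'a set) module set set" where
  "gabriel_vertices A =
     {S. simple_module A S} //
       {(S, T). simple_module A S \<and> simple_module A T \<and> mod_iso A S T}"

lemma simple_module_representative:
  fixes R :: "('a, 'q) ring_scheme" and M :: "('a, 'm, 'r) module_scheme"
  assumes simp: "simple_module R M"
  shows "\<exists>S :: ('a, 'a set) module. simple_module R S \<and> mod_iso R M S"
proof -
  interpret left_module R M using simp by (simp add: simple_module_def)
  have smult_zero: "a \<odot>\<^bsub>M\<^esub> \<zero>\<^bsub>M\<^esub> = \<zero>\<^bsub>M\<^esub>" if "a \<in> carrier R" for a
    using smult_r_distr[OF that M.zero_closed M.zero_closed] that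
    by (metis M.add.r_cancel_one' M.r_zero M.zero_closed smult_closed)
  obtain x where x: "x \<in> carrier M" "x \<noteq> \<zero>\<^bsub>M\<^esub>"
    using simp M.zero_closed unfolding simple_module_def by blast
  let ?H = "(\<lambda>a. a \<odot>\<^bsub>M\<^esub> x) ` carrier R"
  have zero_smult: "\<zero>\<^bsub>R\<^esub> \<odot>\<^bsub>M\<^esub> x = \<zero>\<^bsub>M\<^esub>"
    using smult_l_distr[OF R.zero_closed R.zero_closed x(1)] x
    by (metis M.add.r_cancel_one' R.r_zero R.zero_closed smult_closed)
  have neg: "\<ominus>\<^bsub>M\<^esub> (a \<odot>\<^bsub>M\<^esub> x) = (\<ominus>\<^bsub>R\<^esub> a) \<odot>\<^bsub>M\<^esub> x" if "a \<in> carrier R" for a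
    using that x zero_smult smult_l_distr[of "\<ominus>\<^bsub>R\<^esub> a" a x]
    by (intro M.minus_equality) (auto simp: R.l_neg)
  have "submodule ?H R M"
  proof (intro submodule.intro submodule_axioms.intro M.add.subgroupI)
    show "?H \<subseteq> carrier M" using x by auto
    show "?H \<noteq> {}" by auto
    show "\<ominus>\<^bsub>M\<^esub> y \<in> ?H" if "y \<in> ?H" for y
      using that neg by auto
    show "y \<oplus>\<^bsub>M\<^esub> z \<in> ?H" if "y \<in> ?H" "z \<in> ?H" for y z
      using that x by (auto simp: smult_l_distr[symmetric])
    show "a \<odot>\<^bsub>M\<^esub> y \<in> ?H" if "a \<in> carrier R" "y \<in> ?H" for a y
      using that x by (auto simp: smult_assoc1[symmetric])
  qed
  moreover have "x \<in> ?H" using x by (metis R.one_closed image_eqI smult_one)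
  ultimately have gen: "?H = carrier M"
    using simp x unfolding simple_module_def by blast
  define h where "h y = {a \<in> carrier R. a \<odot>\<^bsub>M\<^esub> x = y}" for y
  define g where "g = the_inv_into (carrier M) h"
  have inj: "inj_on h (carrier M)"
  proof (rule inj_onI)
    fix y z assume yz: "y \<in> carrier M" "h y = h z"
    have "y \<in> ?H" using gen yz(1) by simp
    then obtain a where a: "a \<in> carrier R" "y = a \<odot>\<^bsub>M\<^esub> x" by (rule imageE)
    then have "a \<in> h y" by (simp add: h_def)
    then have "a \<in> h z" using yz(2) by simp
    then show "y = z" using a by (simp add: h_def)
  qed
  have gh [simp]: "g (h y) = y" if "y \<in> carrier M" for y
    unfolding g_def using the_inv_into_f_f[OF inj that] .
  define S :: "('a, 'a set) module" where
    "S = \<lparr>carrier = h ` carrier M, mult = undefined, one = undefined, zero = h \<zero>\<^bsub>M\<^esub>,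
          add = (\<lambda>s t. h (g s \<oplus>\<^bsub>M\<^esub> g t)), smult = (\<lambda>a s. h (a \<odot>\<^bsub>M\<^esub> g s))\<rparr>"
  have S_simps [simp]: "carrier S = h ` carrier M" "\<zero>\<^bsub>S\<^esub> = h \<zero>\<^bsub>M\<^esub>"
    "s \<oplus>\<^bsub>S\<^esub> t = h (g s \<oplus>\<^bsub>M\<^esub> g t)" "a \<odot>\<^bsub>S\<^esub> s = h (a \<odot>\<^bsub>M\<^esub> g s)" for s t a
    by (simp_all add: S_def)
  have "abelian_group S"
  proof (rule abelian_groupI)
    fix s assume "s \<in> carrier S"
    then obtain y where "y \<in> carrier M" "s = h y" by auto
    then have "h (\<ominus>\<^bsub>M\<^esub> y) \<in> carrier S" "h (\<ominus>\<^bsub>M\<^esub> y) \<oplus>\<^bsub>S\<^esub> s = \<zero>\<^bsub>S\<^esub>"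
      by (simp_all add: M.l_neg)
    then show "\<exists>t \<in> carrier S. t \<oplus>\<^bsub>S\<^esub> s = \<zero>\<^bsub>S\<^esub>" by blast
  qed (auto simp: M.a_ac)
  then have S: "left_module R S"
    by (intro left_module.intro left_module_axioms.intro R.ring_axioms)
       (auto simp: smult_l_distr smult_r_distr smult_assoc1)
  have sub: "submodule (g ` H) R M" and H_eq: "H = h ` g ` H" if "submodule H R S" for H
  proof -
    interpret H: submodule H R S by fact
    have Hc: "H \<subseteq> h ` carrier M" using H.subset by simp
    have HD: "\<exists>y \<in> carrier M. s = h y" if "s \<in> H" for s using Hc that by blast
    have gc: "g s \<in> carrier M" if "s \<in> H" for s using HD[OF that] by auto
    show eq: "H = h ` g ` H" using HD by (force simp: image_iff)
    interpret S: left_module R S by (rule S)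
    show "submodule (g ` H) R M"
    proof (intro submodule.intro submodule_axioms.intro M.add.subgroupI)
      show "g ` H \<subseteq> carrier M" using gc by auto
      show "g ` H \<noteq> {}" using H.one_closed by auto
      have add: "g s \<oplus>\<^bsub>M\<^esub> g t \<in> g ` H" if "s \<in> H" "t \<in> H" for s t
      proof -
        have "h (g s \<oplus>\<^bsub>M\<^esub> g t) \<in> H" using H.m_closed[OF that] by simp
        moreover have "g (h (g s \<oplus>\<^bsub>M\<^esub> g t)) = g s \<oplus>\<^bsub>M\<^esub> g t" using that gc by simp
        ultimately show ?thesis by (metis image_eqI)
      qed
      show "y \<oplus>\<^bsub>M\<^esub> z \<in> g ` H" if "y \<in> g ` H" "z \<in> g ` H" for y z
        using that add by auto
      show smul: "a \<odot>\<^bsub>M\<^esub> y \<in> g ` H" if a: "a \<in> carrier R" and y: "y \<in> g ` H" for a y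
      proof -
        obtain s where s: "s \<in> H" "y = g s" using y by blast
        have "h (a \<odot>\<^bsub>M\<^esub> g s) \<in> H" using H.smult_closed[OF a s(1)] by simp
        moreover have "g (h (a \<odot>\<^bsub>M\<^esub> g s)) = a \<odot>\<^bsub>M\<^esub> y" using s a gc by simp
        ultimately show ?thesis by (metis image_eqI)
      qed
      show "\<ominus>\<^bsub>M\<^esub> y \<in> g ` H" if y: "y \<in> g ` H" for y
      proof -
        have yc: "y \<in> carrier M" using y gc by auto
        have "(\<ominus>\<^bsub>R\<^esub> \<one>\<^bsub>R\<^esub>) \<odot>\<^bsub>M\<^esub> y \<oplus>\<^bsub>M\<^esub> y = (\<ominus>\<^bsub>R\<^esub> \<one>\<^bsub>R\<^esub> \<oplus>\<^bsub>R\<^esub> \<one>\<^bsub>R\<^esub>) \<odot>\<^bsub>M\<^esub> y"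
          using yc by (simp add: smult_l_distr)
        also have "\<dots> = \<zero>\<^bsub>M\<^esub>"
          using smult_l_distr[OF R.zero_closed R.zero_closed yc] yc
          by (metis M.add.r_cancel_one' R.l_neg R.one_closed R.r_zero R.zero_closed smult_closed)
        finally have "\<ominus>\<^bsub>M\<^esub> y = (\<ominus>\<^bsub>R\<^esub> \<one>\<^bsub>R\<^esub>) \<odot>\<^bsub>M\<^esub> y"
          using yc by (simp add: M.minus_equality)
        then show ?thesis using smul[OF _ y] by simp
      qed
    qed
  qed
  have "simple_module R S"
    unfolding simple_module_def
  proof (intro conjI allI impI S)
    show "carrier S \<noteq> {\<zero>\<^bsub>S\<^esub>}"
    proof
      assume "carrier S = {\<zero>\<^bsub>S\<^esub>}"
      then have "h x = h \<zero>\<^bsub>M\<^esub>" using x by auto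
      then show False using inj x by (simp add: inj_on_def)
    qed
    fix H assume H: "submodule H R S"
    have "g ` H = {\<zero>\<^bsub>M\<^esub>} \<or> g ` H = carrier M"
      using simp sub[OF H] unfolding simple_module_def by blast
    then show "H = {\<zero>\<^bsub>S\<^esub>} \<or> H = carrier S"
    proof
      assume "g ` H = {\<zero>\<^bsub>M\<^esub>}"
      then have "H = h ` {\<zero>\<^bsub>M\<^esub>}" using H_eq[OF H] by simp
      then show ?thesis by simp
    next
      assume "g ` H = carrier M"
      then have "H = h ` carrier M" using H_eq[OF H] by simp
      then show ?thesis by simp
    qed
  qed
  moreover have "mod_iso R M S"
    unfolding mod_iso_def
  proof (rule bexI)
    show "bij_betw (restrict h (carrier M)) (carrier M) (carrier S)"
      using inj by (simp add: bij_betw_def)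
    show "restrict h (carrier M) \<in> mod_hom R M S"
      by (auto simp: mod_hom_def)
  qed
  ultimately show ?thesis by blast
qed

definition gabriel_arrows ::
    "('a, 'q) ring_scheme \<Rightarrow> (('a, 'a set) module set \<times> ('a, 'a set) module set) set" where
  "gabriel_arrows A = {(i, j). i \<in> gabriel_vertices A \<and> j \<in> gabriel_vertices A \<and>
     (\<exists>S \<in> i. \<exists>T \<in> j. carrier (Ext1 A S T) \<noteq> {\<one>\<^bsub>Ext1 A S T\<^esub>})}"

end

theory Submission
  imports Defs
begin

text \<open>
  A stratification is reduced to a single idempotent \<open>f\<close> of \<open>A\<close>, different from \<open>0\<close> and \<open>1\<close>, with
  \<open>(1 - f) A f = 0\<close>; and the absence of paths from \<open>Q'\<close> to \<open>Q''\<close>, for sets that cover all vertices, is the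
  absence of arrows from \<open>Q'\<close> to \<open>Q''\<close>.

  Let first \<open>g\<close> be the first idempotent of a stratification, so that \<open>g a g = g a\<close> for all \<open>a\<close>. On each
  simple module \<open>g\<close> acts either as zero or as the identity
  (\<open>triangular_idempotent_on_simple\<close>), and both cases occur since \<open>g\<close> is neither \<open>0\<close> nor \<open>1\<close>. Let
  \<open>Q'\<close> consist of the simple modules annihilated by \<open>g\<close>. If \<open>S\<close> is annihilated by \<open>g\<close> and \<open>g\<close> is
  the identity on \<open>T\<close>, then every extension of \<open>S\<close> by \<open>T\<close> splits: for a linear map \<open>\<phi>\<close> to \<open>T\<close> from the
  kernel of a surjection from a free module onto \<open>S\<close>, the formula \<open>u \<mapsto> \<phi> (g u)\<close> defines an extension of
  \<open>\<phi>\<close> to the free module (\<open>Ext1_trivial_of_idempotent\<close>). So there is no arrow from \<open>Q'\<close> to \<open>Q''\<close>.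

  Conversely, given the partition, there is an idempotent \<open>f\<close> that acts as the identity on the simple
  modules in \<open>Q'\<close> and as zero on those in \<open>Q''\<close> (\<open>separating_idempotent\<close>). This needs neither the
  radical nor the structure of semisimple algebras: minimal left ideals with suitable
  properties give an element that acts in this way, and a Fitting-type argument replaces it by an
  idempotent. Then \<open>(1 - f) A f = 0\<close> follows from the vanishing of \<open>Ext1\<close>
  (\<open>idempotent_corner_zero\<close>): otherwise some quotient of \<open>A f\<close> has a least nonzero submodule \<open>T\<close>, which
  is simple in \<open>Q''\<close>, and the next simple subquotient above \<open>T\<close> is in \<open>Q'\<close>; but the extension splits
  (\<open>Ext1_trivial_imp_relative_complement\<close>), so that \<open>T\<close> is not the least nonzero submodule.

  Finite dimension is used only through the chain conditions on left ideals.
\<close>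

section \<open>Submodules and linear maps\<close>

lemma (in abelian_group) minus_eq_zero_iff:
  assumes "x \<in> carrier G" "y \<in> carrier G"
  shows "x \<ominus> y = \<zero> \<longleftrightarrow> x = y"
proof
  assume *: "x \<ominus> y = \<zero>"
  have "x = (x \<ominus> y) \<oplus> y" using assms by (simp add: a_minus_def a_assoc l_neg)
  then show "x = y" using * assms by simp
qed (use assms in \<open>simp add: a_minus_def r_neg\<close>)

context left_module
begin

lemma smult_l_null [simp]: "x \<in> carrier M \<Longrightarrow> \<zero> \<odot>\<^bsub>M\<^esub> x = \<zero>\<^bsub>M\<^esub>"
  using smult_l_distr[OF R.zero_closed R.zero_closed, of x]
  by (metis M.add.r_cancel_one' R.r_zero R.zero_closed smult_closed)

lemma smult_r_null [simp]: "a \<in> carrier R \<Longrightarrow> a \<odot>\<^bsub>M\<^esub> \<zero>\<^bsub>M\<^esub> = \<zero>\<^bsub>M\<^esub>"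
  using smult_r_distr[OF _ M.zero_closed M.zero_closed, of a]
  by (metis M.add.r_cancel_one' M.r_zero M.zero_closed smult_closed)

lemma smult_l_minus:
  "\<lbrakk>a \<in> carrier R; x \<in> carrier M\<rbrakk> \<Longrightarrow> (\<ominus> a) \<odot>\<^bsub>M\<^esub> x = \<ominus>\<^bsub>M\<^esub> (a \<odot>\<^bsub>M\<^esub> x)"
  using smult_l_distr[of "\<ominus> a" a x]
  by (intro M.minus_equality[symmetric]) (auto simp: R.l_neg)

lemma smult_r_minus:
  "\<lbrakk>a \<in> carrier R; x \<in> carrier M\<rbrakk> \<Longrightarrow> a \<odot>\<^bsub>M\<^esub> (\<ominus>\<^bsub>M\<^esub> x) = \<ominus>\<^bsub>M\<^esub> (a \<odot>\<^bsub>M\<^esub> x)"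
  using smult_r_distr[of a "\<ominus>\<^bsub>M\<^esub> x" x]
  by (intro M.minus_equality[symmetric]) (auto simp: M.l_neg)

lemma smult_minus_one: "x \<in> carrier M \<Longrightarrow> (\<ominus> \<one>) \<odot>\<^bsub>M\<^esub> x = \<ominus>\<^bsub>M\<^esub> x"
  by (simp add: smult_l_minus)

lemma submoduleI:
  assumes "H \<subseteq> carrier M" "\<zero>\<^bsub>M\<^esub> \<in> H"
    and "\<And>x y. \<lbrakk>x \<in> H; y \<in> H\<rbrakk> \<Longrightarrow> x \<oplus>\<^bsub>M\<^esub> y \<in> H"
    and "\<And>a x. \<lbrakk>a \<in> carrier R; x \<in> H\<rbrakk> \<Longrightarrow> a \<odot>\<^bsub>M\<^esub> x \<in> H"
  shows "submodule H R M"
proof (intro submodule.intro submodule_axioms.intro M.add.subgroupI)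
  show "\<ominus>\<^bsub>M\<^esub> x \<in> H" if "x \<in> H" for x
    using assms(1) assms(4)[of "\<ominus> \<one>" x] that smult_minus_one[of x] by auto
qed (use assms in auto)

lemma submoduleD:
  assumes "submodule H R M"
  shows "H \<subseteq> carrier M" "\<zero>\<^bsub>M\<^esub> \<in> H" "x \<in> H \<Longrightarrow> x \<in> carrier M"
    and "\<lbrakk>x \<in> H; y \<in> H\<rbrakk> \<Longrightarrow> x \<oplus>\<^bsub>M\<^esub> y \<in> H"
    and "\<lbrakk>a \<in> carrier R; x \<in> H\<rbrakk> \<Longrightarrow> a \<odot>\<^bsub>M\<^esub> x \<in> H"
    and "x \<in> H \<Longrightarrow> \<ominus>\<^bsub>M\<^esub> x \<in> H"
    and "\<lbrakk>x \<in> H; y \<in> H\<rbrakk> \<Longrightarrow> x \<ominus>\<^bsub>M\<^esub> y \<in> H"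
proof -
  interpret H: submodule H R M by fact
  show sub: "H \<subseteq> carrier M" using H.subset by simp
  then show "x \<in> H \<Longrightarrow> x \<in> carrier M" by auto
  show "\<zero>\<^bsub>M\<^esub> \<in> H" using H.one_closed by simp
  show *: "\<lbrakk>x \<in> H; y \<in> H\<rbrakk> \<Longrightarrow> x \<oplus>\<^bsub>M\<^esub> y \<in> H" for x y using H.m_closed by simp
  show sm: "\<lbrakk>a \<in> carrier R; x \<in> H\<rbrakk> \<Longrightarrow> a \<odot>\<^bsub>M\<^esub> x \<in> H" for a x using H.smult_closed by simp
  show neg: "x \<in> H \<Longrightarrow> \<ominus>\<^bsub>M\<^esub> x \<in> H" for x
    using sm[of "\<ominus> \<one>" x] sub smult_minus_one[of x]
    by (metis R.a_inv_closed R.one_closed subsetD)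
  show "\<lbrakk>x \<in> H; y \<in> H\<rbrakk> \<Longrightarrow> x \<ominus>\<^bsub>M\<^esub> y \<in> H"
    unfolding a_minus_def using * neg by blast
qed

lemma submodule_zero: "submodule {\<zero>\<^bsub>M\<^esub>} R M"
  by (rule submoduleI) auto

lemma submodule_carrier: "submodule (carrier M) R M"
  by (rule submoduleI) auto

lemma submodule_Int:
  "\<lbrakk>submodule H R M; submodule L R M\<rbrakk> \<Longrightarrow> submodule (H \<inter> L) R M"
  by (rule submoduleI) (use submoduleD[of H] submoduleD[of L] in auto)

lemma mem_set_add: "z \<in> H <+>\<^bsub>M\<^esub> L \<longleftrightarrow> (\<exists>x \<in> H. \<exists>y \<in> L. z = x \<oplus>\<^bsub>M\<^esub> y)"
  unfolding set_add_def' by blast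

lemma submodule_set_add:
  assumes "submodule H R M" "submodule L R M"
  shows "submodule (H <+>\<^bsub>M\<^esub> L) R M"
proof (rule submoduleI)
  note H = submoduleD[OF assms(1)] and L = submoduleD[OF assms(2)]
  show "H <+>\<^bsub>M\<^esub> L \<subseteq> carrier M" using H L by (auto simp: mem_set_add)
  show "\<zero>\<^bsub>M\<^esub> \<in> H <+>\<^bsub>M\<^esub> L" using H(2) L(2) by (force simp: mem_set_add)
  show "a \<odot>\<^bsub>M\<^esub> x \<in> H <+>\<^bsub>M\<^esub> L" if a: "a \<in> carrier R" and x: "x \<in> H <+>\<^bsub>M\<^esub> L" for a x
    using x a H(5) L(5) smult_r_distr[OF a H(3) L(3)] by (fastforce simp: mem_set_add)
  fix x y assume "x \<in> H <+>\<^bsub>M\<^esub> L" "y \<in> H <+>\<^bsub>M\<^esub> L"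
  then obtain h l h' l' where *: "h \<in> H" "l \<in> L" "h' \<in> H" "l' \<in> L"
    "x = h \<oplus>\<^bsub>M\<^esub> l" "y = h' \<oplus>\<^bsub>M\<^esub> l'" by (auto simp: mem_set_add)
  then have "x \<oplus>\<^bsub>M\<^esub> y = (h \<oplus>\<^bsub>M\<^esub> h') \<oplus>\<^bsub>M\<^esub> (l \<oplus>\<^bsub>M\<^esub> l')"
    using H(3) L(3) by (simp add: M.a_ac)
  then show "x \<oplus>\<^bsub>M\<^esub> y \<in> H <+>\<^bsub>M\<^esub> L" using * H(4) L(4) unfolding mem_set_add by blast
qed

lemma set_add_upper:
  assumes "submodule H R M" "submodule L R M"
  shows "H \<subseteq> H <+>\<^bsub>M\<^esub> L" "L \<subseteq> H <+>\<^bsub>M\<^esub> L"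
proof -
  note H = submoduleD[OF assms(1)] and L = submoduleD[OF assms(2)]
  show "H \<subseteq> H <+>\<^bsub>M\<^esub> L"
  proof
    fix x assume "x \<in> H"
    then show "x \<in> H <+>\<^bsub>M\<^esub> L" unfolding mem_set_add
      by (intro bexI[of _ x] bexI[of _ "\<zero>\<^bsub>M\<^esub>"]) (use H L in auto)
  qed
  show "L \<subseteq> H <+>\<^bsub>M\<^esub> L"
  proof
    fix x assume "x \<in> L"
    then show "x \<in> H <+>\<^bsub>M\<^esub> L" unfolding mem_set_add
      by (intro bexI[of _ "\<zero>\<^bsub>M\<^esub>"] bexI[of _ x]) (use H L in auto)
  qed
qed

lemma submodule_cyclic:
  assumes I: "\<And>a b. \<lbrakk>a \<in> I; b \<in> I\<rbrakk> \<Longrightarrow> a \<oplus> b \<in> I" "\<And>a b. \<lbrakk>a \<in> carrier R; b \<in> I\<rbrakk> \<Longrightarrow> a \<otimes> b \<in> I"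
    "\<zero> \<in> I" "I \<subseteq> carrier R" and x: "x \<in> carrier M"
  shows "submodule ((\<lambda>a. a \<odot>\<^bsub>M\<^esub> x) ` I) R M"
proof (rule submoduleI)
  show "\<zero>\<^bsub>M\<^esub> \<in> (\<lambda>a. a \<odot>\<^bsub>M\<^esub> x) ` I" using I(3) x by (metis image_eqI smult_l_null)
next
  fix y z assume "y \<in> (\<lambda>a. a \<odot>\<^bsub>M\<^esub> x) ` I" "z \<in> (\<lambda>a. a \<odot>\<^bsub>M\<^esub> x) ` I"
  then show "y \<oplus>\<^bsub>M\<^esub> z \<in> (\<lambda>a. a \<odot>\<^bsub>M\<^esub> x) ` I"
    using I x smult_l_distr[of _ _ x] by (smt (verit) image_iff subsetD)
next
  fix a y assume "a \<in> carrier R" "y \<in> (\<lambda>a. a \<odot>\<^bsub>M\<^esub> x) ` I"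
  then show "a \<odot>\<^bsub>M\<^esub> y \<in> (\<lambda>a. a \<odot>\<^bsub>M\<^esub> x) ` I"
    using I x smult_assoc1[of _ _ x] by (smt (verit) image_iff subsetD)
qed (use I x in auto)

end

text \<open>
  A linear map; in contrast to \<open>mod_hom\<close>, nothing is said about its values outside the carrier.
\<close>

definition module_map :: "('a, 'q) ring_scheme \<Rightarrow> ('a, 'm, 'r) module_scheme \<Rightarrow>
    ('a, 'n, 's) module_scheme \<Rightarrow> ('m \<Rightarrow> 'n) \<Rightarrow> bool" where
  "module_map R M N f \<longleftrightarrow> f \<in> carrier M \<rightarrow> carrier N \<and>
     (\<forall>x \<in> carrier M. \<forall>y \<in> carrier M. f (x \<oplus>\<^bsub>M\<^esub> y) = f x \<oplus>\<^bsub>N\<^esub> f y) \<and>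
     (\<forall>a \<in> carrier R. \<forall>x \<in> carrier M. f (a \<odot>\<^bsub>M\<^esub> x) = a \<odot>\<^bsub>N\<^esub> f x)"

lemma module_mapI:
  assumes "\<And>x. x \<in> carrier M \<Longrightarrow> f x \<in> carrier N"
    and "\<And>x y. \<lbrakk>x \<in> carrier M; y \<in> carrier M\<rbrakk> \<Longrightarrow> f (x \<oplus>\<^bsub>M\<^esub> y) = f x \<oplus>\<^bsub>N\<^esub> f y"
    and "\<And>a x. \<lbrakk>a \<in> carrier R; x \<in> carrier M\<rbrakk> \<Longrightarrow> f (a \<odot>\<^bsub>M\<^esub> x) = a \<odot>\<^bsub>N\<^esub> f x"
  shows "module_map R M N f"
  using assms by (auto simp: module_map_def)

lemma module_mapD:
  assumes "module_map R M N f"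
  shows "x \<in> carrier M \<Longrightarrow> f x \<in> carrier N"
    and "\<lbrakk>x \<in> carrier M; y \<in> carrier M\<rbrakk> \<Longrightarrow> f (x \<oplus>\<^bsub>M\<^esub> y) = f x \<oplus>\<^bsub>N\<^esub> f y"
    and "\<lbrakk>a \<in> carrier R; x \<in> carrier M\<rbrakk> \<Longrightarrow> f (a \<odot>\<^bsub>M\<^esub> x) = a \<odot>\<^bsub>N\<^esub> f x"
  using assms by (auto simp: module_map_def)

lemma mod_hom_iff: "f \<in> mod_hom R M N \<longleftrightarrow> f \<in> extensional (carrier M) \<and> module_map R M N f"
  by (auto simp: mod_hom_def module_map_def PiE_def)

lemma restrict_mod_hom:
  assumes "left_module R M" "module_map R M N f"
  shows "restrict f (carrier M) \<in> mod_hom R M N"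
proof -
  interpret left_module R M by fact
  show ?thesis using assms(2) by (auto simp: mod_hom_iff module_map_def)
qed

lemma module_map_comp:
  "\<lbrakk>module_map R L M f; module_map R M N g\<rbrakk> \<Longrightarrow> module_map R L N (\<lambda>x. g (f x))"
  by (auto simp: module_map_def Pi_iff)

lemma module_map_zero:
  assumes "left_module R M" "left_module R N" "module_map R M N f"
  shows "f \<zero>\<^bsub>M\<^esub> = \<zero>\<^bsub>N\<^esub>"
proof -
  interpret M: left_module R M by fact
  interpret N: left_module R N by fact
  show ?thesis
    using module_mapD(3)[OF assms(3) M.R.zero_closed M.M.zero_closed]
      module_mapD(1)[OF assms(3) M.M.zero_closed] by simp
qed

lemma module_map_uminus:
  assumes "left_module R M" "left_module R N" "module_map R M N f" "x \<in> carrier M"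
  shows "f (\<ominus>\<^bsub>M\<^esub> x) = \<ominus>\<^bsub>N\<^esub> f x"
proof -
  interpret M: left_module R M by fact
  interpret N: left_module R N by fact
  show ?thesis
    using module_mapD(3)[OF assms(3), of "\<ominus>\<^bsub>R\<^esub> \<one>\<^bsub>R\<^esub>" x] module_mapD(1)[OF assms(3)] assms(4)
    by (simp add: M.smult_minus_one N.smult_minus_one)
qed

lemma module_map_minus:
  assumes "left_module R M" "left_module R N" "module_map R M N f" "x \<in> carrier M" "y \<in> carrier M"
  shows "f (x \<ominus>\<^bsub>M\<^esub> y) = f x \<ominus>\<^bsub>N\<^esub> f y"
proof -
  interpret M: left_module R M by fact
  interpret N: left_module R N by fact
  show ?thesis using assms module_map_uminus[OF assms(1-3)] module_mapD(2)[OF assms(3)]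
    by (simp add: a_minus_def)
qed

lemma module_map_kernel:
  assumes "left_module R M" "left_module R N" "module_map R M N f"
  shows "submodule {x \<in> carrier M. f x = \<zero>\<^bsub>N\<^esub>} R M"
proof -
  interpret M: left_module R M by fact
  interpret N: left_module R N by fact
  show ?thesis
    by (rule M.submoduleI) (use module_map_zero[OF assms] module_mapD[OF assms(3)] in auto)
qed

lemma module_map_image:
  assumes "left_module R M" "left_module R N" "module_map R M N f"
  shows "submodule (f ` carrier M) R N"
proof -
  interpret M: left_module R M by fact
  interpret N: left_module R N by fact
  note f = module_mapD[OF assms(3)]
  show ?thesis
  proof (rule N.submoduleI)
    show "\<zero>\<^bsub>N\<^esub> \<in> f ` carrier M"
      using module_map_zero[OF assms] by (metis M.M.zero_closed image_eqI)
    show "x \<oplus>\<^bsub>N\<^esub> y \<in> f ` carrier M" if "x \<in> f ` carrier M" "y \<in> f ` carrier M" for x y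
      using that by (auto simp: f(2)[symmetric])
    show "a \<odot>\<^bsub>N\<^esub> x \<in> f ` carrier M" if "a \<in> carrier R" "x \<in> f ` carrier M" for a x
      using that by (auto simp: f(3)[symmetric])
  qed (use f in auto)
qed

lemma module_map_inj:
  assumes "left_module R M" "left_module R N" "module_map R M N f"
    and "\<And>x. \<lbrakk>x \<in> carrier M; f x = \<zero>\<^bsub>N\<^esub>\<rbrakk> \<Longrightarrow> x = \<zero>\<^bsub>M\<^esub>"
  shows "inj_on f (carrier M)"
proof (rule inj_onI)
  interpret M: left_module R M by fact
  interpret N: left_module R N by fact
  fix x y assume xy: "x \<in> carrier M" "y \<in> carrier M" "f x = f y"
  then have "f (x \<ominus>\<^bsub>M\<^esub> y) = \<zero>\<^bsub>N\<^esub>"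
    using module_map_minus[OF assms(1-3)] module_mapD(1)[OF assms(3)]
    by (simp add: N.M.r_neg a_minus_def)
  then have "x \<ominus>\<^bsub>M\<^esub> y = \<zero>\<^bsub>M\<^esub>" using assms(4) xy by simp
  then show "x = y" using xy M.M.minus_eq_zero_iff by blast
qed


section \<open>Isomorphisms and simple modules\<close>

lemma mod_iso_refl:
  assumes "left_module R M"
  shows "mod_iso R M M"
proof -
  interpret left_module R M by fact
  have "restrict id (carrier M) \<in> mod_hom R M M"
    by (rule restrict_mod_hom[OF assms]) (auto intro: module_mapI)
  then show ?thesis unfolding mod_iso_def
    by (rule bexI[rotated]) (simp add: bij_betw_def inj_on_def)
qed

lemma mod_iso_I:
  assumes "left_module R M" "module_map R M N f" "bij_betw f (carrier M) (carrier N)"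
  shows "mod_iso R M N"
  unfolding mod_iso_def using restrict_mod_hom[OF assms(1,2)] assms(3)
  by (intro bexI) (auto cong: bij_betw_cong)

lemma mod_iso_E:
  assumes "mod_iso R M N"
  obtains f where "module_map R M N f" "bij_betw f (carrier M) (carrier N)"
  using assms by (auto simp: mod_iso_def mod_hom_iff)

lemma mod_iso_trans:
  assumes "left_module R L" "mod_iso R L M" "mod_iso R M N"
  shows "mod_iso R L N"
proof -
  from assms(2) obtain f where f: "module_map R L M f" "bij_betw f (carrier L) (carrier M)"
    by (rule mod_iso_E)
  from assms(3) obtain g where g: "module_map R M N g" "bij_betw g (carrier M) (carrier N)"
    by (rule mod_iso_E)
  show ?thesis
    by (rule mod_iso_I[OF assms(1) module_map_comp[OF f(1) g(1)]])
      (use bij_betw_trans[OF f(2) g(2)] in \<open>simp add: comp_def\<close>)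
qed

lemma mod_iso_sym:
  assumes "left_module R M" "left_module R N" "mod_iso R M N"
  shows "mod_iso R N M"
proof -
  interpret M: left_module R M by fact
  interpret N: left_module R N by fact
  from assms(3) obtain f where f: "module_map R M N f" "bij_betw f (carrier M) (carrier N)"
    by (rule mod_iso_E)
  note f' = module_mapD[OF f(1)]
  define g where "g = the_inv_into (carrier M) f"
  have g: "bij_betw g (carrier N) (carrier M)"
    unfolding g_def by (rule bij_betw_the_inv_into[OF f(2)])
  have gc: "g y \<in> carrier M" "f (g y) = y" if "y \<in> carrier N" for y
    using bij_betwE[OF g] that f_the_inv_into_f_bij_betw[OF f(2)] by (auto simp: g_def)
  have gf: "g (f x) = x" if "x \<in> carrier M" for x
    unfolding g_def using f(2) that by (simp add: bij_betw_def the_inv_into_f_f)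
  have "module_map R N M g"
  proof (rule module_mapI)
    fix x y assume xy: "x \<in> carrier N" "y \<in> carrier N"
    then have "g (f (g x \<oplus>\<^bsub>M\<^esub> g y)) = g x \<oplus>\<^bsub>M\<^esub> g y" using gc by (intro gf) simp
    then show "g (x \<oplus>\<^bsub>N\<^esub> y) = g x \<oplus>\<^bsub>M\<^esub> g y" using xy gc f' by simp
  next
    fix a x assume xy: "a \<in> carrier R" "x \<in> carrier N"
    then have "g (f (a \<odot>\<^bsub>M\<^esub> g x)) = a \<odot>\<^bsub>M\<^esub> g x" using gc by (intro gf) simp
    then show "g (a \<odot>\<^bsub>N\<^esub> x) = a \<odot>\<^bsub>M\<^esub> g x" using xy gc f' by simp
  qed (use gc in auto)
  then show ?thesis using g by (rule mod_iso_I[OF assms(2)])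
qed

lemma simple_moduleD:
  assumes "simple_module R S"
  shows "left_module R S" "submodule H R S \<Longrightarrow> H = {\<zero>\<^bsub>S\<^esub>} \<or> H = carrier S"
    and "\<exists>s \<in> carrier S. s \<noteq> \<zero>\<^bsub>S\<^esub>"
proof -
  show S: "left_module R S" using assms by (simp add: simple_module_def)
  show "submodule H R S \<Longrightarrow> H = {\<zero>\<^bsub>S\<^esub>} \<or> H = carrier S"
    using assms by (simp add: simple_module_def)
  interpret left_module R S by fact
  show "\<exists>s \<in> carrier S. s \<noteq> \<zero>\<^bsub>S\<^esub>"
    using assms M.zero_closed unfolding simple_module_def by blast
qed

lemma simple_module_cyclic:
  assumes "simple_module R S" "s \<in> carrier S" "s \<noteq> \<zero>\<^bsub>S\<^esub>"
  shows "(\<lambda>a. a \<odot>\<^bsub>S\<^esub> s) ` carrier R = carrier S"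
proof -
  interpret left_module R S using assms(1) by (rule simple_moduleD)
  have "submodule ((\<lambda>a. a \<odot>\<^bsub>S\<^esub> s) ` carrier R) R S"
    by (rule submodule_cyclic) (use assms in auto)
  moreover have "s \<in> (\<lambda>a. a \<odot>\<^bsub>S\<^esub> s) ` carrier R"
    using assms(2) by (metis R.one_closed image_eqI smult_one)
  ultimately show ?thesis using simple_moduleD(2)[OF assms(1)] assms(3) by blast
qed

text \<open>
  Sending \<open>a t\<close> to \<open>a s\<close> is well defined by the hypothesis on annihilators, and a nonzero map
  between simple modules is bijective.
\<close>

lemma simple_module_iso_of_annihilator:
  assumes S: "simple_module R S" and T: "simple_module R T"
    and s: "s \<in> carrier S" "s \<noteq> \<zero>\<^bsub>S\<^esub>" and t: "t \<in> carrier T"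
    and ann: "\<And>a. \<lbrakk>a \<in> carrier R; a \<odot>\<^bsub>T\<^esub> t = \<zero>\<^bsub>T\<^esub>\<rbrakk> \<Longrightarrow> a \<odot>\<^bsub>S\<^esub> s = \<zero>\<^bsub>S\<^esub>"
  shows "mod_iso R T S"
proof -
  interpret S: left_module R S using S by (rule simple_moduleD)
  interpret T: left_module R T using T by (rule simple_moduleD)
  have t0: "t \<noteq> \<zero>\<^bsub>T\<^esub>"
    using ann[of "\<one>\<^bsub>R\<^esub>"] s t by auto
  define f where "f x = (SOME a. a \<in> carrier R \<and> a \<odot>\<^bsub>T\<^esub> t = x) \<odot>\<^bsub>S\<^esub> s" for x
  have f: "f (a \<odot>\<^bsub>T\<^esub> t) = a \<odot>\<^bsub>S\<^esub> s" if a: "a \<in> carrier R" for a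
  proof -
    define b where "b = (SOME b. b \<in> carrier R \<and> b \<odot>\<^bsub>T\<^esub> t = a \<odot>\<^bsub>T\<^esub> t)"
    have b: "b \<in> carrier R" "b \<odot>\<^bsub>T\<^esub> t = a \<odot>\<^bsub>T\<^esub> t"
      unfolding b_def using someI[of "\<lambda>b. b \<in> carrier R \<and> b \<odot>\<^bsub>T\<^esub> t = a \<odot>\<^bsub>T\<^esub> t" a] a by auto
    then have "(b \<oplus>\<^bsub>R\<^esub> \<ominus>\<^bsub>R\<^esub> a) \<odot>\<^bsub>T\<^esub> t = \<zero>\<^bsub>T\<^esub>"
      using a t by (simp add: T.smult_l_distr T.smult_l_minus T.M.r_neg)
    then have "(b \<oplus>\<^bsub>R\<^esub> \<ominus>\<^bsub>R\<^esub> a) \<odot>\<^bsub>S\<^esub> s = \<zero>\<^bsub>S\<^esub>" using a b by (intro ann) auto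
    then have "b \<odot>\<^bsub>S\<^esub> s \<ominus>\<^bsub>S\<^esub> a \<odot>\<^bsub>S\<^esub> s = \<zero>\<^bsub>S\<^esub>"
      using a b s by (simp add: S.smult_l_distr S.smult_l_minus a_minus_def)
    then show ?thesis using a b s by (simp add: f_def b_def[symmetric] S.M.minus_eq_zero_iff)
  qed
  have rep: "\<exists>a \<in> carrier R. x = a \<odot>\<^bsub>T\<^esub> t" if "x \<in> carrier T" for x
    using simple_module_cyclic[OF T t t0] that by blast
  have map: "module_map R T S f"
  proof (rule module_mapI)
    fix x assume "x \<in> carrier T"
    then obtain a where "a \<in> carrier R" "x = a \<odot>\<^bsub>T\<^esub> t" using rep by meson
    then show "f x \<in> carrier S" using f s by simp
  next
    fix x y assume "x \<in> carrier T" "y \<in> carrier T"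
    then obtain a b where *: "a \<in> carrier R" "b \<in> carrier R" "x = a \<odot>\<^bsub>T\<^esub> t" "y = b \<odot>\<^bsub>T\<^esub> t"
      using rep by meson
    then have "x \<oplus>\<^bsub>T\<^esub> y = (a \<oplus>\<^bsub>R\<^esub> b) \<odot>\<^bsub>T\<^esub> t" using t by (simp add: T.smult_l_distr)
    then show "f (x \<oplus>\<^bsub>T\<^esub> y) = f x \<oplus>\<^bsub>S\<^esub> f y" using * s by (simp add: f S.smult_l_distr)
  next
    fix c x assume c: "c \<in> carrier R" "x \<in> carrier T"
    then obtain a where *: "a \<in> carrier R" "x = a \<odot>\<^bsub>T\<^esub> t" using rep by meson
    then have "c \<odot>\<^bsub>T\<^esub> x = (c \<otimes>\<^bsub>R\<^esub> a) \<odot>\<^bsub>T\<^esub> t" using t c by (simp add: T.smult_assoc1)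
    then show "f (c \<odot>\<^bsub>T\<^esub> x) = c \<odot>\<^bsub>S\<^esub> f x" using * s c by (simp add: f S.smult_assoc1)
  qed
  have ft: "f t = s" using f[of "\<one>\<^bsub>R\<^esub>"] s t by simp
  have "{x \<in> carrier T. f x = \<zero>\<^bsub>S\<^esub>} = {\<zero>\<^bsub>T\<^esub>}"
    using simple_moduleD(2)[OF T module_map_kernel[OF T.left_module_axioms S.left_module_axioms map]]
      ft s t by auto
  then have "inj_on f (carrier T)"
    by (intro module_map_inj[OF T.left_module_axioms S.left_module_axioms map]) auto
  moreover have "f ` carrier T = carrier S"
    using simple_moduleD(2)[OF S module_map_image[OF T.left_module_axioms S.left_module_axioms map]]
      ft s t by auto
  ultimately show ?thesis
    by (intro mod_iso_I[OF T.left_module_axioms map]) (simp add: bij_betw_def)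
qed


section \<open>Subquotients\<close>

text \<open>
  The module \<open>W / V\<close> for submodules \<open>V \<subseteq> W\<close> of \<open>M\<close>. Its elements are cosets of \<open>V\<close>. The
  union over a coset only avoids choosing a representative: all members are equal.
\<close>

definition subquotient :: "('a, 'm, 'r) module_scheme \<Rightarrow> 'm set \<Rightarrow> 'm set \<Rightarrow> ('a, 'm set) module" where
  "subquotient M W V =
     \<lparr>carrier = (\<lambda>w. V +>\<^bsub>M\<^esub> w) ` W, mult = undefined, one = undefined, zero = V,
      add = (\<lambda>X Y. \<Union>x\<in>X. \<Union>y\<in>Y. V +>\<^bsub>M\<^esub> (x \<oplus>\<^bsub>M\<^esub> y)),
      smult = (\<lambda>a X. \<Union>x\<in>X. V +>\<^bsub>M\<^esub> (a \<odot>\<^bsub>M\<^esub> x))\<rparr>"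

context left_module
begin

lemma coset_mem_iff:
  assumes "submodule V R M" "x \<in> carrier M"
  shows "y \<in> V +>\<^bsub>M\<^esub> x \<longleftrightarrow> y \<in> carrier M \<and> y \<ominus>\<^bsub>M\<^esub> x \<in> V"
proof
  note V = submoduleD[OF assms(1)]
  assume "y \<in> V +>\<^bsub>M\<^esub> x"
  then obtain v where "v \<in> V" "y = v \<oplus>\<^bsub>M\<^esub> x" by (auto simp: a_r_coset_def')
  then show "y \<in> carrier M \<and> y \<ominus>\<^bsub>M\<^esub> x \<in> V"
    using V(3) assms(2) by (simp add: a_minus_def M.a_assoc M.r_neg)
next
  assume *: "y \<in> carrier M \<and> y \<ominus>\<^bsub>M\<^esub> x \<in> V"
  then have "y = (y \<ominus>\<^bsub>M\<^esub> x) \<oplus>\<^bsub>M\<^esub> x"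
    using assms(2) by (simp add: a_minus_def M.a_assoc M.l_neg)
  then show "y \<in> V +>\<^bsub>M\<^esub> x" using * unfolding a_r_coset_def' by blast
qed

lemma coset_self:
  assumes "submodule V R M" "x \<in> carrier M"
  shows "x \<in> V +>\<^bsub>M\<^esub> x"
  using assms submoduleD(2)[OF assms(1)] by (simp add: coset_mem_iff a_minus_def M.r_neg)

lemma coset_eq_iff:
  assumes "submodule V R M" "x \<in> carrier M" "y \<in> carrier M"
  shows "V +>\<^bsub>M\<^esub> x = V +>\<^bsub>M\<^esub> y \<longleftrightarrow> x \<ominus>\<^bsub>M\<^esub> y \<in> V"
proof
  assume "V +>\<^bsub>M\<^esub> x = V +>\<^bsub>M\<^esub> y"
  then show "x \<ominus>\<^bsub>M\<^esub> y \<in> V" using coset_self[OF assms(1,2)] assms by (simp add: coset_mem_iff)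
next
  assume "x \<ominus>\<^bsub>M\<^esub> y \<in> V"
  then have "x \<in> V +>\<^bsub>M\<^esub> y" using assms by (simp add: coset_mem_iff)
  then show "V +>\<^bsub>M\<^esub> x = V +>\<^bsub>M\<^esub> y"
    using M.a_repr_independence assms submodule.axioms(1)[OF assms(1)] by metis
qed

lemma coset_eq_self_iff:
  assumes "submodule V R M" "x \<in> carrier M"
  shows "V +>\<^bsub>M\<^esub> x = V \<longleftrightarrow> x \<in> V"
proof -
  have *: "\<ominus>\<^bsub>M\<^esub> \<zero>\<^bsub>M\<^esub> = \<zero>\<^bsub>M\<^esub>" by (simp add: M.minus_equality)
  have "x \<ominus>\<^bsub>M\<^esub> \<zero>\<^bsub>M\<^esub> = x" unfolding a_minus_def * using assms(2) by simp
  then show ?thesis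
    using coset_eq_iff[OF assms M.zero_closed] submoduleD(1)[OF assms(1)] by simp
qed

lemma subquotient_sel [simp]:
  "carrier (subquotient M W V) = (\<lambda>w. V +>\<^bsub>M\<^esub> w) ` W" "\<zero>\<^bsub>subquotient M W V\<^esub> = V"
  by (simp_all add: subquotient_def)

lemma subquotient_add:
  assumes V: "submodule V R M" and xy: "x \<in> carrier M" "y \<in> carrier M"
  shows "(V +>\<^bsub>M\<^esub> x) \<oplus>\<^bsub>subquotient M W V\<^esub> (V +>\<^bsub>M\<^esub> y) = V +>\<^bsub>M\<^esub> (x \<oplus>\<^bsub>M\<^esub> y)"
proof -
  have "V +>\<^bsub>M\<^esub> (x' \<oplus>\<^bsub>M\<^esub> y') = V +>\<^bsub>M\<^esub> (x \<oplus>\<^bsub>M\<^esub> y)" if "x' \<in> V +>\<^bsub>M\<^esub> x" "y' \<in> V +>\<^bsub>M\<^esub> y" for x' y'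
  proof -
    from that have *: "x' \<in> carrier M" "x' \<ominus>\<^bsub>M\<^esub> x \<in> V" "y' \<in> carrier M" "y' \<ominus>\<^bsub>M\<^esub> y \<in> V"
      using assms by (auto simp: coset_mem_iff)
    have "(x' \<oplus>\<^bsub>M\<^esub> y') \<ominus>\<^bsub>M\<^esub> (x \<oplus>\<^bsub>M\<^esub> y) = (x' \<ominus>\<^bsub>M\<^esub> x) \<oplus>\<^bsub>M\<^esub> (y' \<ominus>\<^bsub>M\<^esub> y)"
      using xy * by (simp add: a_minus_def M.minus_add M.a_ac)
    then show ?thesis using * xy V submoduleD(4)[OF V] by (simp add: coset_eq_iff)
  qed
  then have "(\<Union>x'\<in>V +>\<^bsub>M\<^esub> x. \<Union>y'\<in>V +>\<^bsub>M\<^esub> y. V +>\<^bsub>M\<^esub> (x' \<oplus>\<^bsub>M\<^esub> y')) =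
      (\<Union>x'\<in>V +>\<^bsub>M\<^esub> x. \<Union>y'\<in>V +>\<^bsub>M\<^esub> y. V +>\<^bsub>M\<^esub> (x \<oplus>\<^bsub>M\<^esub> y))"
    by (intro SUP_cong refl)
  also have "\<dots> = V +>\<^bsub>M\<^esub> (x \<oplus>\<^bsub>M\<^esub> y)" using coset_self[OF V] xy by blast
  finally show ?thesis by (simp add: subquotient_def)
qed

lemma subquotient_smult:
  assumes V: "submodule V R M" and x: "x \<in> carrier M" and a: "a \<in> carrier R"
  shows "a \<odot>\<^bsub>subquotient M W V\<^esub> (V +>\<^bsub>M\<^esub> x) = V +>\<^bsub>M\<^esub> (a \<odot>\<^bsub>M\<^esub> x)"
proof -
  have "V +>\<^bsub>M\<^esub> (a \<odot>\<^bsub>M\<^esub> x') = V +>\<^bsub>M\<^esub> (a \<odot>\<^bsub>M\<^esub> x)" if "x' \<in> V +>\<^bsub>M\<^esub> x" for x'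
  proof -
    from that have *: "x' \<in> carrier M" "x' \<ominus>\<^bsub>M\<^esub> x \<in> V"
      using assms by (auto simp: coset_mem_iff)
    have "a \<odot>\<^bsub>M\<^esub> x' \<ominus>\<^bsub>M\<^esub> a \<odot>\<^bsub>M\<^esub> x = a \<odot>\<^bsub>M\<^esub> (x' \<ominus>\<^bsub>M\<^esub> x)"
      using x a * by (simp add: a_minus_def smult_r_distr smult_r_minus)
    then show ?thesis using * x a V submoduleD(5)[OF V] by (simp add: coset_eq_iff)
  qed
  then have "(\<Union>x'\<in>V +>\<^bsub>M\<^esub> x. V +>\<^bsub>M\<^esub> (a \<odot>\<^bsub>M\<^esub> x')) = (\<Union>x'\<in>V +>\<^bsub>M\<^esub> x. V +>\<^bsub>M\<^esub> (a \<odot>\<^bsub>M\<^esub> x))"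
    by (intro SUP_cong refl)
  also have "\<dots> = V +>\<^bsub>M\<^esub> (a \<odot>\<^bsub>M\<^esub> x)" using coset_self[OF V x] by blast
  finally show ?thesis by (simp add: subquotient_def)
qed

lemma left_module_subquotient:
  assumes V: "submodule V R M" and W: "submodule W R M" and VW: "V \<subseteq> W"
  shows "left_module R (subquotient M W V)"
proof -
  note add = subquotient_add[OF V] and sm = subquotient_smult[OF V] and W' = submoduleD[OF W]
  have zero: "V +>\<^bsub>M\<^esub> \<zero>\<^bsub>M\<^esub> = V" using submoduleD(1)[OF V] by simp
  have [simp]: "x \<in> carrier M" if "x \<in> W" for x using W'(3) that .
  have "abelian_group (subquotient M W V)"
  proof (rule abelian_groupI)
    show "\<zero>\<^bsub>subquotient M W V\<^esub> \<in> carrier (subquotient M W V)"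
      using zero W'(2) by (metis image_eqI subquotient_sel)
  next
    fix X assume "X \<in> carrier (subquotient M W V)"
    then obtain x where x: "x \<in> W" "X = V +>\<^bsub>M\<^esub> x" by auto
    show "\<zero>\<^bsub>subquotient M W V\<^esub> \<oplus>\<^bsub>subquotient M W V\<^esub> X = X"
      using add[of "\<zero>\<^bsub>M\<^esub>" x] x zero by simp
    have "(V +>\<^bsub>M\<^esub> (\<ominus>\<^bsub>M\<^esub> x)) \<oplus>\<^bsub>subquotient M W V\<^esub> X = \<zero>\<^bsub>subquotient M W V\<^esub>"
      using x zero by (simp add: add M.l_neg)
    then show "\<exists>Y \<in> carrier (subquotient M W V). Y \<oplus>\<^bsub>subquotient M W V\<^esub> X = \<zero>\<^bsub>subquotient M W V\<^esub>"
      using x W'(6) by (intro bexI[of _ "V +>\<^bsub>M\<^esub> (\<ominus>\<^bsub>M\<^esub> x)"]) auto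
  qed (use W' in \<open>auto simp: add M.a_ac\<close>)
  then show ?thesis
    by (intro left_module.intro left_module_axioms.intro R.ring_axioms)
      (use W' in \<open>auto simp: add sm smult_l_distr smult_r_distr smult_assoc1\<close>)
qed

text \<open>The preimage in \<open>W\<close> of a submodule of \<open>W / V\<close>.\<close>

lemma submodule_coset_preimage:
  assumes V: "submodule V R M" and W: "submodule W R M" and VW: "V \<subseteq> W"
    and H: "submodule H R (subquotient M W V)"
  shows "submodule {w \<in> W. V +>\<^bsub>M\<^esub> w \<in> H} R M" "V \<subseteq> {w \<in> W. V +>\<^bsub>M\<^esub> w \<in> H}"
    and "H = (\<lambda>w. V +>\<^bsub>M\<^esub> w) ` {w \<in> W. V +>\<^bsub>M\<^esub> w \<in> H}"
proof -
  interpret Q: left_module R "subquotient M W V" by (rule left_module_subquotient[OF V W VW])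
  note H' = Q.submoduleD[OF H] and W' = submoduleD[OF W]
  have [simp]: "x \<in> carrier M" if "x \<in> W" for x using W'(3) that .
  show VH: "V \<subseteq> {w \<in> W. V +>\<^bsub>M\<^esub> w \<in> H}"
  proof
    fix v assume v: "v \<in> V"
    then have "V +>\<^bsub>M\<^esub> v = V" using coset_eq_self_iff[OF V] submoduleD(3)[OF V] by blast
    then show "v \<in> {w \<in> W. V +>\<^bsub>M\<^esub> w \<in> H}" using VW H'(2) v by auto
  qed
  show "submodule {w \<in> W. V +>\<^bsub>M\<^esub> w \<in> H} R M"
  proof (rule submoduleI)
    show "\<zero>\<^bsub>M\<^esub> \<in> {w \<in> W. V +>\<^bsub>M\<^esub> w \<in> H}" using VH submoduleD(2)[OF V] by blast
    show "x \<oplus>\<^bsub>M\<^esub> y \<in> {w \<in> W. V +>\<^bsub>M\<^esub> w \<in> H}"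
      if "x \<in> {w \<in> W. V +>\<^bsub>M\<^esub> w \<in> H}" "y \<in> {w \<in> W. V +>\<^bsub>M\<^esub> w \<in> H}" for x y
      using that H'(4)[of "V +>\<^bsub>M\<^esub> x" "V +>\<^bsub>M\<^esub> y"] W'(4) by (auto simp: subquotient_add[OF V])
    show "a \<odot>\<^bsub>M\<^esub> x \<in> {w \<in> W. V +>\<^bsub>M\<^esub> w \<in> H}"
      if "a \<in> carrier R" "x \<in> {w \<in> W. V +>\<^bsub>M\<^esub> w \<in> H}" for a x
      using that H'(5)[of a "V +>\<^bsub>M\<^esub> x"] W'(5) by (auto simp: subquotient_smult[OF V])
  qed auto
  show "H = (\<lambda>w. V +>\<^bsub>M\<^esub> w) ` {w \<in> W. V +>\<^bsub>M\<^esub> w \<in> H}"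
    using H'(1) by auto
qed

lemma simple_module_subquotient:
  assumes V: "submodule V R M" and W: "submodule W R M" and VW: "V \<subset> W"
    and no: "\<And>P. \<lbrakk>submodule P R M; V \<subset> P; P \<subseteq> W\<rbrakk> \<Longrightarrow> P = W"
  shows "simple_module R (subquotient M W V)"
  unfolding simple_module_def
proof (intro conjI allI impI)
  have VW': "V \<subseteq> W" using VW by auto
  note W' = submoduleD[OF W]
  show "left_module R (subquotient M W V)" by (rule left_module_subquotient[OF V W VW'])
  obtain w where w: "w \<in> W" "w \<notin> V" using VW by auto
  then have "V +>\<^bsub>M\<^esub> w \<noteq> V" using coset_eq_self_iff[OF V] W' by blast
  then show "carrier (subquotient M W V) \<noteq> {\<zero>\<^bsub>subquotient M W V\<^esub>}" using w by auto
  fix H assume H: "submodule H R (subquotient M W V)"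
  define P where "P = {w \<in> W. V +>\<^bsub>M\<^esub> w \<in> H}"
  note P = submodule_coset_preimage[OF V W VW' H, folded P_def]
  show "H = {\<zero>\<^bsub>subquotient M W V\<^esub>} \<or> H = carrier (subquotient M W V)"
  proof (cases "P = V")
    case True
    have "(\<lambda>w. V +>\<^bsub>M\<^esub> w) ` V = {V}"
      using coset_eq_self_iff[OF V] submoduleD(2,3)[OF V] by auto
    then show ?thesis using P(3) True by simp
  next
    case False
    then have "P = W" using P(1,2) by (intro no) (auto simp: P_def)
    then show ?thesis using P(3) by simp
  qed
qed

end


section \<open>Left ideals\<close>

text \<open>The ring as a left module over itself. Its submodules are the left ideals.\<close>

definition regular_module :: "('a, 'q) ring_scheme \<Rightarrow> ('a, 'a) module" where
  "regular_module R = \<lparr>carrier = carrier R, mult = undefined, one = undefined, zero = \<zero>\<^bsub>R\<^esub>,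
     add = add R, smult = mult R\<rparr>"

lemma regular_module_sel [simp]:
  "carrier (regular_module R) = carrier R" "\<zero>\<^bsub>regular_module R\<^esub> = \<zero>\<^bsub>R\<^esub>"
  "x \<oplus>\<^bsub>regular_module R\<^esub> y = x \<oplus>\<^bsub>R\<^esub> y" "x \<odot>\<^bsub>regular_module R\<^esub> y = x \<otimes>\<^bsub>R\<^esub> y"
  by (simp_all add: regular_module_def)

context ring
begin

lemma left_module_regular: "left_module R (regular_module R)"
proof -
  have "abelian_group (regular_module R)"
  proof (rule abelian_groupI)
    fix x assume "x \<in> carrier (regular_module R)"
    then have "\<ominus> x \<in> carrier (regular_module R)"
      "\<ominus> x \<oplus>\<^bsub>regular_module R\<^esub> x = \<zero>\<^bsub>regular_module R\<^esub>" by (simp_all add: l_neg)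
    then show "\<exists>y \<in> carrier (regular_module R). y \<oplus>\<^bsub>regular_module R\<^esub> x = \<zero>\<^bsub>regular_module R\<^esub>"
      by blast
  qed (simp_all add: a_ac)
  then show ?thesis
    by (intro left_module.intro left_module_axioms.intro ring_axioms)
      (auto simp: l_distr r_distr m_assoc)
qed

text \<open>Left annihilators and the left ideals \<open>L x\<close>, for \<open>L\<close> a left ideal.\<close>

lemma submodule_annihilator:
  assumes "left_module R S" "s \<in> carrier S"
  shows "submodule {a \<in> carrier R. a \<odot>\<^bsub>S\<^esub> s = \<zero>\<^bsub>S\<^esub>} R (regular_module R)"
proof -
  interpret S: left_module R S by fact
  interpret A: left_module R "regular_module R" by (rule left_module_regular)
  show ?thesis
    by (rule A.submoduleI) (use assms(2) in \<open>auto simp: S.smult_l_distr S.smult_assoc1\<close>)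
qed

lemma submodule_right_mult:
  assumes "submodule L R (regular_module R)" "x \<in> carrier R"
  shows "submodule ((\<lambda>a. a \<otimes> x) ` L) R (regular_module R)"
proof -
  interpret A: left_module R "regular_module R" by (rule left_module_regular)
  show ?thesis
    using A.submodule_cyclic[of L x] A.submoduleD[OF assms(1)] assms(2) by simp
qed

end


section \<open>Free modules and first extension groups\<close>

text \<open>
  The linear map from a free module to \<open>M\<close> with prescribed values \<open>h x\<close> on the basis elements. The map
  \<open>free_eval\<close> is the case where \<open>h\<close> is the identity.
\<close>

definition lin_ext :: "('a, 'q) ring_scheme \<Rightarrow> ('a, 'm, 'r) module_scheme \<Rightarrow> ('x \<Rightarrow> 'm) \<Rightarrow>
    ('x \<Rightarrow> 'a) \<Rightarrow> 'm" where
  "lin_ext R M h u = (\<Oplus>\<^bsub>M\<^esub>x\<in>{x. u x \<noteq> \<zero>\<^bsub>R\<^esub>}. u x \<odot>\<^bsub>M\<^esub> h x)"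

text \<open>The basis element of the free module at \<open>x\<close>.\<close>

definition basis_element :: "('a, 'q) ring_scheme \<Rightarrow> 'x \<Rightarrow> 'x \<Rightarrow> 'a" where
  "basis_element R x = (\<lambda>y. if y = x then \<one>\<^bsub>R\<^esub> else \<zero>\<^bsub>R\<^esub>)"

lemma free_eval_lin_ext: "free_eval R M = lin_ext R M (\<lambda>x. x)"
  by (rule ext) (simp add: free_eval_def lin_ext_def)

lemma free_module_sel [simp]:
  "carrier (free_module R X) =
    {u. (\<forall>x. u x \<in> carrier R) \<and> finite {x. u x \<noteq> \<zero>\<^bsub>R\<^esub>} \<and> {x. u x \<noteq> \<zero>\<^bsub>R\<^esub>} \<subseteq> X}"
  "\<zero>\<^bsub>free_module R X\<^esub> = (\<lambda>x. \<zero>\<^bsub>R\<^esub>)"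
  "u \<oplus>\<^bsub>free_module R X\<^esub> v = (\<lambda>x. u x \<oplus>\<^bsub>R\<^esub> v x)"
  "a \<odot>\<^bsub>free_module R X\<^esub> u = (\<lambda>x. a \<otimes>\<^bsub>R\<^esub> u x)"
  by (simp_all add: free_module_def)

context ring
begin

lemma left_module_free: "left_module R (free_module R X)"
proof -
  have add: "(\<lambda>x. u x \<oplus> v x) \<in> carrier (free_module R X)"
    if "u \<in> carrier (free_module R X)" "v \<in> carrier (free_module R X)" for u v
  proof -
    have *: "{x. u x \<oplus> v x \<noteq> \<zero>} \<subseteq> {x. u x \<noteq> \<zero>} \<union> {x. v x \<noteq> \<zero>}" by auto
    show ?thesis using that finite_subset[OF *] * by auto
  qed
  have smult: "(\<lambda>x. a \<otimes> u x) \<in> carrier (free_module R X)"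
    if "a \<in> carrier R" "u \<in> carrier (free_module R X)" for a u
  proof -
    have *: "{x. a \<otimes> u x \<noteq> \<zero>} \<subseteq> {x. u x \<noteq> \<zero>}" using that by auto
    show ?thesis using that finite_subset[OF *] * by auto
  qed
  have "abelian_group (free_module R X)"
  proof (rule abelian_groupI)
    fix u assume u: "u \<in> carrier (free_module R X)"
    have "(\<lambda>x. \<ominus> \<one> \<otimes> u x) \<oplus>\<^bsub>free_module R X\<^esub> u = \<zero>\<^bsub>free_module R X\<^esub>"
      using u by (auto simp: l_minus l_neg)
    then show "\<exists>v \<in> carrier (free_module R X). v \<oplus>\<^bsub>free_module R X\<^esub> u = \<zero>\<^bsub>free_module R X\<^esub>"
      using smult[of "\<ominus> \<one>" u] u by blast
  next
    fix u v assume "u \<in> carrier (free_module R X)" "v \<in> carrier (free_module R X)"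
    then show "u \<oplus>\<^bsub>free_module R X\<^esub> v \<in> carrier (free_module R X)" using add by simp
  qed (auto simp: a_ac)
  then show ?thesis
  proof (intro left_module.intro left_module_axioms.intro ring_axioms)
    fix a u assume "a \<in> carrier R" "u \<in> carrier (free_module R X)"
    then show "a \<odot>\<^bsub>free_module R X\<^esub> u \<in> carrier (free_module R X)" using smult by simp
  qed (auto simp: l_distr r_distr m_assoc)
qed

lemma basis_element_closed: "x \<in> X \<Longrightarrow> basis_element R x \<in> carrier (free_module R X)"
proof -
  assume x: "x \<in> X"
  have "{y. basis_element R x y \<noteq> \<zero>} \<subseteq> {x}" by (auto simp: basis_element_def)
  then have "finite {y. basis_element R x y \<noteq> \<zero>}" "{y. basis_element R x y \<noteq> \<zero>} \<subseteq> X"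
    using x finite_subset by (blast, blast)
  then show ?thesis by (simp add: basis_element_def)
qed

end

context left_module
begin

lemma lin_ext_superset:
  assumes u: "u \<in> carrier (free_module R X)" and h: "h \<in> X \<rightarrow> carrier M"
    and F: "finite F" "{x. u x \<noteq> \<zero>} \<subseteq> F" "F \<subseteq> X"
  shows "lin_ext R M h u = (\<Oplus>\<^bsub>M\<^esub>x\<in>F. u x \<odot>\<^bsub>M\<^esub> h x)"
  unfolding lin_ext_def
proof (rule M.add.finprod_mono_neutral_cong_left)
  show "(\<lambda>x. u x \<odot>\<^bsub>M\<^esub> h x) \<in> F \<rightarrow> carrier M" using u h F(3) by auto
  show "u x \<odot>\<^bsub>M\<^esub> h x = \<zero>\<^bsub>M\<^esub>" if "x \<in> F - {x. u x \<noteq> \<zero>}" for x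
    using that h F(3) by (auto simp: Pi_iff subset_iff)
qed (use F in auto)

lemma finsum_smult:
  assumes "finite F" "a \<in> carrier R" "f \<in> F \<rightarrow> carrier M"
  shows "a \<odot>\<^bsub>M\<^esub> (\<Oplus>\<^bsub>M\<^esub>x\<in>F. f x) = (\<Oplus>\<^bsub>M\<^esub>x\<in>F. a \<odot>\<^bsub>M\<^esub> f x)"
  using assms
proof (induction F rule: finite_induct)
  case (insert x F)
  then have "f \<in> F \<rightarrow> carrier M" "f x \<in> carrier M" "(\<lambda>x. a \<odot>\<^bsub>M\<^esub> f x) \<in> F \<rightarrow> carrier M" by auto
  then show ?case using insert by (simp add: smult_r_distr)
qed simp

lemma submodule_finsum:
  assumes H: "submodule H R M" and f: "f \<in> F \<rightarrow> H"
  shows "(\<Oplus>\<^bsub>M\<^esub>x\<in>F. f x) \<in> H"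
  using f
proof (induction F rule: infinite_finite_induct)
  case (insert x F)
  then have "f x \<in> H" "f \<in> F \<rightarrow> H" by auto
  moreover from this have "f x \<in> carrier M" "f \<in> F \<rightarrow> carrier M" using submoduleD(3)[OF H] by auto
  ultimately show ?case using insert submoduleD(4)[OF H] by simp
qed (use submoduleD(2)[OF H] in auto)

lemma lin_ext_in_submodule:
  assumes H: "submodule H R M" and h: "h \<in> X \<rightarrow> H" and u: "u \<in> carrier (free_module R X)"
  shows "lin_ext R M h u \<in> H"
  unfolding lin_ext_def using u h submoduleD(5)[OF H]
  by (intro submodule_finsum[OF H]) (auto simp: Pi_iff subset_iff)

lemma module_map_lin_ext_comp:
  assumes N: "left_module R N" and f: "module_map R M N f"
    and h: "h \<in> X \<rightarrow> carrier M" and u: "u \<in> carrier (free_module R X)"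
  shows "f (lin_ext R M h u) = lin_ext R N (\<lambda>x. f (h x)) u"
proof -
  interpret N: left_module R N by fact
  note f' = module_mapD[OF f]
  have "f (\<Oplus>\<^bsub>M\<^esub>x\<in>F. u x \<odot>\<^bsub>M\<^esub> h x) = (\<Oplus>\<^bsub>N\<^esub>x\<in>F. u x \<odot>\<^bsub>N\<^esub> f (h x))"
    if "finite F" "F \<subseteq> X" for F
    using that
  proof (induction F rule: finite_induct)
    case empty
    then show ?case using module_map_zero[OF left_module_axioms N f] by simp
  next
    case (insert x F)
    have c: "u y \<odot>\<^bsub>M\<^esub> h y \<in> carrier M" "u y \<odot>\<^bsub>N\<^esub> f (h y) \<in> carrier N"
      "f (u y \<odot>\<^bsub>M\<^esub> h y) = u y \<odot>\<^bsub>N\<^esub> f (h y)" if "y \<in> insert x F" for y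
    proof -
      have "h y \<in> carrier M" "u y \<in> carrier R" using that insert.prems h u by auto
      then show "u y \<odot>\<^bsub>M\<^esub> h y \<in> carrier M" "u y \<odot>\<^bsub>N\<^esub> f (h y) \<in> carrier N"
        "f (u y \<odot>\<^bsub>M\<^esub> h y) = u y \<odot>\<^bsub>N\<^esub> f (h y)" using f' by auto
    qed
    have "f (\<Oplus>\<^bsub>M\<^esub>y\<in>insert x F. u y \<odot>\<^bsub>M\<^esub> h y) =
      f (u x \<odot>\<^bsub>M\<^esub> h x \<oplus>\<^bsub>M\<^esub> (\<Oplus>\<^bsub>M\<^esub>y\<in>F. u y \<odot>\<^bsub>M\<^esub> h y))"
      using c insert.hyps by (subst M.finsum_insert) auto
    also have "\<dots> = u x \<odot>\<^bsub>N\<^esub> f (h x) \<oplus>\<^bsub>N\<^esub> (\<Oplus>\<^bsub>N\<^esub>y\<in>F. u y \<odot>\<^bsub>N\<^esub> f (h y))"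
      using c insert by (subst f'(2)) auto
    also have "\<dots> = (\<Oplus>\<^bsub>N\<^esub>y\<in>insert x F. u y \<odot>\<^bsub>N\<^esub> f (h y))"
      using c insert.hyps by (subst N.M.finsum_insert) auto
    finally show ?case .
  qed
  then show ?thesis using u by (simp add: lin_ext_def)
qed

lemma module_map_lin_ext:
  assumes h: "h \<in> X \<rightarrow> carrier M"
  shows "module_map R (free_module R X) M (lin_ext R M h)"
proof -
  interpret F: left_module R "free_module R X" by (rule R.left_module_free)
  show ?thesis
  proof (rule module_mapI)
    fix u assume u: "u \<in> carrier (free_module R X)"
    show "lin_ext R M h u \<in> carrier M"
      unfolding lin_ext_def using u h by (intro M.finsum_closed) auto
  next
    fix u v assume uv: "u \<in> carrier (free_module R X)" "v \<in> carrier (free_module R X)"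
    define F where "F = {x. u x \<noteq> \<zero>} \<union> {x. v x \<noteq> \<zero>}"
    have F: "finite F" "{x. u x \<noteq> \<zero>} \<subseteq> F" "{x. v x \<noteq> \<zero>} \<subseteq> F" "{x. u x \<oplus> v x \<noteq> \<zero>} \<subseteq> F" "F \<subseteq> X"
      using uv by (auto simp: F_def)
    have c: "u x \<odot>\<^bsub>M\<^esub> h x \<in> carrier M" "v x \<odot>\<^bsub>M\<^esub> h x \<in> carrier M"
      "(u x \<oplus> v x) \<odot>\<^bsub>M\<^esub> h x = u x \<odot>\<^bsub>M\<^esub> h x \<oplus>\<^bsub>M\<^esub> v x \<odot>\<^bsub>M\<^esub> h x" if "x \<in> F" for x
      using that F(5) h uv by (auto simp: smult_l_distr Pi_iff subset_iff)
    have "lin_ext R M h (u \<oplus>\<^bsub>free_module R X\<^esub> v) = (\<Oplus>\<^bsub>M\<^esub>x\<in>F. (u x \<oplus> v x) \<odot>\<^bsub>M\<^esub> h x)"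
      using lin_ext_superset[OF F.M.a_closed[OF uv] h, of F] F by simp
    also have "\<dots> = (\<Oplus>\<^bsub>M\<^esub>x\<in>F. u x \<odot>\<^bsub>M\<^esub> h x \<oplus>\<^bsub>M\<^esub> v x \<odot>\<^bsub>M\<^esub> h x)"
      using c by (intro M.finsum_cong') auto
    also have "\<dots> = (\<Oplus>\<^bsub>M\<^esub>x\<in>F. u x \<odot>\<^bsub>M\<^esub> h x) \<oplus>\<^bsub>M\<^esub> (\<Oplus>\<^bsub>M\<^esub>x\<in>F. v x \<odot>\<^bsub>M\<^esub> h x)"
      using c by (intro M.finsum_addf) auto
    also have "\<dots> = lin_ext R M h u \<oplus>\<^bsub>M\<^esub> lin_ext R M h v"
      using lin_ext_superset[OF uv(1) h F(1,2,5)] lin_ext_superset[OF uv(2) h F(1,3,5)] by simp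
    finally show "lin_ext R M h (u \<oplus>\<^bsub>free_module R X\<^esub> v) = lin_ext R M h u \<oplus>\<^bsub>M\<^esub> lin_ext R M h v" .
  next
    fix a u assume a: "a \<in> carrier R" and u: "u \<in> carrier (free_module R X)"
    define F where "F = {x. u x \<noteq> \<zero>}"
    have F: "finite F" "{x. u x \<noteq> \<zero>} \<subseteq> F" "{x. a \<otimes> u x \<noteq> \<zero>} \<subseteq> F" "F \<subseteq> X"
      using u a by (auto simp: F_def)
    have c: "u x \<odot>\<^bsub>M\<^esub> h x \<in> carrier M" "(a \<otimes> u x) \<odot>\<^bsub>M\<^esub> h x = a \<odot>\<^bsub>M\<^esub> (u x \<odot>\<^bsub>M\<^esub> h x)" if "x \<in> F" for x
      using that F(4) h u a by (auto simp: smult_assoc1 Pi_iff subset_iff)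
    have "lin_ext R M h (a \<odot>\<^bsub>free_module R X\<^esub> u) = (\<Oplus>\<^bsub>M\<^esub>x\<in>F. (a \<otimes> u x) \<odot>\<^bsub>M\<^esub> h x)"
      using lin_ext_superset[OF F.smult_closed[OF a u] h, of F] F by simp
    also have "\<dots> = (\<Oplus>\<^bsub>M\<^esub>x\<in>F. a \<odot>\<^bsub>M\<^esub> (u x \<odot>\<^bsub>M\<^esub> h x))"
      using c a by (intro M.finsum_cong') auto
    also have "\<dots> = a \<odot>\<^bsub>M\<^esub> (\<Oplus>\<^bsub>M\<^esub>x\<in>F. u x \<odot>\<^bsub>M\<^esub> h x)"
      using c a F(1) by (intro finsum_smult[symmetric]) auto
    also have "\<dots> = a \<odot>\<^bsub>M\<^esub> lin_ext R M h u"
      using lin_ext_superset[OF u h F(1,2,4)] by simp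
    finally show "lin_ext R M h (a \<odot>\<^bsub>free_module R X\<^esub> u) = a \<odot>\<^bsub>M\<^esub> lin_ext R M h u" .
  qed
qed

lemma lin_ext_basis_element:
  assumes h: "h \<in> X \<rightarrow> carrier M" and x: "x \<in> X"
  shows "lin_ext R M h (basis_element R x) = h x"
proof -
  have hx: "h x \<in> carrier M" using h x by auto
  have "lin_ext R M h (basis_element R x) = (\<Oplus>\<^bsub>M\<^esub>y\<in>{x}. basis_element R x y \<odot>\<^bsub>M\<^esub> h y)"
    by (rule lin_ext_superset[OF R.basis_element_closed[OF x] h])
      (use x in \<open>auto simp: basis_element_def\<close>)
  then show ?thesis using hx by (simp add: basis_element_def)
qed

end

text \<open>
  The kernel of \<open>P0 \<rightarrow> M\<close>, where \<open>P0\<close> is free on the elements of \<open>M\<close>. The next term \<open>P1\<close> of the standard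
  resolution is free on the elements of this kernel.
\<close>

definition relations :: "('a, 'q) ring_scheme \<Rightarrow> ('a, 'm, 'r) module_scheme \<Rightarrow> ('m \<Rightarrow> 'a) set" where
  "relations R M = {u \<in> carrier (res0 R M). free_eval R M u = \<zero>\<^bsub>M\<^esub>}"

lemma res1_relations: "res1 R M = free_module R (relations R M)"
  by (simp add: res1_def relations_def)

context left_module
begin

lemma left_module_res0: "left_module R (res0 R M)"
  unfolding res0_def by (rule R.left_module_free)

lemma left_module_res1: "left_module R (res1 R M)"
  unfolding res1_def by (rule R.left_module_free)

lemma module_map_eval0: "module_map R (res0 R M) M (free_eval R M)"
  unfolding res0_def free_eval_lin_ext by (rule module_map_lin_ext) auto

lemma submodule_relations: "submodule (relations R M) R (res0 R M)"
  unfolding relations_def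
  by (rule module_map_kernel[OF left_module_res0 left_module_axioms module_map_eval0])

lemma module_map_eval1: "module_map R (res1 R M) (res0 R M) (free_eval R (res0 R M))"
proof -
  interpret P: left_module R "res0 R M" by (rule left_module_res0)
  show ?thesis unfolding res1_relations free_eval_lin_ext
    by (rule P.module_map_lin_ext) (auto simp: relations_def)
qed

lemma eval1_basis_element:
  "u \<in> relations R M \<Longrightarrow> free_eval R (res0 R M) (basis_element R u) = u"
proof -
  interpret P: left_module R "res0 R M" by (rule left_module_res0)
  show "u \<in> relations R M \<Longrightarrow> ?thesis" unfolding free_eval_lin_ext
    by (rule P.lin_ext_basis_element[of _ "relations R M"]) (auto simp: relations_def)
qed

lemma eval1_in_relations:
  "v \<in> carrier (res1 R M) \<Longrightarrow> free_eval R (res0 R M) v \<in> relations R M"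
proof -
  interpret P: left_module R "res0 R M" by (rule left_module_res0)
  show "v \<in> carrier (res1 R M) \<Longrightarrow> ?thesis" unfolding free_eval_lin_ext res1_relations
    by (rule P.lin_ext_in_submodule[OF submodule_relations, of _ "relations R M"]) auto
qed

lemma ext1_cocycles_vanish:
  assumes f: "f \<in> ext1_cocycles R M N"
    and v: "v \<in> carrier (res1 R M)" "free_eval R (res0 R M) v = \<zero>\<^bsub>res0 R M\<^esub>"
  shows "f v = \<zero>\<^bsub>N\<^esub>"
proof -
  interpret P: left_module R "res1 R M" by (rule left_module_res1)
  let ?Z = "{v \<in> carrier (res1 R M). free_eval R (res0 R M) v = \<zero>\<^bsub>res0 R M\<^esub>}"
  have vZ: "v \<in> ?Z" using v by simp
  have "free_eval R (res1 R M) (basis_element R v) = v"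
    unfolding free_eval_lin_ext using vZ
    by (intro P.lin_ext_basis_element[of _ ?Z]) auto
  moreover have "basis_element R v \<in> carrier (res2 R M)"
    unfolding res2_def by (rule R.basis_element_closed[OF vZ])
  ultimately show ?thesis using f unfolding ext1_cocycles_def by force
qed

text \<open>
  The image of \<open>P2\<close> is the whole kernel of \<open>P1 \<rightarrow> P0\<close>, so a cocycle is a linear map on \<open>P1\<close> that
  vanishes on this kernel.
\<close>

lemma ext1_cocycle_iff:
  assumes N: "left_module R N"
  shows "f \<in> ext1_cocycles R M N \<longleftrightarrow> f \<in> mod_hom R (res1 R M) N \<and>
    (\<forall>v \<in> carrier (res1 R M). free_eval R (res0 R M) v = \<zero>\<^bsub>res0 R M\<^esub> \<longrightarrow> f v = \<zero>\<^bsub>N\<^esub>)"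
proof (intro iffI conjI ballI impI)
  assume f: "f \<in> ext1_cocycles R M N"
  then show "f \<in> mod_hom R (res1 R M) N" by (simp add: ext1_cocycles_def)
  show "f v = \<zero>\<^bsub>N\<^esub>" if "v \<in> carrier (res1 R M)" "free_eval R (res0 R M) v = \<zero>\<^bsub>res0 R M\<^esub>" for v
    using ext1_cocycles_vanish[OF f that] .
next
  assume *: "f \<in> mod_hom R (res1 R M) N \<and>
    (\<forall>v \<in> carrier (res1 R M). free_eval R (res0 R M) v = \<zero>\<^bsub>res0 R M\<^esub> \<longrightarrow> f v = \<zero>\<^bsub>N\<^esub>)"
  interpret P0: left_module R "res0 R M" by (rule left_module_res0)
  interpret P1: left_module R "res1 R M" by (rule left_module_res1)
  let ?Z = "{v \<in> carrier (res1 R M). free_eval R (res0 R M) v = \<zero>\<^bsub>res0 R M\<^esub>}"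
  have Z: "submodule ?Z R (res1 R M)"
    by (rule module_map_kernel[OF left_module_res1 left_module_res0 module_map_eval1])
  have "free_eval R (res1 R M) w \<in> ?Z" if w: "w \<in> carrier (res2 R M)" for w
    unfolding free_eval_lin_ext[of R "res1 R M"]
    by (rule P1.lin_ext_in_submodule[OF Z, of _ ?Z]) (use w in \<open>auto simp: res2_def\<close>)
  then show "f \<in> ext1_cocycles R M N" using * by (simp add: ext1_cocycles_def)
qed


text \<open>Two elements of \<open>P1\<close> with the same image in \<open>P0\<close> are not distinguished by a cocycle.\<close>

lemma ext1_cocycle_eq:
  assumes N: "left_module R N" and f: "f \<in> ext1_cocycles R M N"
    and vw: "v \<in> carrier (res1 R M)" "w \<in> carrier (res1 R M)"
      "free_eval R (res0 R M) v = free_eval R (res0 R M) w"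
  shows "f v = f w"
proof -
  interpret N: left_module R N by fact
  interpret P0: left_module R "res0 R M" by (rule left_module_res0)
  interpret P1: left_module R "res1 R M" by (rule left_module_res1)
  have map: "module_map R (res1 R M) N f"
    using f by (simp add: ext1_cocycle_iff[OF N] mod_hom_iff)
  have "free_eval R (res0 R M) (v \<ominus>\<^bsub>res1 R M\<^esub> w) = \<zero>\<^bsub>res0 R M\<^esub>"
    using module_map_minus[OF left_module_res1 left_module_res0 module_map_eval1 vw(1,2)] vw(3)
      module_mapD(1)[OF module_map_eval1 vw(2)] P0.M.minus_eq_zero_iff by simp
  then have "f (v \<ominus>\<^bsub>res1 R M\<^esub> w) = \<zero>\<^bsub>N\<^esub>"
    using ext1_cocycles_vanish[OF f] vw by simp
  then have "f v \<ominus>\<^bsub>N\<^esub> f w = \<zero>\<^bsub>N\<^esub>"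
    using module_map_minus[OF left_module_res1 N map vw(1,2)] by simp
  then show ?thesis using N.M.minus_eq_zero_iff module_mapD(1)[OF map] vw by blast
qed

text \<open>
  Hence a cocycle \<open>f\<close> factors through \<open>P1 \<rightarrow> ker (P0 \<rightarrow> M)\<close>, by the map whose value at a relation \<open>u\<close> is
  the value of \<open>f\<close> at the basis element of \<open>u\<close>.
\<close>

lemma ext1_cocycle_factor:
  assumes N: "left_module R N" and f: "f \<in> ext1_cocycles R M N"
  defines "\<phi> \<equiv> \<lambda>u. f (basis_element R u)"
  shows "u \<in> relations R M \<Longrightarrow> \<phi> u \<in> carrier N"
    and "\<lbrakk>u \<in> relations R M; v \<in> relations R M\<rbrakk> \<Longrightarrow> \<phi> (u \<oplus>\<^bsub>res0 R M\<^esub> v) = \<phi> u \<oplus>\<^bsub>N\<^esub> \<phi> v"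
    and "\<lbrakk>a \<in> carrier R; u \<in> relations R M\<rbrakk> \<Longrightarrow> \<phi> (a \<odot>\<^bsub>res0 R M\<^esub> u) = a \<odot>\<^bsub>N\<^esub> \<phi> u"
    and "v' \<in> carrier (res1 R M) \<Longrightarrow> f v' = \<phi> (free_eval R (res0 R M) v')"
proof -
  interpret N: left_module R N by fact
  interpret P0: left_module R "res0 R M" by (rule left_module_res0)
  interpret P1: left_module R "res1 R M" by (rule left_module_res1)
  note K = P0.submoduleD[OF submodule_relations] and e = module_mapD[OF module_map_eval1]
  have map: "module_map R (res1 R M) N f"
    using f by (simp add: ext1_cocycle_iff[OF N] mod_hom_iff)
  have b: "basis_element R u \<in> carrier (res1 R M)" if "u \<in> relations R M" for u
    using R.basis_element_closed[OF that] by (simp add: res1_relations)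
  show fac: "f v' = \<phi> (free_eval R (res0 R M) v')" if "v' \<in> carrier (res1 R M)" for v'
    unfolding \<phi>_def
    by (rule ext1_cocycle_eq[OF N f that b]) (use eval1_in_relations[OF that] eval1_basis_element in auto)
  show "\<phi> u \<in> carrier N" if "u \<in> relations R M" for u
    using module_mapD(1)[OF map] b that by (simp add: \<phi>_def)
  show "\<phi> (u \<oplus>\<^bsub>res0 R M\<^esub> v) = \<phi> u \<oplus>\<^bsub>N\<^esub> \<phi> v" if "u \<in> relations R M" "v \<in> relations R M" for u v
  proof -
    have "\<phi> u \<oplus>\<^bsub>N\<^esub> \<phi> v = f (basis_element R u \<oplus>\<^bsub>res1 R M\<^esub> basis_element R v)"
      using module_mapD(2)[OF map b b] that by (simp add: \<phi>_def)
    also have "\<dots> = \<phi> (u \<oplus>\<^bsub>res0 R M\<^esub> v)"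
      using fac[OF P1.M.a_closed[OF b b], of u v] that e(2)[OF b b, of u v]
      by (simp add: eval1_basis_element)
    finally show ?thesis ..
  qed
  show "\<phi> (a \<odot>\<^bsub>res0 R M\<^esub> u) = a \<odot>\<^bsub>N\<^esub> \<phi> u" if "a \<in> carrier R" "u \<in> relations R M" for a u
  proof -
    have "a \<odot>\<^bsub>N\<^esub> \<phi> u = f (a \<odot>\<^bsub>res1 R M\<^esub> basis_element R u)"
      using module_mapD(3)[OF map _ b] that by (simp add: \<phi>_def)
    also have "\<dots> = \<phi> (a \<odot>\<^bsub>res0 R M\<^esub> u)"
      using fac[OF P1.smult_closed[OF _ b], of a u] that e(3)[OF _ b, of a u]
      by (simp add: eval1_basis_element)
    finally show ?thesis ..
  qed
qed

lemma module_map_add: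
  assumes N: "left_module R N" and "module_map R M N f" "module_map R M N g"
  shows "module_map R M N (\<lambda>x. f x \<oplus>\<^bsub>N\<^esub> g x)"
proof -
  interpret N: left_module R N by fact
  note f = module_mapD[OF assms(2)] and g = module_mapD[OF assms(3)]
  show ?thesis
    by (rule module_mapI) (use f g in \<open>simp_all add: N.smult_r_distr N.M.a_ac\<close>)
qed

lemma module_map_minus_map:
  assumes N: "left_module R N" and "module_map R M N f" "module_map R M N g"
  shows "module_map R M N (\<lambda>x. f x \<ominus>\<^bsub>N\<^esub> g x)"
proof -
  interpret N: left_module R N by fact
  note f = module_mapD[OF assms(2)] and g = module_mapD[OF assms(3)]
  have "module_map R M N (\<lambda>x. \<ominus>\<^bsub>N\<^esub> g x)"
    by (rule module_mapI) (use g in \<open>simp_all add: N.smult_r_minus N.M.minus_add\<close>)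
  then show ?thesis using module_map_add[OF N assms(2)] by (simp add: a_minus_def)
qed

lemma coboundary_iff:
  "f \<in> ext1_coboundaries R M N \<longleftrightarrow> f \<in> extensional (carrier (res1 R M)) \<and>
    (\<exists>g. module_map R (res0 R M) N g \<and>
      (\<forall>v \<in> carrier (res1 R M). f v = g (free_eval R (res0 R M) v)))"
proof
  assume "f \<in> ext1_coboundaries R M N"
  then show "f \<in> extensional (carrier (res1 R M)) \<and>
    (\<exists>g. module_map R (res0 R M) N g \<and>
      (\<forall>v \<in> carrier (res1 R M). f v = g (free_eval R (res0 R M) v)))"
    by (auto simp: ext1_coboundaries_def mod_hom_iff)
next
  assume *: "f \<in> extensional (carrier (res1 R M)) \<and>
    (\<exists>g. module_map R (res0 R M) N g \<and>
      (\<forall>v \<in> carrier (res1 R M). f v = g (free_eval R (res0 R M) v)))"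
  then obtain g where g: "module_map R (res0 R M) N g"
    "\<And>v. v \<in> carrier (res1 R M) \<Longrightarrow> f v = g (free_eval R (res0 R M) v)" by blast
  have "f = (\<lambda>v \<in> carrier (res1 R M). restrict g (carrier (res0 R M)) (free_eval R (res0 R M) v))"
    using * g(2) module_mapD(1)[OF module_map_eval1]
    by (intro extensionalityI[of _ "carrier (res1 R M)"]) auto
  moreover have "restrict g (carrier (res0 R M)) \<in> mod_hom R (res0 R M) N"
    by (rule restrict_mod_hom[OF left_module_res0 g(1)])
  ultimately show "f \<in> ext1_coboundaries R M N" unfolding ext1_coboundaries_def by blast
qed

text \<open>
  As a quotient group, \<open>Ext1\<close> has the set of coboundaries as its unit element.
\<close>

lemma Ext1_trivial_iff:
  assumes N: "left_module R N"
  shows "carrier (Ext1 R M N) = {\<one>\<^bsub>Ext1 R M N\<^esub>} \<longleftrightarrow>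
    ext1_cocycles R M N \<subseteq> ext1_coboundaries R M N"
proof -
  interpret N: left_module R N by fact
  define G where "G = (hom_group R (res1 R M) N)\<lparr>carrier := ext1_cocycles R M N\<rparr>"
  define B where "B = ext1_coboundaries R M N"
  have mult: "f \<otimes>\<^bsub>G\<^esub> g = (\<lambda>v \<in> carrier (res1 R M). f v \<oplus>\<^bsub>N\<^esub> g v)" for f g
    by (simp add: G_def hom_group_def)
  have car: "carrier G = ext1_cocycles R M N" by (simp add: G_def)
  have Ext: "carrier (Ext1 R M N) = (\<Union>f\<in>carrier G. {B #>\<^bsub>G\<^esub> f})" "\<one>\<^bsub>Ext1 R M N\<^esub> = B"
    by (simp_all add: Ext1_def G_def B_def FactGroup_def RCOSETS_def)
  have coset: "B #>\<^bsub>G\<^esub> f = (\<lambda>h. h \<otimes>\<^bsub>G\<^esub> f) ` B" for f by (auto simp: r_coset_def)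
  have zero_map: "module_map R L N (\<lambda>v. \<zero>\<^bsub>N\<^esub>)" for L :: "('a, 'z, 'w) module_scheme"
    by (rule module_mapI) auto
  have zero: "(\<lambda>v \<in> carrier (res1 R M). \<zero>\<^bsub>N\<^esub>) \<in> B"
    unfolding B_def coboundary_iff using zero_map by auto
  have zero': "(\<lambda>v \<in> carrier (res1 R M). \<zero>\<^bsub>N\<^esub>) \<in> carrier G"
    unfolding car ext1_cocycle_iff[OF N]
    using restrict_mod_hom[OF left_module_res1 zero_map] by auto
  show ?thesis
  proof
    assume triv: "carrier (Ext1 R M N) = {\<one>\<^bsub>Ext1 R M N\<^esub>}"
    show "ext1_cocycles R M N \<subseteq> ext1_coboundaries R M N"
    proof
      fix f assume f: "f \<in> ext1_cocycles R M N"
      then have f': "f \<in> extensional (carrier (res1 R M))"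
        "\<And>v. v \<in> carrier (res1 R M) \<Longrightarrow> f v \<in> carrier N"
        by (auto simp: ext1_cocycle_iff[OF N] mod_hom_iff module_map_def)
      have "B #>\<^bsub>G\<^esub> f = B" using triv f unfolding Ext car by auto
      moreover have "(\<lambda>v \<in> carrier (res1 R M). \<zero>\<^bsub>N\<^esub>) \<otimes>\<^bsub>G\<^esub> f = f"
        unfolding mult using f' by (intro extensionalityI[of _ "carrier (res1 R M)"]) auto
      ultimately show "f \<in> ext1_coboundaries R M N"
        using zero unfolding coset B_def[symmetric] by (metis imageI)
    qed
  next
    assume sub: "ext1_cocycles R M N \<subseteq> ext1_coboundaries R M N"
    have "B #>\<^bsub>G\<^esub> f = B" if "f \<in> carrier G" for f
    proof -
      have "f \<in> B" using that sub by (auto simp: car B_def)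
      then obtain g where f: "f \<in> extensional (carrier (res1 R M))"
        "module_map R (res0 R M) N g"
        "\<And>v. v \<in> carrier (res1 R M) \<Longrightarrow> f v = g (free_eval R (res0 R M) v)"
        unfolding B_def coboundary_iff by blast
      note P0 = left_module.module_map_add[OF left_module_res0 N]
        left_module.module_map_minus_map[OF left_module_res0 N]
      have c: "k (free_eval R (res0 R M) v) \<in> carrier N"
        if "module_map R (res0 R M) N k" "v \<in> carrier (res1 R M)" for k v
        using module_mapD(1)[OF that(1)] module_mapD(1)[OF module_map_eval1 that(2)] .
      have "h \<otimes>\<^bsub>G\<^esub> f \<in> B" if "h \<in> B" for h
      proof -
        from that obtain k where k: "module_map R (res0 R M) N k"
          "\<And>v. v \<in> carrier (res1 R M) \<Longrightarrow> h v = k (free_eval R (res0 R M) v)"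
          unfolding B_def coboundary_iff by blast
        show ?thesis unfolding B_def coboundary_iff mult
          using P0(1)[OF k(1) f(2)] k(2) f(3) by auto
      qed
      moreover have "h \<in> (\<lambda>h. h \<otimes>\<^bsub>G\<^esub> f) ` B" if "h \<in> B" for h
      proof
        from that obtain k where k: "h \<in> extensional (carrier (res1 R M))" "module_map R (res0 R M) N k"
          "\<And>v. v \<in> carrier (res1 R M) \<Longrightarrow> h v = k (free_eval R (res0 R M) v)"
          unfolding B_def coboundary_iff by blast
        let ?d = "\<lambda>v \<in> carrier (res1 R M). h v \<ominus>\<^bsub>N\<^esub> f v"
        show "?d \<in> B" unfolding B_def coboundary_iff
          using P0(2)[OF k(2) f(2)] k(3) f(3) by auto
        have "h v = h v \<ominus>\<^bsub>N\<^esub> f v \<oplus>\<^bsub>N\<^esub> f v" if "v \<in> carrier (res1 R M)" for v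
          using c[OF k(2) that] c[OF f(2) that] k(3) f(3) that
          by (simp add: a_minus_def N.M.a_assoc N.M.l_neg)
        then show "h = ?d \<otimes>\<^bsub>G\<^esub> f" unfolding mult using k(1)
          by (intro extensionalityI[of _ "carrier (res1 R M)"]) auto
      qed
      ultimately show ?thesis unfolding coset by blast
    qed
    then show "carrier (Ext1 R M N) = {\<one>\<^bsub>Ext1 R M N\<^esub>}"
      unfolding Ext using zero' by auto
  qed
qed

text \<open>
  If \<open>e\<close> annihilates \<open>M\<close> then \<open>e u\<close> is a relation for every \<open>u\<close> in \<open>P0\<close>, so a linear map \<open>\<phi>\<close> on the
  relations extends to \<open>P0\<close> by \<open>u \<mapsto> \<phi> (e u)\<close>; this is linear because \<open>e a e = e a\<close>, and it extends
  \<open>\<phi>\<close> because \<open>e\<close> is the identity on \<open>N\<close>.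
\<close>

lemma Ext1_trivial_of_idempotent:
  assumes N: "left_module R N" and e: "e \<in> carrier R"
    and ea: "\<And>a. a \<in> carrier R \<Longrightarrow> e \<otimes> a \<otimes> e = e \<otimes> a"
    and eM: "\<And>x. x \<in> carrier M \<Longrightarrow> e \<odot>\<^bsub>M\<^esub> x = \<zero>\<^bsub>M\<^esub>"
    and eN: "\<And>y. y \<in> carrier N \<Longrightarrow> e \<odot>\<^bsub>N\<^esub> y = y"
  shows "carrier (Ext1 R M N) = {\<one>\<^bsub>Ext1 R M N\<^esub>}"
  unfolding Ext1_trivial_iff[OF N]
proof
  fix f assume f: "f \<in> ext1_cocycles R M N"
  interpret N: left_module R N by fact
  interpret P0: left_module R "res0 R M" by (rule left_module_res0)
  define \<phi> where "\<phi> u = f (basis_element R u)" for u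
  note \<phi> = ext1_cocycle_factor[OF N f, folded \<phi>_def]
  note ev = module_mapD[OF module_map_eval0] and K = P0.submoduleD[OF submodule_relations]
  define g where "g u = \<phi> (e \<odot>\<^bsub>res0 R M\<^esub> u)" for u
  have eu: "e \<odot>\<^bsub>res0 R M\<^esub> u \<in> relations R M" if "u \<in> carrier (res0 R M)" for u
    using that e ev(3)[OF e that] ev(1)[OF that] eM by (simp add: relations_def)
  have "module_map R (res0 R M) N g"
  proof (rule module_mapI)
    fix u assume "u \<in> carrier (res0 R M)"
    then show "g u \<in> carrier N" using \<phi>(1) eu by (simp add: g_def)
  next
    fix u v assume "u \<in> carrier (res0 R M)" "v \<in> carrier (res0 R M)"
    then show "g (u \<oplus>\<^bsub>res0 R M\<^esub> v) = g u \<oplus>\<^bsub>N\<^esub> g v"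
      using \<phi>(2) eu e by (simp add: g_def P0.smult_r_distr)
  next
    fix a u assume a: "a \<in> carrier R" and u: "u \<in> carrier (res0 R M)"
    have "g (a \<odot>\<^bsub>res0 R M\<^esub> u) = \<phi> ((e \<otimes> a) \<odot>\<^bsub>res0 R M\<^esub> u)"
      using a u e by (simp add: g_def P0.smult_assoc1)
    also have "(e \<otimes> a) \<odot>\<^bsub>res0 R M\<^esub> u = (e \<otimes> a) \<odot>\<^bsub>res0 R M\<^esub> (e \<odot>\<^bsub>res0 R M\<^esub> u)"
      using ea[OF a] a u e by (simp add: P0.smult_assoc1[symmetric])
    also have "\<phi> \<dots> = (e \<otimes> a) \<odot>\<^bsub>N\<^esub> g u"
      using \<phi>(3)[OF _ eu[OF u]] a e by (simp add: g_def)
    also have "\<dots> = a \<odot>\<^bsub>N\<^esub> g u"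
      using \<phi>(1)[OF eu[OF u]] a e by (simp add: N.smult_assoc1 eN g_def)
    finally show "g (a \<odot>\<^bsub>res0 R M\<^esub> u) = a \<odot>\<^bsub>N\<^esub> g u" .
  qed
  moreover have "f v = g (free_eval R (res0 R M) v)" if v: "v \<in> carrier (res1 R M)" for v
    using \<phi>(4)[OF v] \<phi>(3)[OF e eval1_in_relations[OF v]] \<phi>(1)[OF eval1_in_relations[OF v]]
    by (simp add: g_def eN)
  moreover have "f \<in> extensional (carrier (res1 R M))"
    using f by (simp add: ext1_cocycle_iff[OF N] mod_hom_iff)
  ultimately show "f \<in> ext1_coboundaries R M N" unfolding coboundary_iff by blast
qed

text \<open>
  A short exact sequence \<open>0 \<rightarrow> T \<rightarrow> E \<rightarrow> M \<rightarrow> 0\<close>, with \<open>T\<close> contained in \<open>E\<close>, splits if \<open>Ext1 M T\<close>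
  vanishes. A set-theoretic section of \<open>p\<close> lifts \<open>P0 \<rightarrow> M\<close> to a linear map \<open>l\<close> from \<open>P0\<close> to \<open>E\<close>, which
  sends relations into \<open>T\<close>. By hypothesis, its restriction to the relations extends to a map \<open>g\<close> from
  \<open>P0\<close> to \<open>T\<close>, and the image of \<open>l - g\<close> is a complement of \<open>T\<close>.
\<close>

lemma Ext1_trivial_imp_complement:
  assumes E: "left_module R E" and T: "left_module R T"
    and incl: "module_map R T E (\<lambda>x. x)"
    and p: "module_map R E M p" "p ` carrier E = carrier M"
    and ker: "{x \<in> carrier E. p x = \<zero>\<^bsub>M\<^esub>} = carrier T"
    and triv: "carrier (Ext1 R M T) = {\<one>\<^bsub>Ext1 R M T\<^esub>}"
  shows "\<exists>H. submodule H R E \<and> H \<inter> carrier T = {\<zero>\<^bsub>E\<^esub>} \<and>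
    (\<forall>x \<in> carrier E. \<exists>y \<in> H. x \<ominus>\<^bsub>E\<^esub> y \<in> carrier T)"
proof -
  interpret E: left_module R E by fact
  interpret T: left_module R T by fact
  interpret P0: left_module R "res0 R M" by (rule left_module_res0)
  note p' = module_mapD[OF p(1)]
  have T_sub: "submodule (carrier T) R E"
    using module_map_kernel[OF E left_module_axioms p(1)] ker by simp
  note T' = E.submoduleD[OF T_sub]
  define \<sigma> where "\<sigma> = inv_into (carrier E) p"
  have \<sigma>: "\<sigma> x \<in> carrier E" "p (\<sigma> x) = x" if "x \<in> carrier M" for x
    using that p(2) by (auto simp: \<sigma>_def inv_into_into f_inv_into_f)
  then have \<sigma>_Pi: "\<sigma> \<in> carrier M \<rightarrow> carrier E" by auto
  define l where "l = lin_ext R E \<sigma>"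
  have l: "module_map R (res0 R M) E l"
    unfolding l_def res0_def by (rule E.module_map_lin_ext[OF \<sigma>_Pi])
  have pl: "p (l u) = free_eval R M u" if "u \<in> carrier (res0 R M)" for u
  proof -
    have "p (l u) = lin_ext R M (\<lambda>x. p (\<sigma> x)) u"
      unfolding l_def using that
      by (intro E.module_map_lin_ext_comp[OF left_module_axioms p(1) \<sigma>_Pi]) (simp add: res0_def)
    also have "\<dots> = free_eval R M u"
      unfolding free_eval_lin_ext lin_ext_def using that \<sigma>
      by (intro M.finsum_cong') (auto simp: res0_def subset_iff)
    finally show ?thesis .
  qed
  have lT: "l u \<in> carrier T" if "u \<in> relations R M" for u
    using that pl module_mapD(1)[OF l] ker by (auto simp: relations_def)
  define f where "f = (\<lambda>v \<in> carrier (res1 R M). l (free_eval R (res0 R M) v))"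
  have "f \<in> ext1_cocycles R M T"
    unfolding ext1_cocycle_iff[OF T]
  proof (intro conjI ballI impI)
    have "module_map R (res1 R M) E (\<lambda>v. l (free_eval R (res0 R M) v))"
      by (rule module_map_comp[OF module_map_eval1 l])
    then have "module_map R (res1 R M) T (\<lambda>v. l (free_eval R (res0 R M) v))"
      using lT[OF eval1_in_relations] module_mapD[OF incl]
      by (auto simp: module_map_def)
    then show "f \<in> mod_hom R (res1 R M) T"
      unfolding f_def by (rule restrict_mod_hom[OF left_module_res1])
    show "f v = \<zero>\<^bsub>T\<^esub>" if "v \<in> carrier (res1 R M)"
      "free_eval R (res0 R M) v = \<zero>\<^bsub>res0 R M\<^esub>" for v
      using that module_map_zero[OF left_module_res0 E l] module_map_zero[OF T E incl]
      by (simp add: f_def)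
  qed
  then have "f \<in> ext1_coboundaries R M T" using triv unfolding Ext1_trivial_iff[OF T] by blast
  then obtain g where g: "module_map R (res0 R M) T g"
    "\<And>v. v \<in> carrier (res1 R M) \<Longrightarrow> f v = g (free_eval R (res0 R M) v)"
    unfolding coboundary_iff by blast
  have gl: "g u = l u" if "u \<in> relations R M" for u
    using g(2)[of "basis_element R u"] eval1_basis_element[OF that] R.basis_element_closed[OF that]
    by (simp add: f_def res1_relations)
  have g': "module_map R (res0 R M) E g" using module_map_comp[OF g(1) incl] by simp
  define d where "d u = l u \<ominus>\<^bsub>E\<^esub> g u" for u
  have d: "module_map R (res0 R M) E d"
    unfolding d_def by (rule P0.module_map_minus_map[OF E l g'])
  have cl: "l u \<in> carrier E" "g u \<in> carrier T" "g u \<in> carrier E" if "u \<in> carrier (res0 R M)" for u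
    using module_mapD(1)[OF l that] module_mapD(1)[OF g(1) that] module_mapD(1)[OF g' that] by auto
  show ?thesis
  proof (intro exI conjI ballI)
    show H: "submodule (d ` carrier (res0 R M)) R E"
      by (rule module_map_image[OF left_module_res0 E d])
    show "d ` carrier (res0 R M) \<inter> carrier T = {\<zero>\<^bsub>E\<^esub>}"
    proof
      show "{\<zero>\<^bsub>E\<^esub>} \<subseteq> d ` carrier (res0 R M) \<inter> carrier T"
        using E.submoduleD(2)[OF H] T'(2) by auto
      show "d ` carrier (res0 R M) \<inter> carrier T \<subseteq> {\<zero>\<^bsub>E\<^esub>}"
      proof
        fix y assume y: "y \<in> d ` carrier (res0 R M) \<inter> carrier T"
        then obtain u where u: "u \<in> carrier (res0 R M)" "y = d u" by blast
        have "l u = d u \<oplus>\<^bsub>E\<^esub> g u"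
          using cl[OF u(1)] by (simp add: d_def a_minus_def E.M.a_assoc E.M.l_neg)
        then have "l u \<in> carrier T" using y u T'(4) cl(2)[OF u(1)] by auto
        then have "p (l u) = \<zero>\<^bsub>M\<^esub>" using ker by blast
        then have "u \<in> relations R M" using pl[OF u(1)] u(1) by (simp add: relations_def)
        then have "d u = \<zero>\<^bsub>E\<^esub>" using gl cl[OF u(1)] by (simp add: d_def E.M.minus_eq_zero_iff)
        then show "y \<in> {\<zero>\<^bsub>E\<^esub>}" using u by simp
      qed
    qed
    fix x assume x: "x \<in> carrier E"
    define u where "u = basis_element R (p x)"
    have px: "p x \<in> carrier M" using p'(1) x by blast
    have u: "u \<in> carrier (res0 R M)"
      unfolding u_def res0_def by (rule R.basis_element_closed[OF px])
    have "l u = \<sigma> (p x)" unfolding l_def u_def by (rule E.lin_ext_basis_element[OF \<sigma>_Pi px])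
    then have "p (l u) = p x" using \<sigma>(2)[OF px] by simp
    then have "p (x \<ominus>\<^bsub>E\<^esub> l u) = \<zero>\<^bsub>M\<^esub>"
      using module_map_minus[OF E left_module_axioms p(1) x cl(1)[OF u]] px M.minus_eq_zero_iff by simp
    then have "x \<ominus>\<^bsub>E\<^esub> l u \<in> carrier T" using ker x cl(1)[OF u] by auto
    then have "(x \<ominus>\<^bsub>E\<^esub> l u) \<oplus>\<^bsub>E\<^esub> g u \<in> carrier T" using T'(4) cl(2)[OF u] by blast
    moreover have "(x \<ominus>\<^bsub>E\<^esub> l u) \<oplus>\<^bsub>E\<^esub> g u = x \<ominus>\<^bsub>E\<^esub> d u"
      using x cl[OF u] by (simp add: d_def a_minus_def E.M.minus_add E.M.a_ac)
    ultimately show "\<exists>y \<in> d ` carrier (res0 R M). x \<ominus>\<^bsub>E\<^esub> y \<in> carrier T" using u by auto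
  qed
qed

end


text \<open>The splitting criterion for \<open>0 \<rightarrow> U / V \<rightarrow> W / V \<rightarrow> W / U \<rightarrow> 0\<close>, expressed inside \<open>M\<close>.\<close>

lemma (in left_module) Ext1_trivial_imp_relative_complement:
  assumes V: "submodule V R M" and U: "submodule U R M" and W: "submodule W R M"
    and VU: "V \<subseteq> U" and UW: "U \<subseteq> W"
    and triv: "carrier (Ext1 R (subquotient M W U) (subquotient M U V)) =
      {\<one>\<^bsub>Ext1 R (subquotient M W U) (subquotient M U V)\<^esub>}"
  obtains P where "submodule P R M" "V \<subseteq> P" "P \<subseteq> W" "P \<inter> U = V"
    "\<And>w. w \<in> W \<Longrightarrow> \<exists>p \<in> P. w \<ominus>\<^bsub>M\<^esub> p \<in> U"
proof -
  let ?E = "subquotient M W V" and ?S = "subquotient M W U" and ?T = "subquotient M U V"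
  have VW: "V \<subseteq> W" using VU UW by blast
  have E: "left_module R ?E" and S: "left_module R ?S" and T: "left_module R ?T"
    using left_module_subquotient V U W VU UW VW by blast+
  interpret E: left_module R ?E by (rule E)
  interpret S: left_module R ?S by (rule S)
  note U' = submoduleD[OF U] and V' = submoduleD[OF V] and W' = submoduleD[OF W]
  note add = subquotient_add[OF V] subquotient_add[OF U]
    and smult = subquotient_smult[OF V] subquotient_smult[OF U]
  define p where "p X = (\<Union>x\<in>X. U +>\<^bsub>M\<^esub> x)" for X
  have p: "p (V +>\<^bsub>M\<^esub> w) = U +>\<^bsub>M\<^esub> w" if w: "w \<in> carrier M" for w
  proof -
    have "U +>\<^bsub>M\<^esub> x = U +>\<^bsub>M\<^esub> w" if "x \<in> V +>\<^bsub>M\<^esub> w" for x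
      using that w VU coset_mem_iff[OF V w] coset_eq_iff[OF U] by blast
    then have "p (V +>\<^bsub>M\<^esub> w) = (\<Union>x\<in>V +>\<^bsub>M\<^esub> w. U +>\<^bsub>M\<^esub> w)"
      unfolding p_def by (intro SUP_cong refl)
    then show ?thesis using coset_self[OF V w] by blast
  qed
  have incl: "module_map R ?T ?E (\<lambda>x. x)"
  proof (rule module_mapI)
    show "X \<oplus>\<^bsub>?T\<^esub> Y = X \<oplus>\<^bsub>?E\<^esub> Y" for X Y by (simp add: subquotient_def)
    show "a \<odot>\<^bsub>?T\<^esub> X = a \<odot>\<^bsub>?E\<^esub> X" for a X by (simp add: subquotient_def)
  qed (use UW in auto)
  have map: "module_map R ?E ?S p"
  proof (rule module_mapI)
    fix X assume "X \<in> carrier ?E"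
    then show "p X \<in> carrier ?S" using p W'(3) by auto
  next
    fix X Y assume "X \<in> carrier ?E" "Y \<in> carrier ?E"
    then obtain x y where "x \<in> W" "y \<in> W" "X = V +>\<^bsub>M\<^esub> x" "Y = V +>\<^bsub>M\<^esub> y" by auto
    then show "p (X \<oplus>\<^bsub>?E\<^esub> Y) = p X \<oplus>\<^bsub>?S\<^esub> p Y" using W'(3) by (simp add: add p)
  next
    fix a X assume "a \<in> carrier R" "X \<in> carrier ?E"
    then obtain x where "a \<in> carrier R" "x \<in> W" "X = V +>\<^bsub>M\<^esub> x" by auto
    then show "p (a \<odot>\<^bsub>?E\<^esub> X) = a \<odot>\<^bsub>?S\<^esub> p X" using W'(3) by (simp add: smult p)
  qed
  have surj: "p ` carrier ?E = carrier ?S"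
    using p W'(3) by (auto simp: image_image intro!: image_cong)
  have ker: "{X \<in> carrier ?E. p X = \<zero>\<^bsub>?S\<^esub>} = carrier ?T"
  proof
    show "{X \<in> carrier ?E. p X = \<zero>\<^bsub>?S\<^esub>} \<subseteq> carrier ?T"
    proof
      fix X assume "X \<in> {X \<in> carrier ?E. p X = \<zero>\<^bsub>?S\<^esub>}"
      then obtain x where x: "x \<in> W" "X = V +>\<^bsub>M\<^esub> x" "p X = U" by auto
      then have "U +>\<^bsub>M\<^esub> x = U" using p[OF W'(3)[OF x(1)]] by simp
      then have "x \<in> U" using coset_eq_self_iff[OF U W'(3)[OF x(1)]] by blast
      then show "X \<in> carrier ?T" unfolding subquotient_sel x(2) by (rule imageI)
    qed
    show "carrier ?T \<subseteq> {X \<in> carrier ?E. p X = \<zero>\<^bsub>?S\<^esub>}"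
    proof
      fix X assume "X \<in> carrier ?T"
      then obtain x where x: "x \<in> U" "X = V +>\<^bsub>M\<^esub> x" by auto
      then have "p X = U"
        using p[OF U'(3)[OF x(1)]] coset_eq_self_iff[OF U U'(3)[OF x(1)]] by blast
      moreover have "X \<in> carrier ?E"
        unfolding subquotient_sel x(2) using x(1) UW by (intro imageI) blast
      ultimately show "X \<in> {X \<in> carrier ?E. p X = \<zero>\<^bsub>?S\<^esub>}" by simp
    qed
  qed
  obtain H where H': "submodule H R ?E \<and> H \<inter> carrier ?T = {\<zero>\<^bsub>?E\<^esub>} \<and>
    (\<forall>X \<in> carrier ?E. \<exists>Y \<in> H. X \<ominus>\<^bsub>?E\<^esub> Y \<in> carrier ?T)"
    using S.Ext1_trivial_imp_complement[OF E T incl map surj ker triv] by (elim exE)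
  note H = conjunct1[OF H'] conjunct1[OF conjunct2[OF H']]
    bspec[OF conjunct2[OF conjunct2[OF H']]]
  define P where "P = {w \<in> W. V +>\<^bsub>M\<^esub> w \<in> H}"
  note P = submodule_coset_preimage[OF V W VW H(1), folded P_def]
  show ?thesis
  proof (rule that[OF P(1,2)])
    show "P \<subseteq> W" by (auto simp: P_def)
    show "P \<inter> U = V"
    proof
      show "V \<subseteq> P \<inter> U" using P(2) VU by blast
      show "P \<inter> U \<subseteq> V"
      proof
        fix x assume x: "x \<in> P \<inter> U"
        then have "V +>\<^bsub>M\<^esub> x \<in> H \<inter> carrier ?T" by (auto simp: P_def)
        then have "V +>\<^bsub>M\<^esub> x \<in> {\<zero>\<^bsub>?E\<^esub>}" unfolding H(2) .
        then have "V +>\<^bsub>M\<^esub> x = V" by simp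
        then show "x \<in> V" using coset_eq_self_iff[OF V] U'(3) x by blast
      qed
    qed
    fix w assume w: "w \<in> W"
    then have "V +>\<^bsub>M\<^esub> w \<in> carrier ?E" by auto
    then obtain Y where Y: "Y \<in> H" "(V +>\<^bsub>M\<^esub> w) \<ominus>\<^bsub>?E\<^esub> Y \<in> carrier ?T"
      by (rule bexE[OF H(3)])
    have "Y \<in> (\<lambda>w. V +>\<^bsub>M\<^esub> w) ` P" using Y(1) P(3) by simp
    then obtain y where y: "y \<in> P" "Y = V +>\<^bsub>M\<^esub> y" by blast
    have yW: "y \<in> W" using y(1) by (simp add: P_def)
    have cE: "V +>\<^bsub>M\<^esub> w \<in> carrier ?E" "Y \<in> carrier ?E" using w yW y(2) by auto
    have "p ((V +>\<^bsub>M\<^esub> w) \<ominus>\<^bsub>?E\<^esub> Y) = \<zero>\<^bsub>?S\<^esub>" using Y(2) ker by blast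
    then have "p (V +>\<^bsub>M\<^esub> w) \<ominus>\<^bsub>?S\<^esub> p Y = \<zero>\<^bsub>?S\<^esub>"
      unfolding module_map_minus[OF E S map cE] .
    then have "p (V +>\<^bsub>M\<^esub> w) = p Y"
      using S.M.minus_eq_zero_iff[OF module_mapD(1)[OF map cE(1)] module_mapD(1)[OF map cE(2)]]
      by blast
    then have "w \<ominus>\<^bsub>M\<^esub> y \<in> U"
      using p w yW y(2) W'(3) coset_eq_iff[OF U] by simp
    then show "\<exists>y \<in> P. w \<ominus>\<^bsub>M\<^esub> y \<in> U" using y(1) by blast
  qed
qed


section \<open>Chain conditions\<close>

text \<open>Left ideals are the submodules of the regular module.\<close>

abbreviation left_ideal :: "('a, 'q) ring_scheme \<Rightarrow> 'a set \<Rightarrow> bool" where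
  "left_ideal R I \<equiv> submodule I R (regular_module R)"

text \<open>
  Finite dimension enters only through an integer-valued function on left ideals that is strictly
  monotone. It provides both chain conditions.
\<close>

locale finite_length_ring = ring R for R (structure) +
  fixes len :: "'a set \<Rightarrow> nat"
  assumes len_less: "\<lbrakk>left_ideal R V; left_ideal R W; V \<subset> W\<rbrakk> \<Longrightarrow> len V < len W"

sublocale finite_length_ring \<subseteq> reg: left_module R "regular_module R"
  rewrites "carrier (regular_module R) = carrier R" and "\<zero>\<^bsub>regular_module R\<^esub> = \<zero>"
    and "\<And>x y. x \<oplus>\<^bsub>regular_module R\<^esub> y = x \<oplus> y" and "\<And>x y. x \<odot>\<^bsub>regular_module R\<^esub> y = x \<otimes> y"
  by (simp_all add: left_module_regular)

context finite_length_ring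
begin

lemma len_le: "\<lbrakk>left_ideal R V; left_ideal R W; V \<subseteq> W\<rbrakk> \<Longrightarrow> len V \<le> len W"
  using len_less[of V W] by (metis less_imp_le order_le_less)

lemma minimal_left_ideal:
  assumes "\<And>V. P V \<Longrightarrow> left_ideal R V" "P V0"
  obtains V where "P V" "\<And>W. \<lbrakk>P W; W \<subseteq> V\<rbrakk> \<Longrightarrow> W = V"
proof -
  from ex_has_least_nat[of P V0 len] assms(2)
  obtain V where V: "P V" "\<And>W. P W \<Longrightarrow> len V \<le> len W" by blast
  have "W = V" if "P W" "W \<subseteq> V" for W
    using len_less[OF assms(1)[OF that(1)] assms(1)[OF V(1)]] V(2)[OF that(1)] that(2) by fastforce
  then show ?thesis using that V(1) by blast
qed

lemma maximal_left_ideal: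
  assumes "\<And>V. P V \<Longrightarrow> left_ideal R V" "P V0"
  obtains V where "P V" "\<And>W. \<lbrakk>P W; V \<subseteq> W\<rbrakk> \<Longrightarrow> W = V"
proof -
  have "len V < Suc (len (carrier R))" if "P V" for V
    using len_le[OF assms(1)[OF that] reg.submodule_carrier] reg.submoduleD(1)[OF assms(1)[OF that]]
    by simp
  then obtain V where V: "P V" "\<And>W. P W \<Longrightarrow> len W \<le> len V"
    using ex_has_greatest_nat[of P V0 len "Suc (len (carrier R))"] assms(2) by blast
  have "W = V" if "P W" "V \<subseteq> W" for W
    using len_less[OF assms(1)[OF V(1)] assms(1)[OF that(1)]] V(2)[OF that(1)] that(2) by fastforce
  then show ?thesis using that V(1) by blast
qed

text \<open>The module is the quotient by a maximal left ideal \<open>L\<close> containing \<open>N\<close>, and \<open>s\<close> is the class of \<open>1\<close>.\<close>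

lemma simple_module_annihilated_by_left_ideal:
  assumes N: "left_ideal R N" and one: "\<one> \<notin> N"
  obtains S :: "('a, 'a set) module" and s where "simple_module R S" "s \<in> carrier S"
    "s \<noteq> \<zero>\<^bsub>S\<^esub>" "\<And>n. n \<in> N \<Longrightarrow> n \<odot>\<^bsub>S\<^esub> s = \<zero>\<^bsub>S\<^esub>"
proof -
  let ?A = "regular_module R"
  obtain L where L: "left_ideal R L \<and> N \<subseteq> L \<and> \<one> \<notin> L"
    and max: "\<And>W. \<lbrakk>left_ideal R W \<and> N \<subseteq> W \<and> \<one> \<notin> W; L \<subseteq> W\<rbrakk> \<Longrightarrow> W = L"
    by (rule maximal_left_ideal[of "\<lambda>L. left_ideal R L \<and> N \<subseteq> L \<and> \<one> \<notin> L" N])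
      (use N one in auto)
  note L' = reg.submoduleD[OF conjunct1[OF L]]
  let ?S = "subquotient ?A (carrier R) L" and ?s = "L +>\<^bsub>?A\<^esub> \<one>"
  have all: "P = carrier R" if "left_ideal R P" "\<one> \<in> P" for P
  proof
    show "P \<subseteq> carrier R" using reg.submoduleD(1)[OF that(1)] .
    show "carrier R \<subseteq> P"
    proof
      fix a assume "a \<in> carrier R"
      then show "a \<in> P" using reg.submoduleD(5)[OF that(1) _ that(2), of a] by simp
    qed
  qed
  have "simple_module R ?S"
  proof (rule reg.simple_module_subquotient)
    show "left_ideal R L" using L by blast
    show "left_ideal R (carrier R)" by (rule reg.submodule_carrier)
    show "L \<subset> carrier R" using L L'(1) by blast
    fix P assume P: "left_ideal R P" "L \<subset> P" "P \<subseteq> carrier R"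
    then have "\<one> \<in> P" using max[of P] L by blast
    then show "P = carrier R" by (rule all[OF P(1)])
  qed
  moreover have "?s \<in> carrier ?S" by simp
  moreover have "?s \<noteq> \<zero>\<^bsub>?S\<^esub>" using L reg.coset_eq_self_iff[of L \<one>] by simp
  moreover have "n \<odot>\<^bsub>?S\<^esub> ?s = \<zero>\<^bsub>?S\<^esub>" if "n \<in> N" for n
  proof -
    have n: "n \<in> L" "n \<in> carrier R" using that L L'(3) by auto
    then have "n \<odot>\<^bsub>?S\<^esub> ?s = L +>\<^bsub>?A\<^esub> (n \<otimes> \<one>)" using L by (simp add: reg.subquotient_smult)
    also have "\<dots> = L" using n L reg.coset_eq_self_iff[of L n] by simp
    finally show ?thesis by simp
  qed
  ultimately show ?thesis by (rule that)
qed

text \<open>The left ideal \<open>R (1 - e)\<close> is proper, since \<open>1 = a (1 - e)\<close> would give \<open>e = a (1 - e) e = 0\<close>.\<close>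

lemma simple_module_fixed_by_idempotent:
  assumes e: "e \<in> carrier R" "e \<otimes> e = e" "e \<noteq> \<zero>"
  obtains S :: "('a, 'a set) module" and s where "simple_module R S" "s \<in> carrier S"
    "s \<noteq> \<zero>\<^bsub>S\<^esub>" "e \<odot>\<^bsub>S\<^esub> s = s"
proof -
  let ?N = "(\<lambda>a. a \<otimes> (\<one> \<ominus> e)) ` carrier R"
  have f: "\<one> \<ominus> e \<in> carrier R" "(\<one> \<ominus> e) \<otimes> e = \<zero>"
    using e by (auto simp: a_minus_def l_distr l_minus r_neg)
  have N: "left_ideal R ?N" by (rule submodule_right_mult[OF reg.submodule_carrier f(1)])
  have one: "\<one> \<notin> ?N"
  proof
    assume "\<one> \<in> ?N"
    then obtain a where a: "a \<in> carrier R" "\<one> = a \<otimes> (\<one> \<ominus> e)" by blast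
    have "e = a \<otimes> (\<one> \<ominus> e) \<otimes> e" using a(2) e(1) by simp
    also have "\<dots> = \<zero>" using a(1) e(1) f by (simp add: m_assoc)
    finally show False using e(3) by simp
  qed
  obtain S :: "('a, 'a set) module" and s where S: "simple_module R S" "s \<in> carrier S"
    "s \<noteq> \<zero>\<^bsub>S\<^esub>" "\<And>n. n \<in> ?N \<Longrightarrow> n \<odot>\<^bsub>S\<^esub> s = \<zero>\<^bsub>S\<^esub>"
    by (rule simple_module_annihilated_by_left_ideal[OF N one]) (rule that; assumption)
  interpret S: left_module R S by (rule simple_moduleD(1)[OF S(1)])
  have "\<one> \<ominus> e \<in> ?N" using f(1) by (intro image_eqI[of _ _ \<one>]) auto
  then have "(\<one> \<ominus> e) \<odot>\<^bsub>S\<^esub> s = \<zero>\<^bsub>S\<^esub>" by (rule S(4))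
  then have "s \<ominus>\<^bsub>S\<^esub> e \<odot>\<^bsub>S\<^esub> s = \<zero>\<^bsub>S\<^esub>"
    using e(1) S(2) by (simp add: a_minus_def S.smult_l_distr S.smult_l_minus)
  then have "e \<odot>\<^bsub>S\<^esub> s = s" using S.M.minus_eq_zero_iff e(1) S(2) by simp
  then show ?thesis using that S by blast
qed

end

text \<open>A function on the submodules of \<open>P\<close> that is strictly monotone.\<close>

definition length_function :: "('a, 'q) ring_scheme \<Rightarrow> ('a, 'm, 'r) module_scheme \<Rightarrow> 'm set \<Rightarrow>
    ('m set \<Rightarrow> nat) \<Rightarrow> bool" where
  "length_function R M P \<mu> \<longleftrightarrow>
     (\<forall>V W. submodule V R M \<longrightarrow> submodule W R M \<longrightarrow> V \<subset> W \<longrightarrow> W \<subseteq> P \<longrightarrow> \<mu> V < \<mu> W)"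

text \<open>
  For a module over a field, a length function is built along a spanning set: passing from \<open>P\<close> to
  \<open>P + R b\<close>, a submodule of the larger module is measured by its intersection with \<open>P\<close>, plus one if
  it is not contained in \<open>P\<close>.
\<close>

context left_module
begin

lemma length_function_extend:
  assumes K: "field R" and P: "submodule P R M" and b: "b \<in> carrier M"
    and \<mu>: "length_function R M P \<mu>"
  shows "length_function R M (P <+>\<^bsub>M\<^esub> (\<lambda>c. c \<odot>\<^bsub>M\<^esub> b) ` carrier R)
    (\<lambda>V. \<mu> (V \<inter> P) + (if V \<subseteq> P then 0 else 1))"
  unfolding length_function_def
proof (intro allI impI)
  fix V W assume V: "submodule V R M" and W: "submodule W R M" and VW: "V \<subset> W"
    and WP: "W \<subseteq> P <+>\<^bsub>M\<^esub> (\<lambda>c. c \<odot>\<^bsub>M\<^esub> b) ` carrier R"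
  show "\<mu> (V \<inter> P) + (if V \<subseteq> P then 0 else 1) < \<mu> (W \<inter> P) + (if W \<subseteq> P then 0 else 1)"
  proof (cases "V \<inter> P = W \<inter> P")
    case False
    then have "V \<inter> P \<subset> W \<inter> P" "W \<inter> P \<subseteq> P" using VW by auto
    then have "\<mu> (V \<inter> P) < \<mu> (W \<inter> P)"
      using \<mu> submodule_Int[OF V P] submodule_Int[OF W P] unfolding length_function_def by blast
    moreover have "W \<subseteq> P \<Longrightarrow> V \<subseteq> P" using VW by blast
    ultimately show ?thesis by simp
  next
    case True
    interpret K: field R by (rule K)
    note V' = submoduleD[OF V] and W' = submoduleD[OF W] and P' = submoduleD[OF P]
    have "\<not> W \<subseteq> P" using True VW by blast
    moreover have "V \<subseteq> P"
    proof (rule ccontr)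
      assume "\<not> V \<subseteq> P"
      then obtain v where v: "v \<in> V" "v \<notin> P" by blast
      have "v \<in> P <+>\<^bsub>M\<^esub> (\<lambda>c. c \<odot>\<^bsub>M\<^esub> b) ` carrier R" using v(1) VW WP by blast
      then obtain s c where s: "s \<in> P" "c \<in> carrier R" "v = s \<oplus>\<^bsub>M\<^esub> c \<odot>\<^bsub>M\<^esub> b"
        by (auto simp: mem_set_add)
      then have "c \<noteq> \<zero>" using v(2) b P'(3) by auto
      then have c: "inv c \<in> carrier R" "inv c \<otimes> c = \<one>"
        using s(2) K.field_Units R.Units_inv_closed R.Units_l_inv by auto
      have "W \<subseteq> V"
      proof
        fix w assume w: "w \<in> W"
        then obtain s' c' where s': "s' \<in> P" "c' \<in> carrier R" "w = s' \<oplus>\<^bsub>M\<^esub> c' \<odot>\<^bsub>M\<^esub> b"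
          using subsetD[OF WP w] by (auto simp: mem_set_add)
        define d where "d = c' \<otimes> inv c"
        have d: "d \<in> carrier R" "d \<otimes> c = c'"
          using s'(2) s(2) c by (auto simp: d_def R.m_assoc)
        have dv: "d \<odot>\<^bsub>M\<^esub> v = d \<odot>\<^bsub>M\<^esub> s \<oplus>\<^bsub>M\<^esub> c' \<odot>\<^bsub>M\<^esub> b"
          using s d b P'(3) by (simp add: smult_r_distr smult_assoc1[symmetric])
        have "w \<ominus>\<^bsub>M\<^esub> d \<odot>\<^bsub>M\<^esub> v = s' \<ominus>\<^bsub>M\<^esub> d \<odot>\<^bsub>M\<^esub> s"
        proof -
          have c: "s' \<in> carrier M" "d \<odot>\<^bsub>M\<^esub> s \<in> carrier M" "c' \<odot>\<^bsub>M\<^esub> b \<in> carrier M"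
            using s' s d b P'(3) by auto
          then have "w \<ominus>\<^bsub>M\<^esub> d \<odot>\<^bsub>M\<^esub> v =
              s' \<ominus>\<^bsub>M\<^esub> d \<odot>\<^bsub>M\<^esub> s \<oplus>\<^bsub>M\<^esub> (c' \<odot>\<^bsub>M\<^esub> b \<oplus>\<^bsub>M\<^esub> \<ominus>\<^bsub>M\<^esub> (c' \<odot>\<^bsub>M\<^esub> b))"
            unfolding dv s'(3) a_minus_def by (simp add: M.minus_add M.a_ac del: M.r_neg)
          then show ?thesis using c by (simp add: M.r_neg)
        qed
        also have "\<dots> \<in> P" using P'(5,7) s s' d by simp
        finally have "w \<ominus>\<^bsub>M\<^esub> d \<odot>\<^bsub>M\<^esub> v \<in> W \<inter> P"
          using w v(1) VW d W'(5,7) by (auto simp: subset_iff)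
        then have "w \<ominus>\<^bsub>M\<^esub> d \<odot>\<^bsub>M\<^esub> v \<in> V" using True by blast
        then have "(w \<ominus>\<^bsub>M\<^esub> d \<odot>\<^bsub>M\<^esub> v) \<oplus>\<^bsub>M\<^esub> d \<odot>\<^bsub>M\<^esub> v \<in> V" using V'(4,5) v(1) d by blast
        moreover have "(w \<ominus>\<^bsub>M\<^esub> d \<odot>\<^bsub>M\<^esub> v) \<oplus>\<^bsub>M\<^esub> d \<odot>\<^bsub>M\<^esub> v = w"
          using W'(3)[OF w] V'(3)[OF v(1)] d by (simp add: a_minus_def M.a_assoc M.l_neg)
        ultimately show "w \<in> V" by simp
      qed
      then show False using VW by blast
    qed
    ultimately show ?thesis using True by simp
  qed
qed

lemma length_function_exists:
  assumes K: "field R" and "finite B" "B \<subseteq> carrier M"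
  shows "\<exists>P \<mu>. submodule P R M \<and> B \<subseteq> P \<and> length_function R M P \<mu>"
  using assms(2,3)
proof (induction B rule: finite_induct)
  case empty
  have "length_function R M {\<zero>\<^bsub>M\<^esub>} (\<lambda>V. 0)"
    unfolding length_function_def using submoduleD(2) by blast
  then show ?case using submodule_zero by blast
next
  case (insert b B)
  then obtain P \<mu> where P: "submodule P R M" "B \<subseteq> P" and \<mu>: "length_function R M P \<mu>" by blast
  have b: "b \<in> carrier M" using insert.prems by simp
  let ?C = "(\<lambda>c. c \<odot>\<^bsub>M\<^esub> b) ` carrier R"
  have C: "submodule ?C R M" by (rule submodule_cyclic) (use b in auto)
  have "b \<in> ?C" using b by (intro image_eqI[of _ _ \<one>]) auto
  then have "insert b B \<subseteq> P <+>\<^bsub>M\<^esub> ?C" using set_add_upper[OF P(1) C] P(2) by blast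
  then show ?case
    using submodule_set_add[OF P(1) C] length_function_extend[OF K P(1) b \<mu>] by blast
qed

end

lemma (in module) left_module: "left_module R M"
  by (intro left_module.intro left_module_axioms.intro)
    (auto simp: R.ring_axioms M.abelian_group_axioms smult_l_distr smult_r_distr smult_assoc1)

lemma (in fin_dim_algebra) finite_length_ring_exists: "\<exists>len. finite_length_ring A len"
proof -
  interpret V: left_module K A by (rule left_module)
  interpret reg: left_module A "regular_module A" by (rule A.left_module_regular)
  obtain B where B: "finite B" "B \<subseteq> carrier A"
    "\<And>x. x \<in> carrier A \<Longrightarrow> \<exists>c \<in> B \<rightarrow> carrier K. x = (\<Oplus>\<^bsub>A\<^esub>b\<in>B. c b \<odot>\<^bsub>A\<^esub> b)"
    using finite_spanning_set by blast
  obtain P \<mu> where P: "submodule P K A" "B \<subseteq> P" and \<mu>: "length_function K A P \<mu>"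
    using V.length_function_exists[OF K.field_axioms B(1,2)] by blast
  have all: "carrier A \<subseteq> P"
  proof
    fix x assume "x \<in> carrier A"
    then obtain c where c: "c \<in> B \<rightarrow> carrier K" "x = (\<Oplus>\<^bsub>A\<^esub>b\<in>B. c b \<odot>\<^bsub>A\<^esub> b)" using B(3) by blast
    show "x \<in> P" unfolding c(2)
      by (rule V.submodule_finsum[OF P(1)]) (use c(1) P V.submoduleD(5)[OF P(1)] in auto)
  qed
  have sub: "submodule I K A" if I: "left_ideal A I" for I
  proof (rule V.submoduleI)
    note I' = reg.submoduleD[OF I]
    show "I \<subseteq> carrier A" "\<zero>\<^bsub>A\<^esub> \<in> I" using I'(1,2) by auto
    show "x \<oplus>\<^bsub>A\<^esub> y \<in> I" if "x \<in> I" "y \<in> I" for x y using I'(4) that by simp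
    show "c \<odot>\<^bsub>A\<^esub> x \<in> I" if "c \<in> carrier K" "x \<in> I" for c x
    proof -
      have x: "x \<in> carrier A" using I'(3) that by simp
      have "(c \<odot>\<^bsub>A\<^esub> \<one>\<^bsub>A\<^esub>) \<otimes>\<^bsub>A\<^esub> x \<in> I" using I'(5)[of "c \<odot>\<^bsub>A\<^esub> \<one>\<^bsub>A\<^esub>" x] that by simp
      then show ?thesis using smult_mult_left[OF that(1) A.one_closed x] x by simp
    qed
  qed
  have "finite_length_ring A \<mu>"
  proof (intro finite_length_ring.intro finite_length_ring_axioms.intro A.ring_axioms)
    fix V W assume VW: "left_ideal A V" "left_ideal A W" "V \<subset> W"
    then have "W \<subseteq> P" using reg.submoduleD(1)[OF VW(2)] all by auto
    then show "\<mu> V < \<mu> W" using \<mu> sub VW unfolding length_function_def by blast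
  qed
  then show ?thesis by blast
qed


section \<open>Idempotents separating two classes of simple modules\<close>

context finite_length_ring
begin

text \<open>
  Take \<open>B\<close> minimal among the left ideals that annihilate no nonzero element of a module in \<open>\<X>\<close>. If
  \<open>B\<close> did not annihilate some \<open>t\<close> in a module of \<open>\<Y>\<close>, then its intersection with the annihilator
  of \<open>t\<close> would be smaller, hence would annihilate some nonzero \<open>s\<close>; mapping \<open>b t\<close> to \<open>b s\<close> for \<open>b\<close> in \<open>B\<close>
  then gives an isomorphism between the two modules.
\<close>

lemma separating_left_ideal:
  fixes \<X> \<Y> :: "('a, 'a set) module set"
  assumes X: "\<And>S. S \<in> \<X> \<Longrightarrow> simple_module R S" and Y: "\<And>T. T \<in> \<Y> \<Longrightarrow> simple_module R T"
    and not_iso: "\<And>S T. \<lbrakk>S \<in> \<X>; T \<in> \<Y>\<rbrakk> \<Longrightarrow> \<not> mod_iso R T S"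
  obtains B where "left_ideal R B"
    "\<And>S s. \<lbrakk>S \<in> \<X>; s \<in> carrier S; s \<noteq> \<zero>\<^bsub>S\<^esub>\<rbrakk> \<Longrightarrow> \<exists>b \<in> B. b \<odot>\<^bsub>S\<^esub> s \<noteq> \<zero>\<^bsub>S\<^esub>"
    "\<And>T t b. \<lbrakk>T \<in> \<Y>; t \<in> carrier T; b \<in> B\<rbrakk> \<Longrightarrow> b \<odot>\<^bsub>T\<^esub> t = \<zero>\<^bsub>T\<^esub>"
proof -
  define F where "F B \<longleftrightarrow> left_ideal R B \<and>
    (\<forall>S \<in> \<X>. \<forall>s \<in> carrier S. s \<noteq> \<zero>\<^bsub>S\<^esub> \<longrightarrow> (\<exists>b \<in> B. b \<odot>\<^bsub>S\<^esub> s \<noteq> \<zero>\<^bsub>S\<^esub>))" for B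
  have F_carrier: "F (carrier R)"
    unfolding F_def
  proof (intro conjI ballI impI)
    show "left_ideal R (carrier R)" by (rule reg.submodule_carrier)
    fix S s assume s: "S \<in> \<X>" "s \<in> carrier S" "s \<noteq> \<zero>\<^bsub>S\<^esub>"
    interpret S: left_module R S by (rule simple_moduleD(1)[OF X[OF s(1)]])
    show "\<exists>b \<in> carrier R. b \<odot>\<^bsub>S\<^esub> s \<noteq> \<zero>\<^bsub>S\<^esub>" using s by (intro bexI[of _ \<one>]) auto
  qed
  obtain B where B: "F B" and min: "\<And>B'. \<lbrakk>F B'; B' \<subseteq> B\<rbrakk> \<Longrightarrow> B' = B"
    by (rule minimal_left_ideal[of F, OF _ F_carrier]) (auto simp: F_def)
  have ideal: "left_ideal R B" using B by (simp add: F_def)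
  note B' = reg.submoduleD[OF ideal]
  show ?thesis
  proof (rule that[OF ideal])
    show "\<exists>b \<in> B. b \<odot>\<^bsub>S\<^esub> s \<noteq> \<zero>\<^bsub>S\<^esub>" if "S \<in> \<X>" "s \<in> carrier S" "s \<noteq> \<zero>\<^bsub>S\<^esub>" for S s
      using B that unfolding F_def by blast
    fix T t b assume T: "T \<in> \<Y>" and t: "t \<in> carrier T" and b: "b \<in> B"
    interpret T: left_module R T by (rule simple_moduleD(1)[OF Y[OF T]])
    let ?I = "{a \<in> carrier R. a \<odot>\<^bsub>T\<^esub> t = \<zero>\<^bsub>T\<^esub>}"
    have I: "left_ideal R (B \<inter> ?I)"
      by (rule reg.submodule_Int[OF ideal submodule_annihilator[OF T.left_module_axioms t]])
    have "F (B \<inter> ?I)"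
      unfolding F_def
    proof (intro conjI I ballI impI)
      fix S s assume s: "S \<in> \<X>" "s \<in> carrier S" "s \<noteq> \<zero>\<^bsub>S\<^esub>"
      interpret S: left_module R S by (rule simple_moduleD(1)[OF X[OF s(1)]])
      obtain c where c: "c \<in> B" "c \<odot>\<^bsub>S\<^esub> s \<noteq> \<zero>\<^bsub>S\<^esub>" using B s unfolding F_def by blast
      have cR: "c \<in> carrier R" using B'(3) c(1) by simp
      show "\<exists>b \<in> B \<inter> ?I. b \<odot>\<^bsub>S\<^esub> s \<noteq> \<zero>\<^bsub>S\<^esub>"
      proof (rule ccontr)
        assume *: "\<not> (\<exists>b \<in> B \<inter> ?I. b \<odot>\<^bsub>S\<^esub> s \<noteq> \<zero>\<^bsub>S\<^esub>)"
        have "mod_iso R T S"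
        proof (rule simple_module_iso_of_annihilator[OF X[OF s(1)] Y[OF T]])
          show "c \<odot>\<^bsub>S\<^esub> s \<in> carrier S" "c \<odot>\<^bsub>S\<^esub> s \<noteq> \<zero>\<^bsub>S\<^esub>" "c \<odot>\<^bsub>T\<^esub> t \<in> carrier T"
            using cR c(2) s(2) t by auto
          fix a assume a: "a \<in> carrier R" "a \<odot>\<^bsub>T\<^esub> (c \<odot>\<^bsub>T\<^esub> t) = \<zero>\<^bsub>T\<^esub>"
          then have "a \<otimes> c \<in> B \<inter> ?I"
            using cR c(1) t B'(5) by (simp add: T.smult_assoc1)
          then have "(a \<otimes> c) \<odot>\<^bsub>S\<^esub> s = \<zero>\<^bsub>S\<^esub>" using * by blast
          then show "a \<odot>\<^bsub>S\<^esub> (c \<odot>\<^bsub>S\<^esub> s) = \<zero>\<^bsub>S\<^esub>" using a cR s(2) by (simp add: S.smult_assoc1)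
        qed
        then show False using not_iso[OF s(1) T] by blast
      qed
    qed
    then have "B \<inter> ?I = B" by (rule min) blast
    then show "b \<odot>\<^bsub>T\<^esub> t = \<zero>\<^bsub>T\<^esub>" using b by blast
  qed
qed

text \<open>
  Let \<open>B\<close> and \<open>C\<close> be as in the previous lemma, for the two orders of the classes. No nonzero element of
  a simple module is annihilated by both, so \<open>B + C\<close> is the whole ring, and the \<open>B\<close>-component of \<open>1\<close>
  separates the classes.
\<close>

lemma separating_element:
  fixes \<X> \<Y> :: "('a, 'a set) module set"
  assumes XY: "\<And>S. S \<in> \<X> \<union> \<Y> \<longleftrightarrow> simple_module R S"
    and not_iso: "\<And>S T. \<lbrakk>S \<in> \<X>; T \<in> \<Y>\<rbrakk> \<Longrightarrow> \<not> mod_iso R S T"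
  obtains x where "x \<in> carrier R" "\<And>S s. \<lbrakk>S \<in> \<X>; s \<in> carrier S\<rbrakk> \<Longrightarrow> x \<odot>\<^bsub>S\<^esub> s = s"
    "\<And>T t. \<lbrakk>T \<in> \<Y>; t \<in> carrier T\<rbrakk> \<Longrightarrow> x \<odot>\<^bsub>T\<^esub> t = \<zero>\<^bsub>T\<^esub>"
proof -
  have X: "simple_module R S" if "S \<in> \<X>" for S using XY that by blast
  have Y: "simple_module R S" if "S \<in> \<Y>" for S using XY that by blast
  have not_iso': "\<not> mod_iso R T S" if "S \<in> \<X>" "T \<in> \<Y>" for S T
    using not_iso[OF that] mod_iso_sym[of R T S] simple_moduleD(1) X Y that by blast
  obtain B where B: "left_ideal R B"
    "\<And>S s. \<lbrakk>S \<in> \<X>; s \<in> carrier S; s \<noteq> \<zero>\<^bsub>S\<^esub>\<rbrakk> \<Longrightarrow> \<exists>b \<in> B. b \<odot>\<^bsub>S\<^esub> s \<noteq> \<zero>\<^bsub>S\<^esub>"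
    "\<And>T t b. \<lbrakk>T \<in> \<Y>; t \<in> carrier T; b \<in> B\<rbrakk> \<Longrightarrow> b \<odot>\<^bsub>T\<^esub> t = \<zero>\<^bsub>T\<^esub>"
    by (rule separating_left_ideal[of \<X> \<Y>]) (use X Y not_iso' in blast)+
  obtain C where C: "left_ideal R C"
    "\<And>S s. \<lbrakk>S \<in> \<Y>; s \<in> carrier S; s \<noteq> \<zero>\<^bsub>S\<^esub>\<rbrakk> \<Longrightarrow> \<exists>b \<in> C. b \<odot>\<^bsub>S\<^esub> s \<noteq> \<zero>\<^bsub>S\<^esub>"
    "\<And>T t b. \<lbrakk>T \<in> \<X>; t \<in> carrier T; b \<in> C\<rbrakk> \<Longrightarrow> b \<odot>\<^bsub>T\<^esub> t = \<zero>\<^bsub>T\<^esub>"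
    by (rule separating_left_ideal[of \<Y> \<X>]) (use X Y not_iso in blast)+
  let ?N = "B <+>\<^bsub>regular_module R\<^esub> C"
  have N: "left_ideal R ?N" "B \<subseteq> ?N" "C \<subseteq> ?N"
    using reg.submodule_set_add[OF B(1) C(1)] reg.set_add_upper[OF B(1) C(1)] by auto
  have "\<one> \<in> ?N"
  proof (rule ccontr)
    assume "\<one> \<notin> ?N"
    then obtain S :: "('a, 'a set) module" and s where S: "simple_module R S" "s \<in> carrier S"
      "s \<noteq> \<zero>\<^bsub>S\<^esub>" "\<And>n. n \<in> ?N \<Longrightarrow> n \<odot>\<^bsub>S\<^esub> s = \<zero>\<^bsub>S\<^esub>"
      by (rule simple_module_annihilated_by_left_ideal[OF N(1)]) (rule that; assumption)
    then show False using XY[of S] B(2)[of S s] C(2)[of S s] N(2,3) by blast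
  qed
  then obtain b c where bc: "b \<in> B" "c \<in> C" "\<one> = b \<oplus> c" by (auto simp: reg.mem_set_add)
  have bR: "b \<in> carrier R" "c \<in> carrier R"
    using reg.submoduleD(3)[OF B(1) bc(1)] reg.submoduleD(3)[OF C(1) bc(2)] by auto
  show ?thesis
  proof (rule that[OF bR(1)])
    fix S s assume S: "S \<in> \<X>" "s \<in> carrier S"
    interpret S: left_module R S by (rule simple_moduleD(1)[OF X[OF S(1)]])
    have "s = (b \<oplus> c) \<odot>\<^bsub>S\<^esub> s" using S(2) bc(3)[symmetric] by simp
    also have "\<dots> = b \<odot>\<^bsub>S\<^esub> s" using C(3)[OF S bc(2)] S(2) bR by (simp add: S.smult_l_distr)
    finally show "b \<odot>\<^bsub>S\<^esub> s = s" ..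
  qed (rule B(3)[OF _ _ bc(1)])
qed

text \<open>
  Among the separating elements, choose \<open>x\<close> with \<open>R x\<close> small and with large left annihilator. As \<open>x\<^sup>2\<close> is
  separating too, \<open>R x = R x\<^sup>2\<close>, and right multiplication by \<open>x\<close> is injective on \<open>R x\<close>. Writing
  \<open>x = a x\<^sup>2\<close>, the element \<open>a x\<close> is then idempotent.
\<close>

lemma separating_idempotent:
  fixes \<X> \<Y> :: "('a, 'a set) module set"
  assumes XY: "\<And>S. S \<in> \<X> \<union> \<Y> \<longleftrightarrow> simple_module R S"
    and not_iso: "\<And>S T. \<lbrakk>S \<in> \<X>; T \<in> \<Y>\<rbrakk> \<Longrightarrow> \<not> mod_iso R S T"
  obtains f where "f \<in> carrier R" "f \<otimes> f = f"
    "\<And>S s. \<lbrakk>S \<in> \<X>; s \<in> carrier S\<rbrakk> \<Longrightarrow> f \<odot>\<^bsub>S\<^esub> s = s"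
    "\<And>T t. \<lbrakk>T \<in> \<Y>; t \<in> carrier T\<rbrakk> \<Longrightarrow> f \<odot>\<^bsub>T\<^esub> t = \<zero>\<^bsub>T\<^esub>"
proof -
  have lm: "left_module R S" if "S \<in> \<X> \<union> \<Y>" for S using XY that simple_moduleD(1) by blast
  define good where "good x \<longleftrightarrow> x \<in> carrier R \<and> (\<forall>S \<in> \<X>. \<forall>s \<in> carrier S. x \<odot>\<^bsub>S\<^esub> s = s) \<and>
    (\<forall>T \<in> \<Y>. \<forall>t \<in> carrier T. x \<odot>\<^bsub>T\<^esub> t = \<zero>\<^bsub>T\<^esub>)" for x
  define I where "I x = (\<lambda>a. a \<otimes> x) ` carrier R" for x
  define J where "J x = {a \<in> carrier R. a \<otimes> x = \<zero>}" for x
  have I: "left_ideal R (I x)" if "x \<in> carrier R" for x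
    unfolding I_def by (rule submodule_right_mult[OF reg.submodule_carrier that])
  have J: "left_ideal R (J x)" if "x \<in> carrier R" for x
    using submodule_annihilator[OF left_module_regular, of x] that by (simp add: J_def)
  have J_le: "len (J x) \<le> len (carrier R)" if "x \<in> carrier R" for x
    using len_le[OF J[OF that] reg.submodule_carrier] by (auto simp: J_def)
  define m where "m x = len (I x) + (len (carrier R) - len (J x))" for x
  obtain x0 where "good x0"
    using separating_element[OF XY not_iso] unfolding good_def by metis
  then obtain x where x: "good x" and least: "\<And>y. good y \<Longrightarrow> m x \<le> m y"
    using ex_has_least_nat[of good x0 m] by blast
  have xR: "x \<in> carrier R" using x by (simp add: good_def)
  then have xxR: "x \<otimes> x \<in> carrier R" by simp
  have good_mult: "good (y \<otimes> x)" if y: "y \<in> carrier R"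
    "\<And>S s. \<lbrakk>S \<in> \<X>; s \<in> carrier S\<rbrakk> \<Longrightarrow> y \<odot>\<^bsub>S\<^esub> s = s" for y
    unfolding good_def
  proof (intro conjI ballI)
    show "y \<otimes> x \<in> carrier R" using xR y by simp
    show "(y \<otimes> x) \<odot>\<^bsub>S\<^esub> s = s" if "S \<in> \<X>" "s \<in> carrier S" for S s
      using left_module.smult_assoc1[OF lm y(1) xR that(2)] y(2) x that by (auto simp: good_def)
    show "(y \<otimes> x) \<odot>\<^bsub>T\<^esub> t = \<zero>\<^bsub>T\<^esub>" if "T \<in> \<Y>" "t \<in> carrier T" for T t
      using left_module.smult_assoc1[OF lm y(1) xR that(2)] left_module.smult_r_null[OF lm y(1)]
        x that by (auto simp: good_def)
  qed
  have "good (x \<otimes> x)" using x by (intro good_mult) (auto simp: good_def)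
  then have le: "m x \<le> m (x \<otimes> x)" by (rule least)
  have I_sub: "I (x \<otimes> x) \<subseteq> I x"
    unfolding I_def using xR by (auto simp: m_assoc[symmetric])
  have J_sub: "J x \<subseteq> J (x \<otimes> x)"
    unfolding J_def using xR by (auto simp: m_assoc[symmetric])
  have "I (x \<otimes> x) = I x"
  proof (rule ccontr)
    assume "I (x \<otimes> x) \<noteq> I x"
    then have "len (I (x \<otimes> x)) < len (I x)" using I_sub I xR xxR by (intro len_less) auto
    moreover have "len (J x) \<le> len (J (x \<otimes> x))" using J_sub J xR xxR by (intro len_le) auto
    ultimately show False using le unfolding m_def by linarith
  qed
  moreover have "x \<in> I x" unfolding I_def using xR by (intro image_eqI[of _ _ \<one>]) auto
  ultimately obtain a where a: "a \<in> carrier R" "x = a \<otimes> (x \<otimes> x)" by (auto simp: I_def)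
  have J_eq: "J (x \<otimes> x) = J x"
  proof (rule ccontr)
    assume "J (x \<otimes> x) \<noteq> J x"
    then have "len (J x) < len (J (x \<otimes> x))" using J_sub J xR xxR by (intro len_less) auto
    moreover have "len (I (x \<otimes> x)) \<le> len (I x)" using I_sub I xR xxR by (intro len_le) auto
    ultimately show False using le J_le[OF xxR] unfolding m_def by linarith
  qed
  define f where "f = a \<otimes> x"
  have fR: "f \<in> carrier R" using a xR by (simp add: f_def)
  have fx: "f \<otimes> x = x" using a xR by (simp add: f_def m_assoc)
  have "a \<odot>\<^bsub>S\<^esub> s = s" if "S \<in> \<X>" "s \<in> carrier S" for S s
  proof -
    interpret S: left_module R S using lm that(1) by blast
    have xs: "x \<odot>\<^bsub>S\<^esub> s = s" using x that by (simp add: good_def)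
    have "s = (a \<otimes> (x \<otimes> x)) \<odot>\<^bsub>S\<^esub> s" using a(2) xs by simp
    then show ?thesis using a(1) xR xs that(2) by (simp add: S.smult_assoc1)
  qed
  then have good: "good f" unfolding f_def using a(1) by (intro good_mult) auto
  have ff: "f \<otimes> f = f"
  proof -
    define c where "c = f \<otimes> a \<ominus> a"
    have c: "c \<in> carrier R" using fR a by (simp add: c_def)
    have cx: "c \<otimes> x = f \<otimes> f \<ominus> f"
      using fR a xR by (simp add: c_def f_def a_minus_def l_distr l_minus m_assoc)
    have "c \<otimes> (x \<otimes> x) = (f \<otimes> f \<ominus> f) \<otimes> x" using c xR cx by (simp add: m_assoc[symmetric])
    also have "\<dots> = \<zero>"
      using fR xR fx by (simp add: a_minus_def l_distr l_minus m_assoc r_neg)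
    finally have "c \<in> J (x \<otimes> x)" using c by (simp add: J_def)
    then have "c \<in> J x" using J_eq by simp
    then have "c \<otimes> x = \<zero>" by (simp add: J_def)
    then show ?thesis using cx fR minus_eq_zero_iff by simp
  qed
  show ?thesis by (rule that[OF fR ff]) (use good in \<open>auto simp: good_def\<close>)
qed


section \<open>From vanishing extensions to a triangular decomposition\<close>

text \<open>
  Let \<open>f\<close> be a separating idempotent and \<open>e = 1 - f\<close>. Suppose that \<open>e R f\<close> is not zero and choose \<open>V\<close> maximal
  among the left ideals in \<open>R f\<close> that do not contain \<open>e R f\<close>. Then every left ideal in \<open>R f\<close> that
  strictly contains \<open>V\<close> contains \<open>e R f\<close>, so \<open>R f / V\<close> has a least nonzero submodule \<open>U / V\<close>. It
  is simple and not annihilated by \<open>e\<close>, hence in \<open>\<Y>\<close>; as \<open>f\<close> acts as zero on it but not on \<open>R f / V\<close>, it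
  is not everything. A simple submodule \<open>W / U\<close> of \<open>R f / U\<close> is annihilated by \<open>e\<close>, hence in \<open>\<X>\<close>. The
  extension \<open>W / V\<close> splits, which contradicts the minimality of \<open>U / V\<close>.
\<close>

lemma idempotent_corner_zero:
  fixes \<X> \<Y> :: "('a, 'a set) module set"
  assumes XY: "\<And>S. S \<in> \<X> \<union> \<Y> \<longleftrightarrow> simple_module R S"
    and Ext: "\<And>S T. \<lbrakk>S \<in> \<X>; T \<in> \<Y>\<rbrakk> \<Longrightarrow> carrier (Ext1 R S T) = {\<one>\<^bsub>Ext1 R S T\<^esub>}"
    and f: "f \<in> carrier R" "f \<otimes> f = f"
    and fX: "\<And>S s. \<lbrakk>S \<in> \<X>; s \<in> carrier S\<rbrakk> \<Longrightarrow> f \<odot>\<^bsub>S\<^esub> s = s"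
    and fY: "\<And>T t. \<lbrakk>T \<in> \<Y>; t \<in> carrier T\<rbrakk> \<Longrightarrow> f \<odot>\<^bsub>T\<^esub> t = \<zero>\<^bsub>T\<^esub>"
    and a: "a \<in> carrier R"
  shows "(\<one> \<ominus> f) \<otimes> a \<otimes> f = \<zero>"
proof (rule ccontr)
  assume nz: "(\<one> \<ominus> f) \<otimes> a \<otimes> f \<noteq> \<zero>"
  define e where "e = \<one> \<ominus> f"
  have e: "e \<in> carrier R" "e \<otimes> e = e" "\<And>x. x \<in> carrier R \<Longrightarrow> e \<otimes> x = x \<ominus> f \<otimes> x"
    using f by (auto simp: e_def a_minus_def l_distr l_minus r_distr r_minus r_neg minus_minus)
  define M where "M = (\<lambda>a. a \<otimes> f) ` carrier R"
  have M: "left_ideal R M"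
    unfolding M_def by (rule submodule_right_mult[OF reg.submodule_carrier f(1)])
  have fM: "f \<in> M" unfolding M_def using f by (intro image_eqI[of _ _ f]) auto
  define D where "D = (\<lambda>a. e \<otimes> a \<otimes> f) ` carrier R"
  have DM: "D \<subseteq> M" using e(1) by (auto simp: D_def M_def)
  have eM: "e \<otimes> x \<in> D" if "x \<in> M" for x
    using that e(1) f(1) by (auto simp: M_def D_def m_assoc)
  have eD: "e \<otimes> d = d" "d \<in> carrier R" if "d \<in> D" for d
  proof -
    from that obtain b where b: "b \<in> carrier R" "d = e \<otimes> b \<otimes> f" by (auto simp: D_def)
    show "d \<in> carrier R" using b e(1) f(1) by simp
    have "e \<otimes> d = (e \<otimes> e) \<otimes> b \<otimes> f" using b e(1) f(1) by (simp only: m_assoc m_closed)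
    then show "e \<otimes> d = d" using b(2) e(2) by simp
  qed
  \<comment> \<open>on a simple subquotient of \<open>R\<close>, one of \<open>e\<close> and \<open>f\<close> acts as zero\<close>
  have cases: "subquotient (regular_module R) W V \<in> \<X> \<and> (\<forall>w \<in> W. e \<otimes> w \<in> V) \<or>
      subquotient (regular_module R) W V \<in> \<Y> \<and> (\<forall>w \<in> W. f \<otimes> w \<in> V)"
    if V: "left_ideal R V" and W: "left_ideal R W" and VW: "V \<subset> W"
      and simple: "\<And>P. \<lbrakk>left_ideal R P; V \<subset> P; P \<subseteq> W\<rbrakk> \<Longrightarrow> P = W" for V W
  proof -
    let ?Q = "subquotient (regular_module R) W V"
    have WR: "w \<in> carrier R" if "w \<in> W" for w using reg.submoduleD(3)[OF W that] .
    have Q: "V +>\<^bsub>regular_module R\<^esub> w \<in> carrier ?Q"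
      "f \<odot>\<^bsub>?Q\<^esub> (V +>\<^bsub>regular_module R\<^esub> w) = V +>\<^bsub>regular_module R\<^esub> (f \<otimes> w)" if "w \<in> W" for w
      using that reg.subquotient_smult[OF V WR[OF that] f(1)] by auto
    have "?Q \<in> \<X> \<union> \<Y>" unfolding XY
      by (rule reg.simple_module_subquotient[OF V W VW simple])
    then show ?thesis
    proof
      assume QX: "?Q \<in> \<X>"
      have "e \<otimes> w \<in> V" if w: "w \<in> W" for w
      proof -
        have "V +>\<^bsub>regular_module R\<^esub> (f \<otimes> w) = V +>\<^bsub>regular_module R\<^esub> w"
          using fX[OF QX Q(1)[OF w]] Q(2)[OF w] by simp
        then have "w \<ominus>\<^bsub>regular_module R\<^esub> f \<otimes> w \<in> V"
          using reg.coset_eq_iff[OF V WR[OF w], of "f \<otimes> w"] f(1) WR[OF w] by simp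
        moreover have "w \<ominus>\<^bsub>regular_module R\<^esub> f \<otimes> w = e \<otimes> w"
        proof -
          have "w \<ominus>\<^bsub>regular_module R\<^esub> f \<otimes> w = w \<oplus> ((\<ominus> \<one>) \<otimes> (f \<otimes> w))"
            unfolding a_minus_def using reg.smult_minus_one[of "f \<otimes> w"] f(1) WR[OF w] by simp
          then show ?thesis using e(3)[OF WR[OF w]] f(1) WR[OF w] by (simp add: l_minus a_minus_def)
        qed
        ultimately show ?thesis by simp
      qed
      then show ?thesis using QX by blast
    next
      assume QY: "?Q \<in> \<Y>"
      have "f \<otimes> w \<in> V" if w: "w \<in> W" for w
      proof -
        have "V +>\<^bsub>regular_module R\<^esub> (f \<otimes> w) = V"
          using fY[OF QY Q(1)[OF w]] Q(2)[OF w] by simp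
        then show ?thesis using reg.coset_eq_self_iff[OF V] f(1) WR[OF w] by simp
      qed
      then show ?thesis using QY by blast
    qed
  qed
  have D0: "\<not> D \<subseteq> {\<zero>}" using nz a by (auto simp: D_def e_def)
  obtain V where V: "left_ideal R V \<and> V \<subseteq> M \<and> \<not> D \<subseteq> V"
    and V_max: "\<And>P. \<lbrakk>left_ideal R P \<and> P \<subseteq> M \<and> \<not> D \<subseteq> P; V \<subseteq> P\<rbrakk> \<Longrightarrow> P = V"
  proof (rule maximal_left_ideal[of "\<lambda>V. left_ideal R V \<and> V \<subseteq> M \<and> \<not> D \<subseteq> V" "{\<zero>}"])
    show "left_ideal R {\<zero>} \<and> {\<zero>} \<subseteq> M \<and> \<not> D \<subseteq> {\<zero>}"
      using reg.submodule_zero reg.submoduleD(2)[OF M] D0 by simp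
  qed auto
  have above_V: "D \<subseteq> P" if "left_ideal R P" "P \<subseteq> M" "V \<subset> P" for P
    using V_max[of P] that by blast
  obtain U where U: "left_ideal R U \<and> V \<subseteq> U \<and> U \<subseteq> M \<and> D \<subseteq> U"
    and U_min: "\<And>P. \<lbrakk>left_ideal R P \<and> V \<subseteq> P \<and> P \<subseteq> M \<and> D \<subseteq> P; P \<subseteq> U\<rbrakk> \<Longrightarrow> P = U"
    by (rule minimal_left_ideal[of "\<lambda>U. left_ideal R U \<and> V \<subseteq> U \<and> U \<subseteq> M \<and> D \<subseteq> U" M])
      (use V M DM in auto)
  have VU: "V \<subset> U" using U V by blast
  have U_simple: "P = U" if "left_ideal R P" "V \<subset> P" "P \<subseteq> U" for P
    using U_min[of P] above_V[of P] that U by blast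
  have "\<exists>u \<in> U. e \<otimes> u \<notin> V"
  proof -
    obtain d where "d \<in> D" "d \<notin> V" using V by blast
    then show ?thesis using U eD by (intro bexI[of _ d]) auto
  qed
  then have UY: "subquotient (regular_module R) U V \<in> \<Y>" "\<forall>u \<in> U. f \<otimes> u \<in> V"
    using cases[OF _ _ VU U_simple] U V by blast+
  have "f \<notin> U"
  proof
    assume "f \<in> U"
    then have fV: "f \<in> V" using UY(2) f(2) by fastforce
    have "M \<subseteq> V"
    proof
      fix x assume "x \<in> M"
      then obtain b where "b \<in> carrier R" "x = b \<otimes> f" by (auto simp: M_def)
      then show "x \<in> V" using reg.submoduleD(5)[of V b f] V fV by simp
    qed
    then show False using V DM by blast
  qed
  then have UM: "U \<subset> M" using U fM by blast
  obtain W where W: "left_ideal R W \<and> U \<subset> W \<and> W \<subseteq> M"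
    and W_min: "\<And>P. \<lbrakk>left_ideal R P \<and> U \<subset> P \<and> P \<subseteq> M; P \<subseteq> W\<rbrakk> \<Longrightarrow> P = W"
    by (rule minimal_left_ideal[of "\<lambda>W. left_ideal R W \<and> U \<subset> W \<and> W \<subseteq> M" M])
      (use UM M in auto)
  have W_simple: "P = W" if "left_ideal R P" "U \<subset> P" "P \<subseteq> W" for P
    using W_min[of P] that W by blast
  have WX: "subquotient (regular_module R) W U \<in> \<X>"
  proof (rule ccontr)
    assume "subquotient (regular_module R) W U \<notin> \<X>"
    then have fW: "\<forall>w \<in> W. f \<otimes> w \<in> U" using cases[of U W] U W W_simple by blast
    have "W \<subseteq> U"
    proof
      fix w assume w: "w \<in> W"
      then have wR: "w \<in> carrier R" using reg.submoduleD(3)[of W] W by blast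
      have "e \<otimes> w \<in> U" using eM w W U by blast
      then have "e \<otimes> w \<oplus> f \<otimes> w \<in> U" using fW w reg.submoduleD(4)[of U] U by blast
      moreover have "e \<otimes> w \<oplus> f \<otimes> w = w"
        using e(3)[OF wR] f(1) wR by (simp add: a_minus_def a_assoc l_neg)
      ultimately show "w \<in> U" by simp
    qed
    then show False using W by blast
  qed
  obtain P where P: "left_ideal R P" "V \<subseteq> P" "P \<subseteq> W" "P \<inter> U = V"
    and PU: "\<And>w. w \<in> W \<Longrightarrow> \<exists>p \<in> P. w \<ominus>\<^bsub>regular_module R\<^esub> p \<in> U"
    by (rule reg.Ext1_trivial_imp_relative_complement[OF _ _ _ _ _ Ext[OF WX UY(1)]])
      (use U V W in \<open>auto 0 3 intro: that\<close>)
  have "P = V"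
  proof (rule ccontr)
    assume "P \<noteq> V"
    then have "D \<subseteq> P" using above_V[of P] P W by blast
    then show False using P(4) U V by blast
  qed
  have "W \<subseteq> U"
  proof
    fix w assume w: "w \<in> W"
    then obtain p where p: "p \<in> U" "w \<ominus>\<^bsub>regular_module R\<^esub> p \<in> U" using PU \<open>P = V\<close> U by blast
    have "w \<in> carrier R" using reg.submoduleD(3)[of W] W w by blast
    then have "w = (w \<ominus>\<^bsub>regular_module R\<^esub> p) \<oplus> p"
      using reg.submoduleD(3)[of U p] U p(1) reg.M.l_neg[of p] reg.M.a_assoc[of w _ p]
      by (simp add: a_minus_def)
    then show "w \<in> U" using reg.submoduleD(4)[of U] U p by metis
  qed
  then show False using W by blast
qed

end


section \<open>Vertices of the Gabriel quiver\<close>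

lemma equiv_mod_iso:
  "equiv {S :: ('a, 'm) module. simple_module R S}
    {(S, T). simple_module R S \<and> simple_module R T \<and> mod_iso R S T}"
proof (rule equivI)
  show "refl_on {S :: ('a, 'm) module. simple_module R S}
    {(S, T). simple_module R S \<and> simple_module R T \<and> mod_iso R S T}"
    by (auto simp: refl_on_def intro: mod_iso_refl simple_moduleD(1))
  show "sym {(S :: ('a, 'm) module, T). simple_module R S \<and> simple_module R T \<and> mod_iso R S T}"
    by (auto simp: sym_def intro: mod_iso_sym simple_moduleD(1))
  show "trans {(S :: ('a, 'm) module, T). simple_module R S \<and> simple_module R T \<and> mod_iso R S T}"
    by (auto simp: trans_def intro: mod_iso_trans simple_moduleD(1))
qed auto

lemma gabriel_vertex_exists:
  "simple_module R S \<Longrightarrow> \<exists>i \<in> gabriel_vertices R. S \<in> i"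
  unfolding gabriel_vertices_def
  by (rule bexI[OF _ quotientI]) (auto intro: mod_iso_refl simple_moduleD(1))

lemma gabriel_vertex_simple:
  "\<lbrakk>i \<in> gabriel_vertices R; S \<in> i\<rbrakk> \<Longrightarrow> simple_module R S"
  unfolding gabriel_vertices_def by (auto elim: quotientE)

lemma gabriel_vertex_eq_iff:
  "\<lbrakk>i \<in> gabriel_vertices R; j \<in> gabriel_vertices R; S \<in> i; T \<in> j\<rbrakk> \<Longrightarrow> i = j \<longleftrightarrow> mod_iso R S T"
  using quotient_eq_iff[OF equiv_mod_iso, of i R j S T] gabriel_vertex_simple[of i R S]
    gabriel_vertex_simple[of j R T]
  unfolding gabriel_vertices_def by auto

lemma gabriel_vertex_nonempty: "i \<in> gabriel_vertices R \<Longrightarrow> \<exists>S. S \<in> i"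
  using in_quotient_imp_non_empty[OF equiv_mod_iso] unfolding gabriel_vertices_def by blast


section \<open>Stratifications and partitions of the vertices\<close>

context finite_length_ring
begin

text \<open>
  Only the first idempotent \<open>g\<close> of a stratification is needed: multiplying \<open>1\<close>, written as the sum of all
  idempotents, on the left by \<open>g a\<close> leaves \<open>g a = g a g\<close>. Conversely, an idempotent \<open>f\<close> with
  \<open>(1 - f) R f = 0\<close> gives the stratification \<open>1 - f, f\<close>.
\<close>

lemma directed_stratification_triangular:
  assumes "n \<ge> 2" and strat: "directed_stratification R n e"
  obtains g where "g \<in> carrier R" "g \<otimes> g = g" "g \<noteq> \<zero>" "g \<noteq> \<one>"
    "\<And>a. a \<in> carrier R \<Longrightarrow> g \<otimes> a \<otimes> g = g \<otimes> a"
proof -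
  have e: "e i \<in> carrier R" "e i \<noteq> \<zero>" "e i \<otimes> e i = e i" if "i \<in> {1..n}" for i
    using strat that by (auto simp: directed_stratification_def)
  have corner: "e 1 \<otimes> a \<otimes> e i = \<zero>" if "i \<in> {2..n}" "a \<in> carrier R" for i a
    using strat that assms(1) by (auto simp: directed_stratification_def)
  have "e 1 \<otimes> e 2 = \<zero>" using strat assms(1) by (auto simp: directed_stratification_def)
  then have "e 1 \<noteq> \<one>" using e[of 2] assms(1) by auto
  have e1: "e 1 \<in> carrier R" using e[of 1] assms(1) by simp
  have ec: "e \<in> {2..n} \<rightarrow> carrier R" using e by auto
  have "{1..n} = insert 1 {2..n}" using assms(1) by auto
  then have one: "\<one> = e 1 \<oplus> (\<Oplus>i\<in>{2..n}. e i)"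
    using strat e1 ec by (auto simp: directed_stratification_def finsum_insert)
  have "e 1 \<otimes> a \<otimes> e 1 = e 1 \<otimes> a" if a: "a \<in> carrier R" for a
  proof -
    have c: "e 1 \<otimes> a \<in> carrier R" using e1 a by simp
    have "(e 1 \<otimes> a) \<otimes> (\<Oplus>i\<in>{2..n}. e i) = (\<Oplus>i\<in>{2..n}. e 1 \<otimes> a \<otimes> e i)"
      by (rule finsum_rdistr[OF _ c ec]) simp
    also have "\<dots> = \<zero>" using corner[OF _ a] by (intro add.finprod_one_eqI)
    finally have "e 1 \<otimes> a \<otimes> (\<Oplus>i\<in>{2..n}. e i) = \<zero>" .
    then have "(e 1 \<otimes> a) \<otimes> (e 1 \<oplus> (\<Oplus>i\<in>{2..n}. e i)) = e 1 \<otimes> a \<otimes> e 1"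
      using c e1 ec by (simp add: r_distr)
    then show ?thesis using one[symmetric] c by simp
  qed
  then show ?thesis using that[of "e 1"] e[of 1] assms(1) \<open>e 1 \<noteq> \<one>\<close> by auto
qed

lemma triangular_imp_directed_stratification:
  assumes f: "f \<in> carrier R" "f \<otimes> f = f" "f \<noteq> \<zero>" "f \<noteq> \<one>"
    and corner: "\<And>a. a \<in> carrier R \<Longrightarrow> (\<one> \<ominus> f) \<otimes> a \<otimes> f = \<zero>"
  shows "has_nontrivial_directed_stratification R"
proof -
  define e where "e = \<one> \<ominus> f"
  have e: "e \<in> carrier R" "e \<otimes> e = e" "e \<otimes> f = \<zero>" "f \<otimes> e = \<zero>" "e \<oplus> f = \<one>"
    using f by (auto simp: e_def a_minus_def l_distr l_minus r_distr r_minus r_neg minus_minus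
        a_assoc l_neg)
  have e0: "e \<noteq> \<zero>" using f(1,4) minus_eq_zero_iff[of \<one> f] by (auto simp: e_def)
  define E where "E i = (if i = 1 then e else f)" for i :: nat
  have 12: "{1..2} = {1, 2::nat}" by auto
  have "directed_stratification R 2 E"
    unfolding directed_stratification_def 12 using e e0 f corner by (auto simp: E_def e_def[symmetric])
  then show ?thesis unfolding has_nontrivial_directed_stratification_def by blast
qed

text \<open>
  As \<open>g a g = g a\<close>, the kernel of the action of \<open>g\<close> is a submodule. If it is zero then \<open>g\<close> acts as the
  identity, because \<open>g\<close> annihilates \<open>g s - s\<close>.
\<close>

lemma triangular_idempotent_on_simple:
  assumes g: "g \<in> carrier R" "g \<otimes> g = g" "\<And>a. a \<in> carrier R \<Longrightarrow> g \<otimes> a \<otimes> g = g \<otimes> a"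
    and S: "simple_module R S"
  shows "(\<forall>s \<in> carrier S. g \<odot>\<^bsub>S\<^esub> s = \<zero>\<^bsub>S\<^esub>) \<or> (\<forall>s \<in> carrier S. g \<odot>\<^bsub>S\<^esub> s = s)"
proof -
  interpret S: left_module R S by (rule simple_moduleD(1)[OF S])
  let ?N = "{s \<in> carrier S. g \<odot>\<^bsub>S\<^esub> s = \<zero>\<^bsub>S\<^esub>}"
  have "submodule ?N R S"
  proof (rule S.submoduleI)
    fix a s assume a: "a \<in> carrier R" and s: "s \<in> ?N"
    have "g \<odot>\<^bsub>S\<^esub> (a \<odot>\<^bsub>S\<^esub> s) = (g \<otimes> a \<otimes> g) \<odot>\<^bsub>S\<^esub> s"
      using a s g(1) g(3)[OF a] by (simp add: S.smult_assoc1[symmetric])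
    also have "\<dots> = \<zero>\<^bsub>S\<^esub>" using a s g(1) by (simp add: S.smult_assoc1)
    finally show "a \<odot>\<^bsub>S\<^esub> s \<in> ?N" using a s by simp
  qed (use g(1) in \<open>auto simp: S.smult_r_distr\<close>)
  then consider "?N = carrier S" | "?N = {\<zero>\<^bsub>S\<^esub>}" using simple_moduleD(2)[OF S] by blast
  then show ?thesis
  proof cases
    case 2
    have "g \<odot>\<^bsub>S\<^esub> s = s" if s: "s \<in> carrier S" for s
    proof -
      have "g \<odot>\<^bsub>S\<^esub> (g \<odot>\<^bsub>S\<^esub> s \<ominus>\<^bsub>S\<^esub> s) = \<zero>\<^bsub>S\<^esub>"
        using g(1,2) s
        by (simp add: a_minus_def S.smult_r_distr S.smult_r_minus S.smult_assoc1[symmetric] S.M.r_neg)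
      then have "g \<odot>\<^bsub>S\<^esub> s \<ominus>\<^bsub>S\<^esub> s \<in> ?N" using g(1) s by simp
      then have "g \<odot>\<^bsub>S\<^esub> s \<ominus>\<^bsub>S\<^esub> s = \<zero>\<^bsub>S\<^esub>" unfolding 2 by simp
      then show ?thesis using S.M.minus_eq_zero_iff g(1) s by simp
    qed
    then show ?thesis by blast
  qed blast
qed

lemma stratification_imp_partition:
  assumes "has_nontrivial_directed_stratification R"
  shows "\<exists>Q' Q''. Q' \<noteq> {} \<and> Q'' \<noteq> {} \<and> Q' \<inter> Q'' = {} \<and>
       gabriel_vertices R = Q' \<union> Q'' \<and>
       (\<forall>i \<in> Q'. \<forall>j \<in> Q''. (i, j) \<notin> (gabriel_arrows R)\<^sup>*)"
proof -
  obtain n e where "n \<ge> 2" "directed_stratification R n e"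
    using assms unfolding has_nontrivial_directed_stratification_def by blast
  then obtain g where g: "g \<in> carrier R" "g \<otimes> g = g" "g \<noteq> \<zero>" "g \<noteq> \<one>"
    "\<And>a. a \<in> carrier R \<Longrightarrow> g \<otimes> a \<otimes> g = g \<otimes> a"
    by (rule directed_stratification_triangular) (rule that; assumption)
  define kills where "kills S \<longleftrightarrow> (\<forall>s \<in> carrier S. g \<odot>\<^bsub>S\<^esub> s = \<zero>\<^bsub>S\<^esub>)" for S :: "('a, 'a set) module"
  have kills_iso: "kills T" if S: "simple_module R S" and T: "simple_module R T"
    and iso: "mod_iso R S T" and k: "kills S" for S T
  proof -
    obtain h where h: "module_map R S T h" "bij_betw h (carrier S) (carrier T)"
      using iso by (rule mod_iso_E)
    have "g \<odot>\<^bsub>T\<^esub> h s = \<zero>\<^bsub>T\<^esub>" if "s \<in> carrier S" for s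
      using module_mapD(3)[OF h(1) g(1) that] k that
        module_map_zero[OF simple_moduleD(1)[OF S] simple_moduleD(1)[OF T] h(1)]
      by (simp add: kills_def)
    then show ?thesis
      unfolding kills_def bij_betw_imp_surj_on[OF h(2), symmetric] by auto
  qed
  define Q' where "Q' = {i \<in> gabriel_vertices R. \<exists>S \<in> i. kills S}"
  define Q'' where "Q'' = gabriel_vertices R - Q'"
  have Q': "kills S" if iQ: "i \<in> Q'" and Si: "S \<in> i" for i S
  proof -
    obtain T where T: "T \<in> i" "kills T" and i: "i \<in> gabriel_vertices R"
      using iQ unfolding Q'_def by blast
    have "mod_iso R T S" using gabriel_vertex_eq_iff[OF i i T(1) Si] by simp
    then show ?thesis
      using kills_iso T gabriel_vertex_simple[OF i T(1)] gabriel_vertex_simple[OF i Si] by blast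
  qed
  have Q'': "\<not> kills T" if "j \<in> Q''" "T \<in> j" for j T
    using that by (auto simp: Q''_def Q'_def)
  have no_arrow: "(i, j) \<notin> gabriel_arrows R" if i: "i \<in> Q'" and j: "j \<in> Q''" for i j
  proof
    assume "(i, j) \<in> gabriel_arrows R"
    then obtain S T where ST: "S \<in> i" "T \<in> j"
      and nz: "carrier (Ext1 R S T) \<noteq> {\<one>\<^bsub>Ext1 R S T\<^esub>}"
      and v: "i \<in> gabriel_vertices R" "j \<in> gabriel_vertices R"
      by (auto simp: gabriel_arrows_def)
    have S: "simple_module R S" and T: "simple_module R T"
      using gabriel_vertex_simple v ST by blast+
    have gT: "g \<odot>\<^bsub>T\<^esub> t = t" if "t \<in> carrier T" for t
      using triangular_idempotent_on_simple[OF g(1,2,5) T] Q''[OF j ST(2)] that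
      by (auto simp: kills_def)
    have "carrier (Ext1 R S T) = {\<one>\<^bsub>Ext1 R S T\<^esub>}"
      by (rule left_module.Ext1_trivial_of_idempotent[OF simple_moduleD(1)[OF S]
            simple_moduleD(1)[OF T] g(1,5)])
        (use Q'[OF i ST(1)] gT in \<open>auto simp: kills_def\<close>)
    then show False using nz by blast
  qed
  have stay: "j \<in> Q'" if "(i, j) \<in> (gabriel_arrows R)\<^sup>*" "i \<in> Q'" for i j
    using that
  proof (induction rule: rtrancl_induct)
    case (step j k)
    then have "k \<in> gabriel_vertices R" by (auto simp: gabriel_arrows_def)
    then show ?case using step no_arrow[of j k] by (auto simp: Q''_def)
  qed
  \<comment> \<open>both idempotents \<open>g\<close> and \<open>1 - g\<close> act as the identity somewhere\<close>
  obtain T :: "('a, 'a set) module" and t where T: "simple_module R T" "t \<in> carrier T"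
    "t \<noteq> \<zero>\<^bsub>T\<^esub>" "g \<odot>\<^bsub>T\<^esub> t = t"
    by (rule simple_module_fixed_by_idempotent[OF g(1-3)]) (rule that; assumption)
  have 1: "\<one> \<ominus> g \<in> carrier R" "(\<one> \<ominus> g) \<otimes> (\<one> \<ominus> g) = \<one> \<ominus> g" "g \<otimes> (\<one> \<ominus> g) = \<zero>"
    using g by (auto simp: a_minus_def l_distr l_minus r_distr r_minus r_neg minus_minus)
  have "\<one> \<ominus> g \<noteq> \<zero>" using g(1,4) minus_eq_zero_iff[of \<one> g] by auto
  then obtain S :: "('a, 'a set) module" and s where S: "simple_module R S" "s \<in> carrier S"
    "s \<noteq> \<zero>\<^bsub>S\<^esub>" "(\<one> \<ominus> g) \<odot>\<^bsub>S\<^esub> s = s"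
    by (rule simple_module_fixed_by_idempotent[OF 1(1,2)]) (rule that; assumption)
  interpret S: left_module R S by (rule simple_moduleD(1)[OF S(1)])
  have "g \<odot>\<^bsub>S\<^esub> s = (g \<otimes> (\<one> \<ominus> g)) \<odot>\<^bsub>S\<^esub> s"
    using S(2,4) g(1) 1(1) by (simp add: S.smult_assoc1)
  then have "g \<odot>\<^bsub>S\<^esub> s \<noteq> s" using S(2,3) 1(3) by simp
  then have "kills S"
    using triangular_idempotent_on_simple[OF g(1,2,5) S(1)] S(2) by (auto simp: kills_def)
  then have "Q' \<noteq> {}" using gabriel_vertex_exists[OF S(1)] by (auto simp: Q'_def)
  moreover have "\<not> kills T" using T by (auto simp: kills_def)
  then have "Q'' \<noteq> {}" using gabriel_vertex_exists[OF T(1)] Q' by (auto simp: Q''_def)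
  ultimately show ?thesis
    by (intro exI[of _ Q'] exI[of _ Q'']) (use stay in \<open>auto simp: Q'_def Q''_def\<close>)
qed

lemma partition_imp_stratification:
  assumes ne: "Q' \<noteq> {}" "Q'' \<noteq> {}" and disj: "Q' \<inter> Q'' = {}"
    and un: "gabriel_vertices R = Q' \<union> Q''"
    and no_path: "\<And>i j. \<lbrakk>i \<in> Q'; j \<in> Q''\<rbrakk> \<Longrightarrow> (i, j) \<notin> (gabriel_arrows R)\<^sup>*"
  shows "has_nontrivial_directed_stratification R"
proof -
  have XY: "S \<in> \<Union>Q' \<union> \<Union>Q'' \<longleftrightarrow> simple_module R S" for S
    using gabriel_vertex_exists[of R S] gabriel_vertex_simple[of _ R S] un by blast
  have not_iso: "\<not> mod_iso R S T" if "S \<in> \<Union>Q'" "T \<in> \<Union>Q''" for S T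
    using that gabriel_vertex_eq_iff[of _ R _ S T] un disj by blast
  have Ext: "carrier (Ext1 R S T) = {\<one>\<^bsub>Ext1 R S T\<^esub>}" if ST: "S \<in> \<Union>Q'" "T \<in> \<Union>Q''" for S T
  proof (rule ccontr)
    assume nz: "carrier (Ext1 R S T) \<noteq> {\<one>\<^bsub>Ext1 R S T\<^esub>}"
    obtain i j where ij: "i \<in> Q'" "S \<in> i" "j \<in> Q''" "T \<in> j" using ST by blast
    then have "(i, j) \<in> gabriel_arrows R" using nz un unfolding gabriel_arrows_def by blast
    then show False using no_path ij by blast
  qed
  obtain f where f: "f \<in> carrier R" "f \<otimes> f = f"
    "\<And>S s. \<lbrakk>S \<in> \<Union>Q'; s \<in> carrier S\<rbrakk> \<Longrightarrow> f \<odot>\<^bsub>S\<^esub> s = s"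
    "\<And>T t. \<lbrakk>T \<in> \<Union>Q''; t \<in> carrier T\<rbrakk> \<Longrightarrow> f \<odot>\<^bsub>T\<^esub> t = \<zero>\<^bsub>T\<^esub>"
    by (rule separating_idempotent[OF XY not_iso]; (assumption | (rule that; assumption)))
  obtain i j where ij: "i \<in> Q'" "j \<in> Q''" using ne by blast
  then have "i \<in> gabriel_vertices R" "j \<in> gabriel_vertices R" using un by auto
  then obtain S T where "S \<in> i" "T \<in> j" by (metis gabriel_vertex_nonempty)
  with ij have S: "S \<in> \<Union>Q'" and T: "T \<in> \<Union>Q''" by (metis UnionI)+
  have S': "simple_module R S" and T': "simple_module R T" using XY S T by blast+
  interpret S: left_module R S by (rule simple_moduleD(1)[OF S'])
  interpret T: left_module R T by (rule simple_moduleD(1)[OF T'])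
  obtain s where s: "s \<in> carrier S" "s \<noteq> \<zero>\<^bsub>S\<^esub>" using simple_moduleD(3)[OF S'] by blast
  obtain t where t: "t \<in> carrier T" "t \<noteq> \<zero>\<^bsub>T\<^esub>" using simple_moduleD(3)[OF T'] by blast
  show ?thesis
  proof (rule triangular_imp_directed_stratification[OF f(1,2)])
    show "f \<noteq> \<zero>" using f(3)[OF S s(1)] s S.smult_l_null[OF s(1)] by metis
    show "f \<noteq> \<one>" using f(4)[OF T t(1)] t T.smult_one[OF t(1)] by metis
    show "(\<one> \<ominus> f) \<otimes> a \<otimes> f = \<zero>" if "a \<in> carrier R" for a
      by (rule idempotent_corner_zero[OF XY Ext f that])
  qed
qed

end


theorem proposition2p6:
  fixes K :: "('k, 'p) ring_scheme" and A :: "('k, 'a, 'q) module_scheme"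
  assumes "fin_dim_algebra K A"
  shows "has_nontrivial_directed_stratification A \<longleftrightarrow>
    (\<exists>Q' Q''. Q' \<noteq> {} \<and> Q'' \<noteq> {} \<and> Q' \<inter> Q'' = {} \<and>
       gabriel_vertices A = Q' \<union> Q'' \<and>
       (\<forall>i \<in> Q'. \<forall>j \<in> Q''. (i, j) \<notin> (gabriel_arrows A)\<^sup>*))"
proof -
  obtain len where "finite_length_ring A len"
    using fin_dim_algebra.finite_length_ring_exists[OF assms] by blast
  then interpret finite_length_ring A len .
  show ?thesis
  proof
    assume "has_nontrivial_directed_stratification A"
    then show "\<exists>Q' Q''. Q' \<noteq> {} \<and> Q'' \<noteq> {} \<and> Q' \<inter> Q'' = {} \<and>
       gabriel_vertices A = Q' \<union> Q'' \<and>
       (\<forall>i \<in> Q'. \<forall>j \<in> Q''. (i, j) \<notin> (gabriel_arrows A)\<^sup>*)"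
      by (rule stratification_imp_partition)
  qed (elim exE conjE, rule partition_imp_stratification, auto)
qed

end
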